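(* Let $n>1$, let $\lambda\in\Bbbk$ be a primitive $n$th root of unity, $H=H_n(\lambda)$, and let $\mu\in\Bbbk^\times$. Let $A=\Bbbk_\mu[u,v]$ or $A=A_1^\mu$, and suppose $H$ acts linearly and inner faithfully on $A$. If $\mu$ has multiplicative order $n$, then $\mathcal{Z}(A\#H)=A^H=\Bbbk[u^n,v^n]$, where $A$ is identified with the subalgebra $A\#1$ of $A\#H$.
   Context: $\Bbbk$ is an algebraically closed field of characteristic zero; all algebras are $\Bbbk$-algebras; $\mathcal{Z}$ denotes center. $\Bbbk_\mu[u,v]=\Bbbk\langle u,v\mid uv-\mu vu\rangle$ (quantum plane); $A_1^\mu=\Bbbk\langle u,v\mid uv-\mu vu-1\rangle$ (quantum Weyl algebra). $\Bbbk[u^n,v^n]$ is the subalgebra of $A$ generated by $u^n$ and $v^n$. The Taft algebra $H_n(\lambda)$ is the Hopf algebra generated by $g,x$ with relations $g^n=1$, $x^n=0$, $xg=\lambda gx$, and $\Delta(g)=g\otimes g$, $\Delta(x)=g\otimes x+x\otimes 1$, $\varepsilon(g)=1$, $\varepsilon(x)=0$, $S(g)=g^{n-1}$, $S(x)=-g^{n-1}x$. $H$ acts on $A$ if $A$ is a left $H$-module with $h\cdot 1=\varepsilon(h)1$ and $h\cdot(rr')=\sum(h_1\cdot r)(h_2\cdot r')$. The action is inner faithful if no nonzero Hopf ideal of $H$ annihilates $A$, and linear if $g(u),g(v),x(u),x(v)\in\Bbbk u+\Bbbk v$. The smash product $A\#H$ is $A\otimes H$ as a vector space, with multiplication $(r\#h)(r'\#h')=\sum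 r(h_1\cdot r')\#h_2h'$. $A^H=\{r\in A: h(r)=\varepsilon(h)r\ \forall h\in H\}$. *)

theory Defs
  imports
    "HOL-Algebra.QuotRing"
    "HOL-Algebra.Subrings"
    "HOL-Algebra.Module"
    "HOL-Library.Poly_Mapping"
    "HOL-Computational_Algebra.Polynomial"
begin

text \<open>
  The base field is a type \<open>'k\<close>; algebras over it are records of type \<open>('k, 'a) module\<close>
  with explicit carriers, since the presentations depend on the parameters
  \<open>\<mu>\<close>, \<open>\<lambda>\<close> and \<open>n\<close>.
\<close>

text \<open>The primitive \<open>n\<close>th roots of unity are the elements of multiplicative order \<open>n\<close>.\<close>
definition has_mult_order :: "'k::field \<Rightarrow> nat \<Rightarrow> bool" where
  "has_mult_order z n \<longleftrightarrow> 0 < n \<and> z ^ n = 1 \<and> (\<forall>m. 0 < m \<and> m < n \<longrightarrow> z ^ m \<noteq> 1)"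


subsection \<open>Linear combinations, quotients, generated subalgebras\<close>

definition lin_ext ::
  "('k::field, 'a, 'c) module_scheme \<Rightarrow> ('x \<Rightarrow> 'a) \<Rightarrow> ('x \<Rightarrow>\<^sub>0 'k) \<Rightarrow> 'a" where
  "lin_ext V f p = (\<Oplus>\<^bsub>V\<^esub>x\<in>Poly_Mapping.keys p. Poly_Mapping.lookup p x \<odot>\<^bsub>V\<^esub> f x)"

definition lin_span :: "('k::field, 'a, 'c) module_scheme \<Rightarrow> 'a set \<Rightarrow> 'a set" where
  "lin_span V S = {lin_ext V (\<lambda>x. x) p | p. Poly_Mapping.keys p \<subseteq> S}"

definition quot_alg :: "('k, 'a, 'c) module_scheme \<Rightarrow> 'a set \<Rightarrow> ('k, 'a set) module" where
  "quot_alg M I =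
    \<lparr>carrier = carrier (M Quot I), monoid.mult = monoid.mult (M Quot I), one = one (M Quot I),
     zero = zero (M Quot I), add = add (M Quot I),
     module.smult = (\<lambda>c Q. set_add M I ((\<lambda>a. c \<odot>\<^bsub>M\<^esub> a) ` Q))\<rparr>"

definition subalgebra :: "'a set \<Rightarrow> ('k, 'a, 'c) module_scheme \<Rightarrow> bool" where
  "subalgebra B A \<longleftrightarrow> subring B A \<and> (\<forall>c. \<forall>b\<in>B. c \<odot>\<^bsub>A\<^esub> b \<in> B)"

definition gen_subalgebra :: "('k, 'a, 'c) module_scheme \<Rightarrow> 'a set \<Rightarrow> 'a set" where
  "gen_subalgebra A S = \<Inter>{B. subalgebra B A \<and> S \<subseteq> B}"

definition alg_center :: "('a, 'c) monoid_scheme \<Rightarrow> 'a set" where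
  "alg_center A = {z \<in> carrier A. \<forall>a\<in>carrier A. z \<otimes>\<^bsub>A\<^esub> a = a \<otimes>\<^bsub>A\<^esub> z}"


subsection \<open>Monoid algebras, free algebras, presentations\<close>

definition monoid_alg :: "('m, 'c) monoid_scheme \<Rightarrow> ('k::field, 'm \<Rightarrow>\<^sub>0 'k) module" where
  "monoid_alg M =
    \<lparr>carrier = {p. Poly_Mapping.keys p \<subseteq> carrier M},
     monoid.mult = (\<lambda>p q. \<Sum>a\<in>Poly_Mapping.keys p. \<Sum>b\<in>Poly_Mapping.keys q.
        Poly_Mapping.single (a \<otimes>\<^bsub>M\<^esub> b) (Poly_Mapping.lookup p a * Poly_Mapping.lookup q b)),
     one = Poly_Mapping.single \<one>\<^bsub>M\<^esub> 1,
     zero = 0,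
     add = (+),
     module.smult = (\<lambda>c. Poly_Mapping.map ((*) c))\<rparr>"

definition word_monoid :: "'g list monoid" where
  "word_monoid = \<lparr>carrier = UNIV, monoid.mult = (@), one = []\<rparr>"

definition free_alg :: "('k::field, 'g list \<Rightarrow>\<^sub>0 'k) module" where
  "free_alg = monoid_alg word_monoid"

definition presented_alg ::
  "('g list \<Rightarrow>\<^sub>0 'k::field) set \<Rightarrow> ('k, ('g list \<Rightarrow>\<^sub>0 'k) set) module" where
  "presented_alg R = quot_alg free_alg (Idl\<^bsub>free_alg\<^esub> R)"

definition presented_gen ::
  "('g list \<Rightarrow>\<^sub>0 'k::field) set \<Rightarrow> 'g \<Rightarrow> ('g list \<Rightarrow>\<^sub>0 'k) set" where
  "presented_gen R s = Idl\<^bsub>free_alg\<^esub> R +>\<^bsub>free_alg\<^esub> Poly_Mapping.single [s] 1"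

text \<open>
  The algebra homomorphism from a presented algebra to \<open>B\<close> with prescribed values \<open>f\<close> on the
  generators: evaluate any representative of the coset \<open>Q\<close>. It is meaningful when \<open>f\<close> respects
  the defining relations, so that the image of \<open>Q\<close> is a singleton.
\<close>
definition alg_lift ::
  "('k::field, 'b, 'c) module_scheme \<Rightarrow> ('g \<Rightarrow> 'b) \<Rightarrow> ('g list \<Rightarrow>\<^sub>0 'k) set \<Rightarrow> 'b" where
  "alg_lift B f Q =
    the_elem (lin_ext B (\<lambda>w. foldr (\<lambda>s b. f s \<otimes>\<^bsub>B\<^esub> b) w \<one>\<^bsub>B\<^esub>) ` Q)"

definition scalar_alg :: "('k::field, 'k) module" where
  "scalar_alg = \<lparr>carrier = UNIV, monoid.mult = (*), one = 1, zero = 0, add = (+), module.smult = (*)\<rparr>"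

definition opposite_alg :: "('k, 'a) module \<Rightarrow> ('k, 'a) module" where
  "opposite_alg A = A\<lparr>monoid.mult := \<lambda>a b. b \<otimes>\<^bsub>A\<^esub> a\<rparr>"


subsection \<open>Tensor products\<close>

text \<open>
  The vector space with basis \<open>carrier A \<times> carrier B\<close> modulo the bilinearity relations. Its
  componentwise multiplication is inherited from the monoid algebra of the product monoid.
\<close>
definition tensor_rels ::
  "('k::field, 'a, 'c) module_scheme \<Rightarrow> ('k, 'b, 'd) module_scheme \<Rightarrow> ('a \<times> 'b \<Rightarrow>\<^sub>0 'k) set" where
  "tensor_rels A B =
     {Poly_Mapping.single (a \<oplus>\<^bsub>A\<^esub> a', b) 1 - Poly_Mapping.single (a, b) 1
        - Poly_Mapping.single (a', b) 1 | a a' b.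
        a \<in> carrier A \<and> a' \<in> carrier A \<and> b \<in> carrier B}
   \<union> {Poly_Mapping.single (a, b \<oplus>\<^bsub>B\<^esub> b') 1 - Poly_Mapping.single (a, b) 1
        - Poly_Mapping.single (a, b') 1 | a b b'.
        a \<in> carrier A \<and> b \<in> carrier B \<and> b' \<in> carrier B}
   \<union> {Poly_Mapping.single (c \<odot>\<^bsub>A\<^esub> a, b) 1 - Poly_Mapping.single (a, b) c | c a b.
        a \<in> carrier A \<and> b \<in> carrier B}
   \<union> {Poly_Mapping.single (a, c \<odot>\<^bsub>B\<^esub> b) 1 - Poly_Mapping.single (a, b) c | c a b.
        a \<in> carrier A \<and> b \<in> carrier B}"

definition tensor_null ::
  "('k::field, 'a, 'c) module_scheme \<Rightarrow> ('k, 'b, 'd) module_scheme \<Rightarrow> ('a \<times> 'b \<Rightarrow>\<^sub>0 'k) set" where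
  "tensor_null A B = lin_span (monoid_alg (A \<times>\<times> B)) (tensor_rels A B)"

definition tensor_alg ::
  "('k::field, 'a, 'c) module_scheme \<Rightarrow> ('k, 'b, 'd) module_scheme
    \<Rightarrow> ('k, ('a \<times> 'b \<Rightarrow>\<^sub>0 'k) set) module" where
  "tensor_alg A B = quot_alg (monoid_alg (A \<times>\<times> B)) (tensor_null A B)"

definition pure_tensor ::
  "('k::field, 'a, 'c) module_scheme \<Rightarrow> ('k, 'b, 'd) module_scheme
    \<Rightarrow> 'a \<Rightarrow> 'b \<Rightarrow> ('a \<times> 'b \<Rightarrow>\<^sub>0 'k) set" where
  "pure_tensor A B a b =
    tensor_null A B +>\<^bsub>monoid_alg (A \<times>\<times> B)\<^esub> Poly_Mapping.single (a, b) 1"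

text \<open>
  The linear map from a tensor product to \<open>V\<close> induced by a bilinear map \<open>\<beta>\<close>. Applied to
  \<open>\<Delta>(h)\<close> it is Sweedler notation: \<open>tensor_lift V \<beta> (\<Delta>(h))\<close> stands for the sum of the
  \<open>\<beta>(h\<^sub>1, h\<^sub>2)\<close>.
\<close>
definition tensor_lift ::
  "('k::field, 'v, 'c) module_scheme \<Rightarrow> ('a \<Rightarrow> 'b \<Rightarrow> 'v) \<Rightarrow> ('a \<times> 'b \<Rightarrow>\<^sub>0 'k) set \<Rightarrow> 'v" where
  "tensor_lift V \<beta> Q = the_elem (lin_ext V (\<lambda>(a, b). \<beta> a b) ` Q)"


subsection \<open>Hopf algebras and their actions\<close>

record (overloaded) ('k, 'h) hopf_alg = "('k, 'h) module" +
  comult :: "'h \<Rightarrow> ('h \<times> 'h \<Rightarrow>\<^sub>0 'k) set"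
  counit :: "'h \<Rightarrow> 'k"
  antipode :: "'h \<Rightarrow> 'h"

definition hopf_ideal :: "'h set \<Rightarrow> ('k::field, 'h) hopf_alg \<Rightarrow> bool" where
  "hopf_ideal I H \<longleftrightarrow>
     ideal I H \<and>
     (\<forall>h\<in>I. comult H h \<in> lin_span (tensor_alg H H)
        ({pure_tensor H H a b | a b. a \<in> I \<and> b \<in> carrier H}
         \<union> {pure_tensor H H a b | a b. a \<in> carrier H \<and> b \<in> I})) \<and>
     (\<forall>h\<in>I. counit H h = 0) \<and>
     (\<forall>h\<in>I. antipode H h \<in> I)"

locale hopf_action =
  fixes H :: "('k::field, 'h) hopf_alg"
    and A :: "('k, 'a) module"
    and act :: "'h \<Rightarrow> 'a \<Rightarrow> 'a"
  assumes act_closed: "\<lbrakk>h \<in> carrier H; r \<in> carrier A\<rbrakk> \<Longrightarrow> act h r \<in> carrier A"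
    and act_add_left: "\<lbrakk>h \<in> carrier H; h' \<in> carrier H; r \<in> carrier A\<rbrakk>
          \<Longrightarrow> act (h \<oplus>\<^bsub>H\<^esub> h') r = act h r \<oplus>\<^bsub>A\<^esub> act h' r"
    and act_add_right: "\<lbrakk>h \<in> carrier H; r \<in> carrier A; r' \<in> carrier A\<rbrakk>
          \<Longrightarrow> act h (r \<oplus>\<^bsub>A\<^esub> r') = act h r \<oplus>\<^bsub>A\<^esub> act h r'"
    and act_smult_left: "\<lbrakk>h \<in> carrier H; r \<in> carrier A\<rbrakk>
          \<Longrightarrow> act (c \<odot>\<^bsub>H\<^esub> h) r = c \<odot>\<^bsub>A\<^esub> act h r"
    and act_smult_right: "\<lbrakk>h \<in> carrier H; r \<in> carrier A\<rbrakk>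
          \<Longrightarrow> act h (c \<odot>\<^bsub>A\<^esub> r) = c \<odot>\<^bsub>A\<^esub> act h r"
    and act_one: "r \<in> carrier A \<Longrightarrow> act \<one>\<^bsub>H\<^esub> r = r"
    and act_mult: "\<lbrakk>h \<in> carrier H; h' \<in> carrier H; r \<in> carrier A\<rbrakk>
          \<Longrightarrow> act (h \<otimes>\<^bsub>H\<^esub> h') r = act h (act h' r)"
    and act_unit: "h \<in> carrier H \<Longrightarrow> act h \<one>\<^bsub>A\<^esub> = counit H h \<odot>\<^bsub>A\<^esub> \<one>\<^bsub>A\<^esub>"
    and act_prod: "\<lbrakk>h \<in> carrier H; r \<in> carrier A; r' \<in> carrier A\<rbrakk>
          \<Longrightarrow> act h (r \<otimes>\<^bsub>A\<^esub> r')
            = tensor_lift A (\<lambda>h1 h2. act h1 r \<otimes>\<^bsub>A\<^esub> act h2 r') (comult H h)"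

definition inner_faithful ::
  "('k::field, 'h) hopf_alg \<Rightarrow> ('k, 'a) module \<Rightarrow> ('h \<Rightarrow> 'a \<Rightarrow> 'a) \<Rightarrow> bool" where
  "inner_faithful H A act \<longleftrightarrow>
     \<not> (\<exists>I. hopf_ideal I H \<and> I \<noteq> {\<zero>\<^bsub>H\<^esub>} \<and> (\<forall>h\<in>I. \<forall>r\<in>carrier A. act h r = \<zero>\<^bsub>A\<^esub>))"

definition invariants ::
  "('k::field, 'h) hopf_alg \<Rightarrow> ('k, 'a) module \<Rightarrow> ('h \<Rightarrow> 'a \<Rightarrow> 'a) \<Rightarrow> 'a set" where
  "invariants H A act =
     {r \<in> carrier A. \<forall>h\<in>carrier H. act h r = counit H h \<odot>\<^bsub>A\<^esub> r}"

text \<open>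
  The multiplication is the bilinear extension of
  \<open>(r # h)(r' # h') = \<Sum> r (h\<^sub>1 \<cdot> r') # h\<^sub>2 h'\<close>.
\<close>
definition smash_product ::
  "('k::field, 'a) module \<Rightarrow> ('k, 'h) hopf_alg \<Rightarrow> ('h \<Rightarrow> 'a \<Rightarrow> 'a)
    \<Rightarrow> ('k, ('a \<times> 'h \<Rightarrow>\<^sub>0 'k) set) module" where
  "smash_product A H act = (tensor_alg A H)
    \<lparr>monoid.mult := \<lambda>Q Q'.
       tensor_lift (tensor_alg A H) (\<lambda>r h.
         tensor_lift (tensor_alg A H) (\<lambda>r' h'.
           tensor_lift (tensor_alg A H) (\<lambda>h1 h2.
             pure_tensor A H (r \<otimes>\<^bsub>A\<^esub> act h1 r') (h2 \<otimes>\<^bsub>H\<^esub> h')) (comult H h)) Q') Q\<rparr>"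


subsection \<open>The Taft algebras, the quantum planes and the quantum Weyl algebras\<close>

datatype taft_sym = SymG | SymX

definition taft_rels :: "nat \<Rightarrow> 'k::field \<Rightarrow> (taft_sym list \<Rightarrow>\<^sub>0 'k) set" where
  "taft_rels n lam =
    {Poly_Mapping.single (replicate n SymG) 1 - Poly_Mapping.single [] 1,
     Poly_Mapping.single (replicate n SymX) 1,
     Poly_Mapping.single [SymX, SymG] 1 - Poly_Mapping.single [SymG, SymX] lam}"

abbreviation taft_g :: "nat \<Rightarrow> 'k::field \<Rightarrow> (taft_sym list \<Rightarrow>\<^sub>0 'k) set" where
  "taft_g n lam \<equiv> presented_gen (taft_rels n lam) SymG"

abbreviation taft_x :: "nat \<Rightarrow> 'k::field \<Rightarrow> (taft_sym list \<Rightarrow>\<^sub>0 'k) set" where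
  "taft_x n lam \<equiv> presented_gen (taft_rels n lam) SymX"

text \<open>
  Comultiplication and counit are algebra homomorphisms and the antipode is an
  antihomomorphism, so each is given by its values on \<open>g\<close> and \<open>x\<close>.
\<close>
definition taft_hopf ::
  "nat \<Rightarrow> 'k::field \<Rightarrow> ('k, (taft_sym list \<Rightarrow>\<^sub>0 'k) set) hopf_alg" where
  "taft_hopf n lam =
    (let H = presented_alg (taft_rels n lam); g = taft_g n lam; x = taft_x n lam in
     \<lparr>carrier = carrier H, monoid.mult = monoid.mult H, one = one H, zero = zero H, add = add H,
      module.smult = module.smult H,
      comult = alg_lift (tensor_alg H H) (\<lambda>s. case s of
          SymG \<Rightarrow> pure_tensor H H g g
        | SymX \<Rightarrow> pure_tensor H H g x \<oplus>\<^bsub>tensor_alg H H\<^esub> pure_tensor H H x \<one>\<^bsub>H\<^esub>),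
      counit = alg_lift scalar_alg (\<lambda>s. case s of SymG \<Rightarrow> 1 | SymX \<Rightarrow> 0),
      antipode = alg_lift (opposite_alg H) (\<lambda>s. case s of
          SymG \<Rightarrow> g [^]\<^bsub>H\<^esub> (n - 1)
        | SymX \<Rightarrow> \<ominus>\<^bsub>H\<^esub> (g [^]\<^bsub>H\<^esub> (n - 1) \<otimes>\<^bsub>H\<^esub> x))\<rparr>)"

datatype plane_sym = SymU | SymV

definition quantum_plane_rels :: "'k::field \<Rightarrow> (plane_sym list \<Rightarrow>\<^sub>0 'k) set" where
  "quantum_plane_rels \<mu> =
    {Poly_Mapping.single [SymU, SymV] 1 - Poly_Mapping.single [SymV, SymU] \<mu>}"

definition quantum_weyl_rels :: "'k::field \<Rightarrow> (plane_sym list \<Rightarrow>\<^sub>0 'k) set" where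
  "quantum_weyl_rels \<mu> =
    {Poly_Mapping.single [SymU, SymV] 1 - Poly_Mapping.single [SymV, SymU] \<mu>
      - Poly_Mapping.single [] 1}"

definition linear_action ::
  "('k::field, 'a) module \<Rightarrow> 'h set \<Rightarrow> 'a set \<Rightarrow> ('h \<Rightarrow> 'a \<Rightarrow> 'a) \<Rightarrow> bool" where
  "linear_action A G V act \<longleftrightarrow> (\<forall>h\<in>G. \<forall>r\<in>V. act h r \<in> lin_span A V)"

end

(*
  Linearity and the relations of the Taft algebra leave, besides x = 0 (excluded by inner
  faithfulness), only the action  g u = mu u,  g v = lam mu v,  x u = 0,  x v = r u  with r nonzero,
  up to exchanging u and v, which replaces mu by 1 / mu.  Both algebras have the basis u^i v^j, and
  commutators only produce lower terms on the diagonal i - j = const.  Let (p, q) be the last place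
  on its diagonal where an element a has a nonzero coefficient: x a = 0 forces n | q, and then
  g a = a forces n | p.  Hence the invariants are spanned by the u^(n k) v^(n l), which are central.
  Write a central element of the smash product as the sum of the a_ij # g^i x^j and let j be maximal
  with a_ij nonzero.  Commuting with u, v and g twists a_ij by powers of mu, lam mu and lam, and
  comparing the three twists on a last coefficient gives lam^j = 1, so j = 0; commuting with x then
  gives n | i.
  The Hopf structure maps of the Taft algebra are well defined because the Gaussian binomial
  coefficients at a primitive nth root of unity vanish, so that Delta(x)^n = 0.
*)

theory Submission
  imports Defs
begin

text \<open>All objects are quotients of free ones, and maps out of them take
  \<open>the_elem\<close> of the image of a coset, so nothing can be computed before universal
  properties and bases are available. Linear independence is never argued inside the quotients: A
  and the Taft algebra act on functions on pairs of naturals, and the values of the image of one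
  fixed function give coefficient functionals dual to the monomials. Later arguments compare such
  coefficients. Both algebras are treated at once as uv = \<mu> vu + \<epsilon>, with \<epsilon>
  arbitrary because exchanging u and v turns it into -\<epsilon>/\<mu>. That the twists force
  \<open>lam^j = 1\<close> rests on \<mu> and \<open>lam\<close> having the same order n: an
  equality between powers of \<mu> transfers to the same powers of \<open>lam\<close>. In the
  reduction of linear actions, \<open>lam\<close> \<noteq> 1 makes x antidiagonal once g is
  diagonal. A g exchanging the two lines requires \<mu> = -1 and n = 2; both entries of x being
  nonzero requires n = 2, against x^2 = 0.\<close>

section \<open>Vector spaces and algebras over the field type, linear maps and spans\<close>

locale kspace = abelian_group V for V :: "('k::field, 'a, 'c) module_scheme" (structure) +
  assumes smult_closed [simp, intro]: "a \<in> carrier V \<Longrightarrow> c \<odot> a \<in> carrier V"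
    and smult_r_distr: "\<lbrakk>a \<in> carrier V; b \<in> carrier V\<rbrakk> \<Longrightarrow> c \<odot> (a \<oplus> b) = c \<odot> a \<oplus> c \<odot> b"
    and smult_l_distr: "a \<in> carrier V \<Longrightarrow> (c + d) \<odot> a = c \<odot> a \<oplus> d \<odot> a"
    and smult_smult: "a \<in> carrier V \<Longrightarrow> c \<odot> (d \<odot> a) = (c * d) \<odot> a"
    and smult_one [simp]: "a \<in> carrier V \<Longrightarrow> 1 \<odot> a = a"

locale kalgebra = ring A + kspace A for A :: "('k::field, 'a, 'c) module_scheme" (structure) +
  assumes smult_mult_left: "\<lbrakk>a \<in> carrier A; b \<in> carrier A\<rbrakk> \<Longrightarrow> (c \<odot> a) \<otimes> b = c \<odot> (a \<otimes> b)"
    and smult_mult_right: "\<lbrakk>a \<in> carrier A; b \<in> carrier A\<rbrakk> \<Longrightarrow> a \<otimes> (c \<odot> b) = c \<odot> (a \<otimes> b)"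

text \<open>The scalars produce additive inverses: (-1)a + a = (-1 + 1)a = 0a, and the last
  assumption says that this is zero.\<close>

lemma kspaceI:
  fixes V :: "('k::field, 'a, 'c) module_scheme" (structure)
  assumes "\<And>a b. \<lbrakk>a \<in> carrier V; b \<in> carrier V\<rbrakk> \<Longrightarrow> a \<oplus> b \<in> carrier V" "\<zero> \<in> carrier V"
    and "\<And>a b d. \<lbrakk>a \<in> carrier V; b \<in> carrier V; d \<in> carrier V\<rbrakk> \<Longrightarrow> a \<oplus> b \<oplus> d = a \<oplus> (b \<oplus> d)"
    and comm: "\<And>a b. \<lbrakk>a \<in> carrier V; b \<in> carrier V\<rbrakk> \<Longrightarrow> a \<oplus> b = b \<oplus> a"
    and "\<And>a. a \<in> carrier V \<Longrightarrow> \<zero> \<oplus> a = a"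
    and closed: "\<And>c a. a \<in> carrier V \<Longrightarrow> c \<odot> a \<in> carrier V"
    and "\<And>c a b. \<lbrakk>a \<in> carrier V; b \<in> carrier V\<rbrakk> \<Longrightarrow> c \<odot> (a \<oplus> b) = c \<odot> a \<oplus> c \<odot> b"
    and distr: "\<And>c d a. a \<in> carrier V \<Longrightarrow> (c + d) \<odot> a = c \<odot> a \<oplus> d \<odot> a"
    and "\<And>c d a. a \<in> carrier V \<Longrightarrow> c \<odot> (d \<odot> a) = (c * d) \<odot> a"
    and one: "\<And>a. a \<in> carrier V \<Longrightarrow> 1 \<odot> a = a" and zero: "\<And>a. a \<in> carrier V \<Longrightarrow> 0 \<odot> a = \<zero>"
  shows "kspace V"
proof -
  have "\<exists>b\<in>carrier V. b \<oplus> a = \<zero>" if "a \<in> carrier V" for a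
    using distr[OF that, of "- 1" 1] closed[OF that, of "- 1"] by (auto simp: one[OF that] zero[OF that])
  then have "abelian_group V" using assms by (intro abelian_groupI) auto
  then show ?thesis using assms by (intro kspace.intro kspace_axioms.intro) auto
qed

lemma kalgebraI:
  fixes A :: "('k::field, 'a, 'c) module_scheme" (structure)
  assumes "kspace A" "\<one> \<in> carrier A"
    and "\<And>a b. \<lbrakk>a \<in> carrier A; b \<in> carrier A\<rbrakk> \<Longrightarrow> a \<otimes> b \<in> carrier A"
    and "\<And>a b d. \<lbrakk>a \<in> carrier A; b \<in> carrier A; d \<in> carrier A\<rbrakk> \<Longrightarrow> a \<otimes> b \<otimes> d = a \<otimes> (b \<otimes> d)"
    and "\<And>a. a \<in> carrier A \<Longrightarrow> \<one> \<otimes> a = a" "\<And>a. a \<in> carrier A \<Longrightarrow> a \<otimes> \<one> = a"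
    and "\<And>a b d. \<lbrakk>a \<in> carrier A; b \<in> carrier A; d \<in> carrier A\<rbrakk> \<Longrightarrow> (a \<oplus> b) \<otimes> d = a \<otimes> d \<oplus> b \<otimes> d"
    and "\<And>a b d. \<lbrakk>a \<in> carrier A; b \<in> carrier A; d \<in> carrier A\<rbrakk> \<Longrightarrow> d \<otimes> (a \<oplus> b) = d \<otimes> a \<oplus> d \<otimes> b"
    and "\<And>c a b. \<lbrakk>a \<in> carrier A; b \<in> carrier A\<rbrakk> \<Longrightarrow> (c \<odot> a) \<otimes> b = c \<odot> (a \<otimes> b)"
    and "\<And>c a b. \<lbrakk>a \<in> carrier A; b \<in> carrier A\<rbrakk> \<Longrightarrow> a \<otimes> (c \<odot> b) = c \<odot> (a \<otimes> b)"
  shows "kalgebra A"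
  using assms
  by (intro kalgebra.intro kalgebra_axioms.intro ringI monoidI kspace.axioms(1)[OF assms(1)]) auto

definition linear_on ::
  "('k::field, 'a, 'c) module_scheme \<Rightarrow> ('k, 'b, 'd) module_scheme \<Rightarrow> ('a \<Rightarrow> 'b) \<Rightarrow> bool" where
  "linear_on V W f \<longleftrightarrow>
     (\<forall>a\<in>carrier V. f a \<in> carrier W) \<and>
     (\<forall>a\<in>carrier V. \<forall>b\<in>carrier V. f (a \<oplus>\<^bsub>V\<^esub> b) = f a \<oplus>\<^bsub>W\<^esub> f b) \<and>
     (\<forall>c. \<forall>a\<in>carrier V. f (c \<odot>\<^bsub>V\<^esub> a) = c \<odot>\<^bsub>W\<^esub> f a)"

definition subspace_of :: "'a set \<Rightarrow> ('k::field, 'a, 'c) module_scheme \<Rightarrow> bool" where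
  "subspace_of U V \<longleftrightarrow>
     U \<subseteq> carrier V \<and> \<zero>\<^bsub>V\<^esub> \<in> U \<and> (\<forall>a\<in>U. \<forall>b\<in>U. a \<oplus>\<^bsub>V\<^esub> b \<in> U) \<and> (\<forall>c. \<forall>a\<in>U. c \<odot>\<^bsub>V\<^esub> a \<in> U)"

text \<open>Phrased through subspaces instead of linear combinations, so that spanning acts directly
  as an induction principle.\<close>

definition spans :: "('k::field, 'a, 'c) module_scheme \<Rightarrow> 'a set \<Rightarrow> bool" where
  "spans V S \<longleftrightarrow> S \<subseteq> carrier V \<and> (\<forall>U. subspace_of U V \<longrightarrow> S \<subseteq> U \<longrightarrow> carrier V \<subseteq> U)"

lemma linear_onI:
  assumes "\<And>a. a \<in> carrier V \<Longrightarrow> f a \<in> carrier W"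
    and "\<And>a b. \<lbrakk>a \<in> carrier V; b \<in> carrier V\<rbrakk> \<Longrightarrow> f (a \<oplus>\<^bsub>V\<^esub> b) = f a \<oplus>\<^bsub>W\<^esub> f b"
    and "\<And>c a. a \<in> carrier V \<Longrightarrow> f (c \<odot>\<^bsub>V\<^esub> a) = c \<odot>\<^bsub>W\<^esub> f a"
  shows "linear_on V W f"
  using assms by (simp add: linear_on_def)

lemma linear_on_closed: "linear_on V W f \<Longrightarrow> a \<in> carrier V \<Longrightarrow> f a \<in> carrier W"
  and linear_on_add:
    "linear_on V W f \<Longrightarrow> a \<in> carrier V \<Longrightarrow> b \<in> carrier V \<Longrightarrow> f (a \<oplus>\<^bsub>V\<^esub> b) = f a \<oplus>\<^bsub>W\<^esub> f b"
  and linear_on_smult: "linear_on V W f \<Longrightarrow> a \<in> carrier V \<Longrightarrow> f (c \<odot>\<^bsub>V\<^esub> a) = c \<odot>\<^bsub>W\<^esub> f a"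
  by (simp_all add: linear_on_def)

lemma linear_on_id: "linear_on V V (\<lambda>a. a)"
  by (simp add: linear_on_def)

lemma linear_on_comp: "linear_on V W f \<Longrightarrow> linear_on U V h \<Longrightarrow> linear_on U W (\<lambda>a. f (h a))"
  by (simp add: linear_on_def)

lemma linear_on_cong:
  assumes "kspace V" "linear_on V W f" "\<And>a. a \<in> carrier V \<Longrightarrow> f a = h a"
  shows "linear_on V W h"
proof -
  interpret kspace V by fact
  show ?thesis using assms(2,3) by (simp add: linear_on_def)
qed

lemma subspace_ofI:
  assumes "U \<subseteq> carrier V" "\<zero>\<^bsub>V\<^esub> \<in> U" "\<And>a b. a \<in> U \<Longrightarrow> b \<in> U \<Longrightarrow> a \<oplus>\<^bsub>V\<^esub> b \<in> U"
    and "\<And>c a. a \<in> U \<Longrightarrow> c \<odot>\<^bsub>V\<^esub> a \<in> U"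
  shows "subspace_of U V"
  using assms by (simp add: subspace_of_def)

lemma subspace_ofD:
  assumes "subspace_of U V"
  shows "U \<subseteq> carrier V" "\<zero>\<^bsub>V\<^esub> \<in> U" "\<And>a b. a \<in> U \<Longrightarrow> b \<in> U \<Longrightarrow> a \<oplus>\<^bsub>V\<^esub> b \<in> U"
    and "\<And>c a. a \<in> U \<Longrightarrow> c \<odot>\<^bsub>V\<^esub> a \<in> U"
  using assms by (auto simp add: subspace_of_def)

lemma spansD: "spans V S \<Longrightarrow> subspace_of U V \<Longrightarrow> S \<subseteq> U \<Longrightarrow> a \<in> carrier V \<Longrightarrow> a \<in> U"
  by (auto simp: spans_def)

lemma spans_carrier: "spans V S \<Longrightarrow> S \<subseteq> carrier V"
  by (simp add: spans_def)

context kspace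
begin

lemma smult_zero_left [simp]: "a \<in> carrier V \<Longrightarrow> 0 \<odot> a = \<zero>"
  by (metis smult_closed smult_l_distr add.r_cancel_one' add_0_right)

lemma smult_zero_right [simp]: "c \<odot> \<zero> = \<zero>"
  by (metis smult_closed smult_r_distr add.r_cancel_one' r_zero zero_closed)

lemma smult_minus_left: "a \<in> carrier V \<Longrightarrow> (- c) \<odot> a = \<ominus> (c \<odot> a)"
  by (metis smult_closed smult_l_distr add.inv_equality left_minus smult_zero_left)

lemma smult_minus_one: "a \<in> carrier V \<Longrightarrow> \<ominus> a = (- 1) \<odot> a"
  by (simp add: smult_minus_left)

lemma linear_on_zero:
  assumes "kspace W" "linear_on V W f"
  shows "f \<zero> = \<zero>\<^bsub>W\<^esub>"
proof -
  interpret W: kspace W by fact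
  have "f (0 \<odot> \<zero>) = 0 \<odot>\<^bsub>W\<^esub> f \<zero>" using assms(2) by (simp only: linear_on_smult zero_closed)
  then show ?thesis using assms(2) by (simp add: linear_on_closed)
qed

lemma linear_on_eq_subspace:
  assumes "kspace W" "linear_on V W f" "linear_on V W h"
  shows "subspace_of {a \<in> carrier V. f a = h a} V"
  using assms linear_on_zero[OF assms(1,2)] linear_on_zero[OF assms(1,3)]
  by (intro subspace_ofI) (auto simp: linear_on_add linear_on_smult)

text \<open>The arguments on which two linear maps agree form a subspace, so a spanning set decides.
  Most identities below, associativity included, are reduced to generators or monomials in this
  way.\<close>

lemma linear_on_eqI:
  assumes "kspace W" "linear_on V W f" "linear_on V W h" "spans V S"
    and "\<And>s. s \<in> S \<Longrightarrow> f s = h s" and "a \<in> carrier V"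
  shows "f a = h a"
proof -
  have "S \<subseteq> {a \<in> carrier V. f a = h a}" using assms(4,5) by (auto simp: spans_def)
  from spansD[OF assms(4) linear_on_eq_subspace[OF assms(1-3)] this assms(6)]
  show ?thesis by simp
qed

lemma subspace_vimage:
  assumes "kspace W" "linear_on V W f" "subspace_of U W"
  shows "subspace_of {a \<in> carrier V. f a \<in> U} V"
  using assms linear_on_zero[of W f]
  by (intro subspace_ofI) (auto simp: linear_on_add linear_on_smult subspace_ofD)

lemma linear_on_smult_left: "linear_on V V (\<lambda>a. c \<odot> a)"
  by (rule linear_onI) (simp_all add: smult_r_distr smult_smult mult.commute)

lemma linear_on_add_fun:
  assumes "linear_on U V f" "linear_on U V h"
  shows "linear_on U V (\<lambda>a. f a \<oplus> h a)"
  using assms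
  by (intro linear_onI) (simp_all add: linear_on_closed linear_on_add linear_on_smult smult_r_distr a_ac)

lemma linear_on_const_zero: "linear_on U V (\<lambda>a. \<zero>)"
  by (rule linear_onI) simp_all

lemma subspace_sum:
  assumes "subspace_of U V" "finite S" "\<And>x. x \<in> S \<Longrightarrow> f x \<in> U"
  shows "(\<Oplus>x\<in>S. f x) \<in> U"
  using assms(2,3)
proof (induction S rule: finite_induct)
  case empty
  then show ?case using assms(1) by (simp add: subspace_ofD)
next
  case (insert x S)
  then have "f ` insert x S \<subseteq> U" by auto
  moreover from this have "f ` insert x S \<subseteq> carrier V" using subspace_ofD(1)[OF assms(1)] by blast
  ultimately show ?case using insert assms(1)
    by (subst finsum_insert) (auto simp: subspace_ofD image_subset_iff)
qed

text \<open>Padding with zero coefficients. Sums over different sets of keys combine only over a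
  common finite index set, and keys disappear under cancellation or scaling by 0.\<close>

lemma lin_ext_superset:
  assumes "finite S" "Poly_Mapping.keys p \<subseteq> S" "f ` S \<subseteq> carrier V"
  shows "lin_ext V f p = (\<Oplus>x\<in>S. Poly_Mapping.lookup p x \<odot> f x)"
  unfolding lin_ext_def using assms
  by (intro add.finprod_mono_neutral_cong_left) (auto simp: image_subset_iff in_keys_iff)

lemma lin_ext_closed:
  assumes "f ` Poly_Mapping.keys p \<subseteq> carrier V"
  shows "lin_ext V f p \<in> carrier V"
  unfolding lin_ext_def using assms by (intro finsum_closed) auto

lemma lin_ext_zero [simp]: "lin_ext V f 0 = \<zero>"
  by (simp add: lin_ext_def)

lemma lin_ext_single [simp]: "f x \<in> carrier V \<Longrightarrow> lin_ext V f (Poly_Mapping.single x c) = c \<odot> f x"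
  by (cases "c = 0") (simp_all add: lin_ext_def)

lemma lin_ext_add:
  assumes "f ` Poly_Mapping.keys p \<subseteq> carrier V" "f ` Poly_Mapping.keys q \<subseteq> carrier V"
  shows "lin_ext V f (p + q) = lin_ext V f p \<oplus> lin_ext V f q"
proof -
  let ?S = "Poly_Mapping.keys p \<union> Poly_Mapping.keys q"
  have S: "finite ?S" "f ` ?S \<subseteq> carrier V" "Poly_Mapping.keys (p + q) \<subseteq> ?S"
    using assms keys_add[of p q] by auto
  have "lin_ext V f (p + q) = (\<Oplus>x\<in>?S. Poly_Mapping.lookup p x \<odot> f x \<oplus> Poly_Mapping.lookup q x \<odot> f x)"
    unfolding lin_ext_superset[OF S(1,3,2)] using S(2)
    by (intro finsum_cong') (auto simp: lookup_add smult_l_distr image_subset_iff)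
  also have "\<dots> = lin_ext V f p \<oplus> lin_ext V f q"
    using S(1,2) by (subst finsum_addf) (auto simp: lin_ext_superset[of ?S] image_subset_iff)
  finally show ?thesis .
qed

lemma lin_ext_smult:
  assumes "f ` Poly_Mapping.keys p \<subseteq> carrier V"
  shows "lin_ext V f (Poly_Mapping.map ((*) c) p) = c \<odot> lin_ext V f p"
proof -
  have k: "Poly_Mapping.keys (Poly_Mapping.map ((*) c) p) \<subseteq> Poly_Mapping.keys p"
    by (auto simp: in_keys_iff map.rep_eq)
  have l: "Poly_Mapping.lookup (Poly_Mapping.map ((*) c) p) x = c * Poly_Mapping.lookup p x" for x
    by (simp add: map.rep_eq when_def)
  have "c \<odot> (\<Oplus>x\<in>S. Poly_Mapping.lookup p x \<odot> f x) = (\<Oplus>x\<in>S. (c * Poly_Mapping.lookup p x) \<odot> f x)"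
    if "finite S" "f ` S \<subseteq> carrier V" for S
    using that
  proof (induction S rule: finite_induct)
    case (insert x S)
    then show ?case
      by (simp add: smult_r_distr smult_smult image_subset_iff finsum_insert)
  qed simp
  then show ?thesis
    using assms by (subst lin_ext_superset[OF finite_keys k assms]) (simp add: l lin_ext_def)
qed

lemma lin_span_subspace:
  assumes "S \<subseteq> carrier V"
  shows "subspace_of (lin_span V S) V"
proof (rule subspace_ofI)
  show "lin_span V S \<subseteq> carrier V"
    using assms by (auto simp: lin_span_def intro!: lin_ext_closed)
  show "\<zero> \<in> lin_span V S"
    unfolding lin_span_def by (rule CollectI, rule exI[of _ 0]) simp
next
  fix a b assume "a \<in> lin_span V S" "b \<in> lin_span V S"
  then obtain p q where "a = lin_ext V (\<lambda>x. x) p" "Poly_Mapping.keys p \<subseteq> S"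
    "b = lin_ext V (\<lambda>x. x) q" "Poly_Mapping.keys q \<subseteq> S" by (auto simp: lin_span_def)
  then show "a \<oplus> b \<in> lin_span V S"
    using assms keys_add[of p q] unfolding lin_span_def
    by (intro CollectI exI[of _ "p + q"]) (auto simp: lin_ext_add subset_iff)
next
  fix c a assume "a \<in> lin_span V S"
  then obtain p where "a = lin_ext V (\<lambda>x. x) p" "Poly_Mapping.keys p \<subseteq> S" by (auto simp: lin_span_def)
  moreover from this have "Poly_Mapping.keys (Poly_Mapping.map ((*) c) p) \<subseteq> S"
    by (auto simp: in_keys_iff map.rep_eq)
  ultimately show "c \<odot> a \<in> lin_span V S"
    using assms unfolding lin_span_def
    by (intro CollectI exI[of _ "Poly_Mapping.map ((*) c) p"]) (auto simp: lin_ext_smult subset_iff)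
qed

lemma lin_span_incl: "S \<subseteq> carrier V \<Longrightarrow> S \<subseteq> lin_span V S"
proof
  fix s assume "S \<subseteq> carrier V" "s \<in> S"
  then show "s \<in> lin_span V S" unfolding lin_span_def
    by (intro CollectI exI[of _ "Poly_Mapping.single s 1"]) auto
qed

lemma lin_span_minimal:
  assumes "subspace_of U V" "S \<subseteq> U"
  shows "lin_span V S \<subseteq> U"
  unfolding lin_span_def lin_ext_def
  using assms by (auto intro!: subspace_sum simp: subspace_ofD)

end

context kalgebra
begin

lemma linear_on_mult_left: "a \<in> carrier A \<Longrightarrow> linear_on A A (\<lambda>b. a \<otimes> b)"
  by (rule linear_onI) (simp_all add: r_distr smult_mult_right)

lemma linear_on_mult_right: "a \<in> carrier A \<Longrightarrow> linear_on A A (\<lambda>b. b \<otimes> a)"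
  by (rule linear_onI) (simp_all add: l_distr smult_mult_left)

end

subsection \<open>Monoid algebras\<close>

lemma monoid_alg_simps [simp]:
  "carrier (monoid_alg M) = {p. Poly_Mapping.keys p \<subseteq> carrier M}"
  "add (monoid_alg M) = (+)" "zero (monoid_alg M) = 0"
  "one (monoid_alg M) = Poly_Mapping.single \<one>\<^bsub>M\<^esub> 1"
  "module.smult (monoid_alg M) = (\<lambda>c. Poly_Mapping.map ((*) c))"
  by (simp_all add: monoid_alg_def)

lemma lookup_map_times [simp]:
  "Poly_Mapping.lookup (Poly_Mapping.map ((*) (c::'k::field)) p) x = c * Poly_Mapping.lookup p x"
  by (simp add: map.rep_eq when_def)

lemma keys_map_times: "Poly_Mapping.keys (Poly_Mapping.map ((*) (c::'k::field)) p) \<subseteq> Poly_Mapping.keys p"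
  by (auto simp: in_keys_iff)

lemma kspace_monoid_alg: "kspace (monoid_alg M :: ('k::field, 'm \<Rightarrow>\<^sub>0 'k) module)"
  by (rule kspaceI)
    (auto intro!: poly_mapping_eqI simp: lookup_add algebra_simps dest!: subsetD[OF keys_add] subsetD[OF keys_map_times])

lemma poly_mapping_sum_single:
  "p = (\<Sum>k\<in>Poly_Mapping.keys p. Poly_Mapping.single k (Poly_Mapping.lookup p k))"
  by (rule poly_mapping_eqI) (auto simp: lookup_sum lookup_single when_def in_keys_iff)

lemma spans_monoid_alg:
  "spans (monoid_alg M :: ('k::field, 'm \<Rightarrow>\<^sub>0 'k) module) ((\<lambda>a. Poly_Mapping.single a 1) ` carrier M)"
  unfolding spans_def
proof (intro conjI allI impI subsetI)
  fix U :: "('m \<Rightarrow>\<^sub>0 'k) set" and p :: "'m \<Rightarrow>\<^sub>0 'k"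
  assume U: "subspace_of U (monoid_alg M)" "(\<lambda>a. Poly_Mapping.single a 1) ` carrier M \<subseteq> U"
    and p: "p \<in> carrier (monoid_alg M)"
  have "Poly_Mapping.single k c \<in> U" if "k \<in> carrier M" for k c
  proof -
    have "Poly_Mapping.map ((*) c) (Poly_Mapping.single k 1) \<in> U"
      using subspace_ofD(4)[OF U(1), of "Poly_Mapping.single k 1" c] U(2) that by auto
    then show ?thesis by simp
  qed
  moreover have "sum f S \<in> U" if "finite S" "\<And>x. x \<in> S \<Longrightarrow> f x \<in> U" for f :: "'m \<Rightarrow> ('m \<Rightarrow>\<^sub>0 'k)" and S
    using that subspace_ofD(2,3)[OF U(1)] by (induction S rule: finite_induct) auto
  ultimately have "(\<Sum>k\<in>Poly_Mapping.keys p. Poly_Mapping.single k (Poly_Mapping.lookup p k)) \<in> U"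
    using p by (metis (no_types, lifting) finite_keys mem_Collect_eq monoid_alg_simps(1) subsetD)
  then show "p \<in> U" using poly_mapping_sum_single[of p] by simp
qed auto

lemma linear_on_lin_ext:
  assumes "kspace V" "\<And>x. x \<in> carrier M \<Longrightarrow> f x \<in> carrier V"
  shows "linear_on (monoid_alg M) V (lin_ext V f)"
proof -
  interpret kspace V by fact
  have *: "f ` Poly_Mapping.keys p \<subseteq> carrier V" if "Poly_Mapping.keys p \<subseteq> carrier M" for p
    using that assms(2) by auto
  show ?thesis
    by (rule linear_onI) (simp_all add: * lin_ext_closed lin_ext_add lin_ext_smult)
qed

text \<open>The same padding as for \<open>lin_ext\<close>; with fixed index sets the product is
  visibly additive in each factor.\<close>

lemma monoid_alg_mult_superset:
  assumes "finite S" "finite T" "Poly_Mapping.keys p \<subseteq> S" "Poly_Mapping.keys q \<subseteq> T"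
  shows "p \<otimes>\<^bsub>monoid_alg M\<^esub> q = (\<Sum>a\<in>S. \<Sum>b\<in>T.
    Poly_Mapping.single (a \<otimes>\<^bsub>M\<^esub> b) (Poly_Mapping.lookup p a * Poly_Mapping.lookup q b :: 'k::field))"
proof -
  have "p \<otimes>\<^bsub>monoid_alg M\<^esub> q = (\<Sum>a\<in>Poly_Mapping.keys p. \<Sum>b\<in>T.
    Poly_Mapping.single (a \<otimes>\<^bsub>M\<^esub> b) (Poly_Mapping.lookup p a * Poly_Mapping.lookup q b))"
    unfolding monoid_alg_def using assms
    by (simp, intro sum.cong refl sum.mono_neutral_left) (auto simp: in_keys_iff)
  also have "\<dots> = (\<Sum>a\<in>S. \<Sum>b\<in>T.
    Poly_Mapping.single (a \<otimes>\<^bsub>M\<^esub> b) (Poly_Mapping.lookup p a * Poly_Mapping.lookup q b))"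
    using assms by (intro sum.mono_neutral_left) (auto simp: in_keys_iff)
  finally show ?thesis .
qed

lemma monoid_alg_mult_single [simp]:
  "Poly_Mapping.single a c \<otimes>\<^bsub>monoid_alg M\<^esub> Poly_Mapping.single b d
     = Poly_Mapping.single (a \<otimes>\<^bsub>M\<^esub> b) (c * d :: 'k::field)"
  using monoid_alg_mult_superset[of "{a}" "{b}" "Poly_Mapping.single a c" "Poly_Mapping.single b d" M]
  by simp

lemma monoid_alg_l_distr:
  "(p + p') \<otimes>\<^bsub>monoid_alg M\<^esub> q = p \<otimes>\<^bsub>monoid_alg M\<^esub> q + p' \<otimes>\<^bsub>monoid_alg M\<^esub> (q :: 'm \<Rightarrow>\<^sub>0 'k::field)"
  using keys_add[of p p']
  by (simp add: monoid_alg_mult_superset[of "Poly_Mapping.keys p \<union> Poly_Mapping.keys p'" "Poly_Mapping.keys q"]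
      lookup_add distrib_right single_add sum.distrib)

lemma monoid_alg_r_distr:
  "q \<otimes>\<^bsub>monoid_alg M\<^esub> (p + p') = q \<otimes>\<^bsub>monoid_alg M\<^esub> p + q \<otimes>\<^bsub>monoid_alg M\<^esub> (p' :: 'm \<Rightarrow>\<^sub>0 'k::field)"
  using keys_add[of p p']
  by (simp add: monoid_alg_mult_superset[of "Poly_Mapping.keys q" "Poly_Mapping.keys p \<union> Poly_Mapping.keys p'"]
      lookup_add distrib_left single_add sum.distrib)

lemma map_times_sum:
  "Poly_Mapping.map ((*) (c::'k::field)) (sum f S) = (\<Sum>x\<in>S. Poly_Mapping.map ((*) c) (f x))"
  by (rule poly_mapping_eqI) (simp add: lookup_sum sum_distrib_left)

lemma monoid_alg_smult_mult:
  fixes p q :: "'m \<Rightarrow>\<^sub>0 'k::field"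
  shows "Poly_Mapping.map ((*) c) p \<otimes>\<^bsub>monoid_alg M\<^esub> q = Poly_Mapping.map ((*) c) (p \<otimes>\<^bsub>monoid_alg M\<^esub> q)"
    and "p \<otimes>\<^bsub>monoid_alg M\<^esub> Poly_Mapping.map ((*) c) q = Poly_Mapping.map ((*) c) (p \<otimes>\<^bsub>monoid_alg M\<^esub> q)"
proof -
  note mult = monoid_alg_mult_superset[of "Poly_Mapping.keys p" "Poly_Mapping.keys q", OF finite_keys finite_keys, of _ _ M]
  show "Poly_Mapping.map ((*) c) p \<otimes>\<^bsub>monoid_alg M\<^esub> q = Poly_Mapping.map ((*) c) (p \<otimes>\<^bsub>monoid_alg M\<^esub> q)"
    using mult[of "Poly_Mapping.map ((*) c) p" q] mult[of p q] keys_map_times[of c p]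
    by (simp add: map_times_sum mult_ac)
  show "p \<otimes>\<^bsub>monoid_alg M\<^esub> Poly_Mapping.map ((*) c) q = Poly_Mapping.map ((*) c) (p \<otimes>\<^bsub>monoid_alg M\<^esub> q)"
    using mult[of p "Poly_Mapping.map ((*) c) q"] mult[of p q] keys_map_times[of c q]
    by (simp add: map_times_sum mult_ac)
qed

lemma kalgebra_monoid_alg:
  assumes "monoid M"
  shows "kalgebra (monoid_alg M :: ('k::field, 'm \<Rightarrow>\<^sub>0 'k) module)"
proof -
  interpret M: monoid M by fact
  let ?A = "monoid_alg M :: ('k::field, 'm \<Rightarrow>\<^sub>0 'k) module"
  interpret kspace ?A by (rule kspace_monoid_alg)
  have closed: "p \<otimes>\<^bsub>?A\<^esub> q \<in> carrier ?A" if "p \<in> carrier ?A" "q \<in> carrier ?A" for p q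
  proof -
    have sum: "sum f S \<in> carrier ?A" if "finite S" "\<And>x. x \<in> S \<Longrightarrow> f x \<in> carrier ?A" for f :: "'m \<Rightarrow> ('m \<Rightarrow>\<^sub>0 'k)" and S
      using that zero_closed a_closed by (induction S rule: finite_induct) (simp_all del: monoid_alg_simps(1))
    have "Poly_Mapping.single (a \<otimes>\<^bsub>M\<^esub> b) c \<in> carrier ?A" if "a \<in> carrier M" "b \<in> carrier M" for a b c
      using that by simp
    then show ?thesis
      unfolding monoid_alg_mult_superset[OF finite_keys finite_keys order_refl order_refl]
      using that by (intro sum finite_keys) auto
  qed
  have lin_l: "linear_on ?A ?A (\<lambda>p. p \<otimes>\<^bsub>?A\<^esub> q)" and lin_r: "linear_on ?A ?A (\<lambda>p. q \<otimes>\<^bsub>?A\<^esub> p)"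
    if "q \<in> carrier ?A" for q
    using closed that by (auto intro!: linear_onI simp: monoid_alg_l_distr monoid_alg_r_distr monoid_alg_smult_mult
        simp del: monoid_alg_simps(1))
  note sp = spans_monoid_alg[of M, where 'k='k]
  have cs: "Poly_Mapping.single a c \<in> carrier ?A" if "a \<in> carrier M" for a c using that by simp
  \<comment> \<open>Both sides are linear in each of the three factors. Reducing these one after the
    other to basis elements leaves associativity of the monoid.\<close>
  have assoc1: "(p \<otimes>\<^bsub>?A\<^esub> q) \<otimes>\<^bsub>?A\<^esub> r = p \<otimes>\<^bsub>?A\<^esub> (q \<otimes>\<^bsub>?A\<^esub> r)"
    if p: "p \<in> carrier ?A" and q: "q \<in> carrier ?A" and r: "r \<in> carrier ?A" for p q r
  proof (rule linear_on_eqI[OF kspace_monoid_alg _ _ sp _ p])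
    show "linear_on ?A ?A (\<lambda>p. p \<otimes>\<^bsub>?A\<^esub> q \<otimes>\<^bsub>?A\<^esub> r)"
      by (rule linear_on_comp[OF lin_l[OF r] lin_l[OF q]])
    show "linear_on ?A ?A (\<lambda>p. p \<otimes>\<^bsub>?A\<^esub> (q \<otimes>\<^bsub>?A\<^esub> r))"
      by (rule lin_l[OF closed[OF q r]])
    fix s :: "'m \<Rightarrow>\<^sub>0 'k" assume "s \<in> (\<lambda>a. Poly_Mapping.single a 1) ` carrier M"
    then obtain a where a: "a \<in> carrier M" "s = Poly_Mapping.single a 1" by auto
    have s: "s \<in> carrier ?A" using a by simp
    show "s \<otimes>\<^bsub>?A\<^esub> q \<otimes>\<^bsub>?A\<^esub> r = s \<otimes>\<^bsub>?A\<^esub> (q \<otimes>\<^bsub>?A\<^esub> r)"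
    proof (rule linear_on_eqI[OF kspace_monoid_alg _ _ sp _ q])
      show "linear_on ?A ?A (\<lambda>q. s \<otimes>\<^bsub>?A\<^esub> q \<otimes>\<^bsub>?A\<^esub> r)"
        by (rule linear_on_comp[OF lin_l[OF r] lin_r[OF s]])
      show "linear_on ?A ?A (\<lambda>q. s \<otimes>\<^bsub>?A\<^esub> (q \<otimes>\<^bsub>?A\<^esub> r))"
        by (rule linear_on_comp[OF lin_r[OF s] lin_l[OF r]])
      fix t :: "'m \<Rightarrow>\<^sub>0 'k" assume "t \<in> (\<lambda>a. Poly_Mapping.single a 1) ` carrier M"
      then obtain b where b: "b \<in> carrier M" "t = Poly_Mapping.single b 1" by auto
      have t: "t \<in> carrier ?A" using b by simp
      show "s \<otimes>\<^bsub>?A\<^esub> t \<otimes>\<^bsub>?A\<^esub> r = s \<otimes>\<^bsub>?A\<^esub> (t \<otimes>\<^bsub>?A\<^esub> r)"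
      proof (rule linear_on_eqI[OF kspace_monoid_alg _ _ sp _ r])
        show "linear_on ?A ?A (\<lambda>r. s \<otimes>\<^bsub>?A\<^esub> t \<otimes>\<^bsub>?A\<^esub> r)"
          by (rule lin_r[OF closed[OF s t]])
        show "linear_on ?A ?A (\<lambda>r. s \<otimes>\<^bsub>?A\<^esub> (t \<otimes>\<^bsub>?A\<^esub> r))"
          by (rule linear_on_comp[OF lin_r[OF s] lin_r[OF t]])
      qed (auto simp: a b M.m_assoc)
    qed
  qed
  have one: "\<one>\<^bsub>?A\<^esub> \<otimes>\<^bsub>?A\<^esub> p = p" "p \<otimes>\<^bsub>?A\<^esub> \<one>\<^bsub>?A\<^esub> = p" if p: "p \<in> carrier ?A" for p
    by (rule linear_on_eqI[OF kspace_monoid_alg _ linear_on_id sp _ p], use lin_r cs in force, force)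
      (rule linear_on_eqI[OF kspace_monoid_alg _ linear_on_id sp _ p], use lin_l cs in force, force)
  show ?thesis
    by (rule kalgebraI[OF kspace_monoid_alg])
      (auto intro!: closed assoc1 one simp: monoid_alg_l_distr monoid_alg_r_distr monoid_alg_smult_mult
        cs[OF M.one_closed, of 1, folded monoid_alg_simps(4)] simp del: monoid_alg_simps(1,4))
qed

lemma (in kspace) lin_ext_uminus:
  assumes "f ` Poly_Mapping.keys p \<subseteq> carrier V"
  shows "lin_ext V f (- p) = \<ominus> lin_ext V f p"
proof -
  have "- p = Poly_Mapping.map ((*) (- 1)) p"
    by (rule poly_mapping_eqI) simp
  then show ?thesis using assms by (simp only: lin_ext_smult smult_minus_one[OF lin_ext_closed])
qed

lemma (in kspace) lin_ext_diff:
  assumes "f ` Poly_Mapping.keys p \<subseteq> carrier V" "f ` Poly_Mapping.keys q \<subseteq> carrier V"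
  shows "lin_ext V f (p - q) = lin_ext V f p \<ominus> lin_ext V f q"
  using lin_ext_add[of f p "- q"] assms by (simp add: lin_ext_uminus a_minus_def)

lemma spans_image:
  assumes "kspace V" "kspace W" "linear_on V W f" "f ` carrier V = carrier W" "spans V S"
  shows "spans W (f ` S)"
  unfolding spans_def
proof (intro conjI allI impI)
  interpret V: kspace V by fact
  show "f ` S \<subseteq> carrier W" using assms(4,5) by (auto simp: spans_def)
  fix U assume U: "subspace_of U W" "f ` S \<subseteq> U"
  have "S \<subseteq> {a \<in> carrier V. f a \<in> U}" using U(2) assms(5) by (auto simp: spans_def)
  then have "carrier V \<subseteq> {a \<in> carrier V. f a \<in> U}"
    using V.subspace_vimage[OF assms(2,3) U(1)] assms(5) by (simp add: spans_def)
  then show "carrier W \<subseteq> U" unfolding assms(4)[symmetric] by auto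
qed

section \<open>Algebra homomorphisms and ideals\<close>

definition alg_hom ::
  "('k::field, 'a, 'c) module_scheme \<Rightarrow> ('k, 'b, 'd) module_scheme \<Rightarrow> ('a \<Rightarrow> 'b) \<Rightarrow> bool" where
  "alg_hom A B f \<longleftrightarrow> linear_on A B f \<and> f \<one>\<^bsub>A\<^esub> = \<one>\<^bsub>B\<^esub> \<and>
     (\<forall>a\<in>carrier A. \<forall>b\<in>carrier A. f (a \<otimes>\<^bsub>A\<^esub> b) = f a \<otimes>\<^bsub>B\<^esub> f b)"

lemma alg_hom_linear: "alg_hom A B f \<Longrightarrow> linear_on A B f"
  and alg_hom_one: "alg_hom A B f \<Longrightarrow> f \<one>\<^bsub>A\<^esub> = \<one>\<^bsub>B\<^esub>"
  and alg_hom_mult: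
    "alg_hom A B f \<Longrightarrow> a \<in> carrier A \<Longrightarrow> b \<in> carrier A \<Longrightarrow> f (a \<otimes>\<^bsub>A\<^esub> b) = f a \<otimes>\<^bsub>B\<^esub> f b"
  by (simp_all add: alg_hom_def)

lemma (in kalgebra) subspace_ideal:
  assumes "subspace_of I A" "\<And>a i. a \<in> carrier A \<Longrightarrow> i \<in> I \<Longrightarrow> a \<otimes> i \<in> I"
    and "\<And>a i. a \<in> carrier A \<Longrightarrow> i \<in> I \<Longrightarrow> i \<otimes> a \<in> I"
  shows "ideal I A"
proof (rule idealI[OF ring_axioms])
  note I = subspace_ofD[OF assms(1)]
  show "subgroup I (add_monoid A)"
  proof (rule add.subgroupI)
    fix a assume "a \<in> I"
    then show "\<ominus> a \<in> I" using I(1) I(4)[of a "- 1"] by (auto simp: smult_minus_one)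
  qed (use I in auto)
qed (use assms in auto)

text \<open>Scaling by c is multiplication by c times the unit, so ring ideals absorb
  scalars.\<close>

lemma (in kalgebra) ideal_subspace:
  assumes "ideal I A"
  shows "subspace_of I A"
proof -
  interpret I: ideal I A by fact
  show ?thesis
  proof (rule subspace_ofI)
    fix c a assume a: "a \<in> I"
    then have "(c \<odot> \<one>) \<otimes> a \<in> I" by (intro I.I_l_closed) auto
    moreover have "(c \<odot> \<one>) \<otimes> a = c \<odot> a"
      using I.a_subset a by (subst smult_mult_left) auto
    ultimately show "c \<odot> a \<in> I" by simp
  qed (use I.a_subset in auto)
qed

text \<open>Reduces properties of a generated ideal to its generators: a condition of the form f a
  \<in> J cuts out an ideal, which contains the generated one once it contains the
  generators.\<close>

lemma (in kalgebra) alg_hom_vimage_ideal: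
  assumes "kalgebra B" "alg_hom A B f" "ideal J B"
  shows "ideal {a \<in> carrier A. f a \<in> J} A"
proof -
  interpret B: kalgebra B by fact
  interpret J: ideal J B by fact
  note lin = alg_hom_linear[OF assms(2)]
  show ?thesis
    using J.I_l_closed J.I_r_closed
    by (intro subspace_ideal subspace_vimage[OF B.kspace_axioms lin] B.ideal_subspace assms)
       (auto simp: alg_hom_mult[OF assms(2)] linear_on_closed[OF lin])
qed

text \<open>Linearity is used twice, in the element of the span and in the element of the algebra,
  so that absorption is verified only on products of spanning elements.\<close>

lemma (in kalgebra) lin_span_ideal:
  assumes S: "S \<subseteq> carrier A" and G: "spans A G"
    and l: "\<And>g s. g \<in> G \<Longrightarrow> s \<in> S \<Longrightarrow> g \<otimes> s \<in> lin_span A S"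
    and r: "\<And>g s. g \<in> G \<Longrightarrow> s \<in> S \<Longrightarrow> s \<otimes> g \<in> lin_span A S"
  shows "ideal (lin_span A S) A"
proof (rule subspace_ideal)
  note sub = lin_span_subspace[OF S]
  note GA = spans_carrier[OF G]
  show "subspace_of (lin_span A S) A" by (rule sub)
  fix a i assume a: "a \<in> carrier A" and i: "i \<in> lin_span A S"
  have iA: "i \<in> carrier A" using i subspace_ofD(1)[OF sub] by auto
  have "g \<otimes> i \<in> lin_span A S" if g: "g \<in> G" for g
  proof -
    have "subspace_of {i \<in> carrier A. g \<otimes> i \<in> lin_span A S} A"
      using g GA by (intro subspace_vimage[OF kspace_axioms _ sub] linear_on_mult_left) auto
    from lin_span_minimal[OF this, of S] show ?thesis using S l[OF g] i by auto
  qed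
  then have "G \<subseteq> {g \<in> carrier A. g \<otimes> i \<in> lin_span A S}" using GA by auto
  from spansD[OF G _ this a] show "a \<otimes> i \<in> lin_span A S"
    using subspace_vimage[OF kspace_axioms linear_on_mult_right[OF iA] sub] by auto
  have "i \<otimes> g \<in> lin_span A S" if g: "g \<in> G" for g
  proof -
    have "subspace_of {i \<in> carrier A. i \<otimes> g \<in> lin_span A S} A"
      using g GA by (intro subspace_vimage[OF kspace_axioms _ sub] linear_on_mult_right) auto
    from lin_span_minimal[OF this, of S] show ?thesis using S r[OF g] i by auto
  qed
  then have "G \<subseteq> {g \<in> carrier A. i \<otimes> g \<in> lin_span A S}" using GA by auto
  from spansD[OF G _ this a] show "i \<otimes> a \<in> lin_span A S"
    using subspace_vimage[OF kspace_axioms linear_on_mult_left[OF iA] sub] by auto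
qed

subsection \<open>Quotient algebras\<close>

locale kalgebra_ideal = kalgebra M + ideal I M for M :: "('k::field, 'a, 'c) module_scheme" (structure) and I
begin

lemma quot_alg_carrier: "carrier (quot_alg M I) = (\<lambda>a. I +> a) ` carrier M"
  by (auto simp: quot_alg_def FactRing_def A_RCOSETS_def')

lemma quot_alg_mult:
  "\<lbrakk>a \<in> carrier M; b \<in> carrier M\<rbrakk> \<Longrightarrow> (I +> a) \<otimes>\<^bsub>quot_alg M I\<^esub> (I +> b) = I +> (a \<otimes> b)"
  by (simp add: quot_alg_def FactRing_def rcoset_mult_add)

lemma quot_alg_add:
  "\<lbrakk>a \<in> carrier M; b \<in> carrier M\<rbrakk> \<Longrightarrow> (I +> a) \<oplus>\<^bsub>quot_alg M I\<^esub> (I +> b) = I +> (a \<oplus> b)"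
  by (simp add: quot_alg_def FactRing_def a_rcos_sum)

lemma quot_alg_one: "\<one>\<^bsub>quot_alg M I\<^esub> = I +> \<one>"
  by (simp add: quot_alg_def FactRing_def)

lemma quot_alg_zero: "\<zero>\<^bsub>quot_alg M I\<^esub> = I +> \<zero>"
  by (simp add: quot_alg_def FactRing_def a_subset)

lemma coset_eq_iff:
  assumes "a \<in> carrier M" "b \<in> carrier M"
  shows "I +> a = I +> b \<longleftrightarrow> a \<ominus> b \<in> I"
  using a_rcos_module_minus[OF ring_axioms assms(2,1)] a_rcos_self[OF assms(1)]
    a_repr_independence'[OF _ assms(2), of a] by auto

lemma coset_eq_zero_iff: "a \<in> carrier M \<Longrightarrow> I +> a = \<zero>\<^bsub>quot_alg M I\<^esub> \<longleftrightarrow> a \<in> I"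
  by (simp add: quot_alg_zero coset_eq_iff a_minus_def)

text \<open>The definition adds I after scaling because for c = 0 the scaled coset shrinks to the
  zero element; adding I restores a full coset.\<close>

lemma quot_alg_smult:
  assumes "a \<in> carrier M"
  shows "c \<odot>\<^bsub>quot_alg M I\<^esub> (I +> a) = I +> (c \<odot> a)"
proof -
  note I = subspace_ofD[OF ideal_subspace[OF is_ideal]]
  have coset: "I +> b = {i \<oplus> b | i. i \<in> I}" for b by (auto simp: a_r_coset_def')
  have "c \<odot>\<^bsub>quot_alg M I\<^esub> (I +> a) = {i \<oplus> c \<odot> (j \<oplus> a) | i j. i \<in> I \<and> j \<in> I}"
    by (auto simp: quot_alg_def set_add_def' coset)
  also have "\<dots> = {(i \<oplus> c \<odot> j) \<oplus> c \<odot> a | i j. i \<in> I \<and> j \<in> I}"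
  proof -
    have eq: "i \<oplus> c \<odot> (j \<oplus> a) = (i \<oplus> c \<odot> j) \<oplus> c \<odot> a" if "i \<in> I" "j \<in> I" for i j
    proof -
      have "i \<in> carrier M" "j \<in> carrier M" using that I(1) by auto
      then show ?thesis using assms by (simp add: smult_r_distr a_assoc)
    qed
    have "(\<exists>i j. y = i \<oplus> c \<odot> (j \<oplus> a) \<and> i \<in> I \<and> j \<in> I)
      \<longleftrightarrow> (\<exists>i j. y = (i \<oplus> c \<odot> j) \<oplus> c \<odot> a \<and> i \<in> I \<and> j \<in> I)" for y
      \<comment> \<open>\<open>rev_conj_cong\<close> makes the memberships of i and j available
        where the equation is rewritten.\<close>
      by (rule arg_cong[of _ _ Ex], rule ext, rule arg_cong[of _ _ Ex], rule ext, rule rev_conj_cong[OF refl]) (auto simp only: eq)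
    then show ?thesis by (rule Collect_cong)
  qed
  also have "\<dots> = I +> (c \<odot> a)"
    unfolding coset
  proof (intro equalityI subsetI; clarsimp)
    fix i j assume "i \<in> I" "j \<in> I"
    then show "\<exists>i'. i \<oplus> c \<odot> j \<oplus> c \<odot> a = i' \<oplus> c \<odot> a \<and> i' \<in> I"
      using I(3)[OF _ I(4)[of j c], of i] by auto
  next
    fix i assume "i \<in> I"
    then show "\<exists>i' j. i \<oplus> c \<odot> a = i' \<oplus> c \<odot> j \<oplus> c \<odot> a \<and> i' \<in> I \<and> j \<in> I"
      using I(1,2) by (intro exI[of _ i] exI[of _ \<zero>]) auto
  qed
  finally show ?thesis .
qed

lemma kalgebra_quot_alg: "kalgebra (quot_alg M I)"
  by (intro kalgebraI kspaceI)
    (auto simp: quot_alg_carrier quot_alg_mult quot_alg_add quot_alg_zero quot_alg_one quot_alg_smult a_ac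
      m_assoc l_distr r_distr smult_r_distr smult_l_distr smult_smult smult_mult_left smult_mult_right)

lemma alg_hom_coset: "alg_hom M (quot_alg M I) (\<lambda>a. I +> a)"
  unfolding alg_hom_def
  by (auto intro!: linear_onI simp: quot_alg_carrier quot_alg_mult quot_alg_add quot_alg_smult quot_alg_one)

text \<open>A linear map that kills the ideal is constant on cosets, so the image is a singleton.
  This gives \<open>alg_lift\<close> and \<open>tensor_lift\<close> their meaning.\<close>

lemma the_elem_image_coset:
  assumes "kspace W" "linear_on M W f" "\<And>i. i \<in> I \<Longrightarrow> f i = \<zero>\<^bsub>W\<^esub>" "a \<in> carrier M"
  shows "the_elem (f ` (I +> a)) = f a"
proof -
  interpret W: kspace W by fact
  have "f (i \<oplus> a) = f a" if "i \<in> I" for i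
    using that assms a_subset by (auto simp: linear_on_add[OF assms(2)] linear_on_closed[OF assms(2)])
  then have "f ` (I +> a) = {f a}"
    using a_rcos_self[OF assms(4)] by (auto simp: a_r_coset_def')
  then show ?thesis by simp
qed

end

lemma linear_on_quot:
  assumes "kalgebra_ideal M I" "kspace W" "linear_on M W f" "\<And>i. i \<in> I \<Longrightarrow> f i = \<zero>\<^bsub>W\<^esub>"
  shows "linear_on (quot_alg M I) W (\<lambda>Q. the_elem (f ` Q))"
proof -
  interpret kalgebra_ideal M I by fact
  note el = the_elem_image_coset[OF assms(2-4)]
  show ?thesis using assms(3)
    by (intro linear_onI) (auto simp: quot_alg_carrier quot_alg_add quot_alg_smult el linear_on_add
        linear_on_smult linear_on_closed)
qed

subsection \<open>Free algebras and presentations\<close>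

definition word_eval :: "('b, 'c) monoid_scheme \<Rightarrow> ('g \<Rightarrow> 'b) \<Rightarrow> 'g list \<Rightarrow> 'b" where
  "word_eval B f w = foldr (\<lambda>s b. f s \<otimes>\<^bsub>B\<^esub> b) w \<one>\<^bsub>B\<^esub>"

lemma word_eval_simps [simp]:
  "word_eval B f [] = \<one>\<^bsub>B\<^esub>" "word_eval B f (s # w) = f s \<otimes>\<^bsub>B\<^esub> word_eval B f w"
  by (simp_all add: word_eval_def)

lemma monoid_word_monoid: "monoid word_monoid"
  by (rule monoidI) (simp_all add: word_monoid_def)

lemma kalgebra_free_alg: "kalgebra (free_alg :: ('k::field, 'g list \<Rightarrow>\<^sub>0 'k) module)"
  unfolding free_alg_def by (rule kalgebra_monoid_alg[OF monoid_word_monoid])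

lemma free_alg_simps [simp]:
  "carrier free_alg = UNIV" "add free_alg = (+)" "zero free_alg = 0"
  "one free_alg = Poly_Mapping.single [] 1"
  "Poly_Mapping.single w c \<otimes>\<^bsub>free_alg\<^esub> Poly_Mapping.single w' d = Poly_Mapping.single (w @ w') (c * d)"
  "module.smult free_alg = (\<lambda>c. Poly_Mapping.map ((*) c))"
  by (simp_all add: free_alg_def word_monoid_def)

lemma spans_free_alg: "spans free_alg (range (\<lambda>w. Poly_Mapping.single w 1))"
  using spans_monoid_alg[of word_monoid] by (simp add: free_alg_def word_monoid_def)

context kalgebra
begin

lemma word_eval_closed [simp]: "range f \<subseteq> carrier A \<Longrightarrow> word_eval A f w \<in> carrier A"
  by (induction w) (auto simp: image_subset_iff)

lemma word_eval_append:
  "range f \<subseteq> carrier A \<Longrightarrow> word_eval A f (w @ w') = word_eval A f w \<otimes> word_eval A f w'"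
  by (induction w) (auto simp: image_subset_iff m_assoc)

lemma word_eval_replicate:
  "range f \<subseteq> carrier A \<Longrightarrow> word_eval A f (replicate n s) = f s [^] n"
proof (induction n)
  case (Suc n)
  then show ?case by (simp add: image_subset_iff) (metis nat_pow_Suc nat_pow_Suc2 rangeI)
qed simp

end

text \<open>Multiplicativity is bilinear in the two factors and hence reduces to pairs of words,
  where it is \<open>word_eval_append\<close>.\<close>

lemma alg_hom_free:
  fixes A :: "('k::field, 'a, 'c) module_scheme" (structure) and f :: "'g \<Rightarrow> 'a"
  assumes "kalgebra A" and f: "range f \<subseteq> carrier A"
  shows "alg_hom free_alg A (lin_ext A (word_eval A f))"
  unfolding alg_hom_def
proof (intro conjI ballI)
  interpret kalgebra A by fact
  interpret F: kalgebra free_alg by (rule kalgebra_free_alg)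
  show lin: "linear_on free_alg A (lin_ext A (word_eval A f))"
    unfolding free_alg_def by (rule linear_on_lin_ext[OF kspace_axioms]) (simp add: f)
  show "lin_ext A (word_eval A f) \<one>\<^bsub>free_alg\<^esub> = \<one>" by simp
  fix p q :: "'g list \<Rightarrow>\<^sub>0 'k" assume p: "p \<in> carrier free_alg" and q: "q \<in> carrier free_alg"
  have cl: "lin_ext A (word_eval A f) p \<in> carrier A" for p using linear_on_closed[OF lin] by simp
  show "lin_ext A (word_eval A f) (p \<otimes>\<^bsub>free_alg\<^esub> q)
    = lin_ext A (word_eval A f) p \<otimes> lin_ext A (word_eval A f) q"
  proof (rule F.linear_on_eqI[OF kspace_axioms _ _ spans_free_alg _ p])
    show "linear_on free_alg A (\<lambda>p. lin_ext A (word_eval A f) (p \<otimes>\<^bsub>free_alg\<^esub> q))"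
      by (rule linear_on_comp[OF lin F.linear_on_mult_right[OF q]])
    show "linear_on free_alg A (\<lambda>p. lin_ext A (word_eval A f) p \<otimes> lin_ext A (word_eval A f) q)"
      by (rule linear_on_comp[OF linear_on_mult_right[OF cl] lin])
    fix s :: "'g list \<Rightarrow>\<^sub>0 'k" assume "s \<in> range (\<lambda>w. Poly_Mapping.single w 1)"
    then obtain w where s: "s = Poly_Mapping.single w 1" by auto
    show "lin_ext A (word_eval A f) (s \<otimes>\<^bsub>free_alg\<^esub> q)
      = lin_ext A (word_eval A f) s \<otimes> lin_ext A (word_eval A f) q"
    proof (rule F.linear_on_eqI[OF kspace_axioms _ _ spans_free_alg _ q])
      show "linear_on free_alg A (\<lambda>q. lin_ext A (word_eval A f) (s \<otimes>\<^bsub>free_alg\<^esub> q))"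
        by (rule linear_on_comp[OF lin F.linear_on_mult_left]) simp
      show "linear_on free_alg A (\<lambda>q. lin_ext A (word_eval A f) s \<otimes> lin_ext A (word_eval A f) q)"
        by (rule linear_on_comp[OF linear_on_mult_left[OF cl] lin])
    qed (auto simp: s f word_eval_append)
  qed
qed

locale presentation =
  fixes R :: "('g list \<Rightarrow>\<^sub>0 'k::field) set"
begin

sublocale F: kalgebra "free_alg :: ('k, 'g list \<Rightarrow>\<^sub>0 'k) module"
  by (rule kalgebra_free_alg)

abbreviation "I \<equiv> Idl\<^bsub>free_alg\<^esub> R"
abbreviation "P \<equiv> presented_alg R"
abbreviation "gen \<equiv> presented_gen R"

sublocale Q: kalgebra_ideal "free_alg :: ('k, 'g list \<Rightarrow>\<^sub>0 'k) module" I
  by (intro kalgebra_ideal.intro kalgebra_free_alg F.genideal_ideal) simp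

sublocale P: kalgebra P
  unfolding presented_alg_def by (rule Q.kalgebra_quot_alg)

lemma alg_hom_presented: "alg_hom free_alg P (\<lambda>p. I +>\<^bsub>free_alg\<^esub> p)"
  unfolding presented_alg_def by (rule Q.alg_hom_coset)

lemma presented_carrier: "carrier P = range (\<lambda>p. I +>\<^bsub>free_alg\<^esub> p)"
  by (simp add: presented_alg_def Q.quot_alg_carrier)

lemma gen_closed [simp, intro]: "gen s \<in> carrier P"
  by (auto simp: presented_carrier presented_gen_def)

lemma range_gen: "range gen \<subseteq> carrier P"
  by auto

text \<open>Identifies the projection with evaluation at the classes of the generators, which turns
  the defining relations into equations of the presented algebra, see
  \<open>eval_rels\<close>.\<close>

lemma coset_eq_eval: "I +>\<^bsub>free_alg\<^esub> p = lin_ext P (word_eval P gen) p"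
proof (rule F.linear_on_eqI[OF P.kspace_axioms alg_hom_linear[OF alg_hom_presented]
      alg_hom_linear[OF alg_hom_free[OF P.kalgebra_axioms range_gen]] spans_free_alg])
  fix s :: "'g list \<Rightarrow>\<^sub>0 'k" assume "s \<in> range (\<lambda>w. Poly_Mapping.single w 1)"
  then obtain w where s: "s = Poly_Mapping.single w 1" by auto
  have "I +>\<^bsub>free_alg\<^esub> Poly_Mapping.single w 1 = word_eval P gen w"
  proof (induction w)
    case Nil
    then show ?case using alg_hom_one[OF alg_hom_presented] by simp
  next
    case (Cons t w)
    have "Poly_Mapping.single (t # w) 1 = Poly_Mapping.single [t] 1 \<otimes>\<^bsub>free_alg\<^esub> Poly_Mapping.single w (1::'k)"
      by simp
    then show ?case using Cons alg_hom_mult[OF alg_hom_presented]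
      by (simp add: presented_gen_def del: free_alg_simps(5))
  qed
  then show "I +>\<^bsub>free_alg\<^esub> s = lin_ext P (word_eval P gen) s"
    by (simp add: s P.word_eval_closed[OF range_gen])
qed simp

lemma eval_rels:
  assumes "r \<in> R"
  shows "lin_ext P (word_eval P gen) r = \<zero>\<^bsub>P\<^esub>"
proof -
  have "I +>\<^bsub>free_alg\<^esub> r = \<zero>\<^bsub>quot_alg free_alg I\<^esub>"
    using F.genideal_self[of R] assms by (subst Q.coset_eq_zero_iff) auto
  then show ?thesis using coset_eq_eval[of r] by (simp only: presented_alg_def)
qed

lemma spans_words: "spans P (range (word_eval P gen))"
proof -
  have "(\<lambda>p. I +>\<^bsub>free_alg\<^esub> p) ` range (\<lambda>w. Poly_Mapping.single w 1) = range (word_eval P gen)"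
    by (auto simp: coset_eq_eval P.word_eval_closed[OF range_gen] image_iff)
  moreover have "spans P ((\<lambda>p. I +>\<^bsub>free_alg\<^esub> p) ` range (\<lambda>w. Poly_Mapping.single w 1))"
    by (rule spans_image[OF F.kspace_axioms P.kspace_axioms alg_hom_linear[OF alg_hom_presented] _ spans_free_alg])
      (simp add: presented_carrier)
  ultimately show ?thesis by simp
qed

lemma presented_left_induct:
  assumes "subspace_of U P" "\<one>\<^bsub>P\<^esub> \<in> U" "\<And>s a. a \<in> U \<Longrightarrow> gen s \<otimes>\<^bsub>P\<^esub> a \<in> U" "a \<in> carrier P"
  shows "a \<in> U"
proof -
  have "word_eval P gen w \<in> U" for w by (induction w) (simp_all add: assms)
  then show ?thesis using spansD[OF spans_words assms(1) _ assms(4)] by auto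
qed

text \<open>The variant for maps computed by splitting off the last factor, such as the action of a
  product hk, where k acts first.\<close>

lemma presented_right_induct:
  assumes "subspace_of U P" "\<one>\<^bsub>P\<^esub> \<in> U" "\<And>s a. a \<in> U \<Longrightarrow> a \<otimes>\<^bsub>P\<^esub> gen s \<in> U" "a \<in> carrier P"
  shows "a \<in> U"
proof -
  have "word_eval P gen w \<in> U" for w
  proof (induction w rule: rev_induct)
    case (snoc s w)
    then show ?case using assms(3)[OF snoc, of s] P.word_eval_append[OF range_gen, of w "[s]"]
      by simp
  qed (simp add: assms)
  then show ?thesis using spansD[OF spans_words assms(1) _ assms(4)] by auto
qed

context
  fixes B :: "('k, 'b, 'c) module_scheme" and f :: "'g \<Rightarrow> 'b"
  assumes B: "kalgebra B" and f: "range f \<subseteq> carrier B"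
    and rels: "\<And>r. r \<in> R \<Longrightarrow> lin_ext B (word_eval B f) r = \<zero>\<^bsub>B\<^esub>"
begin

text \<open>The preimage of the zero ideal under evaluation is an ideal containing the relations,
  hence contains all of \<open>I\<close>.\<close>

lemma eval_ideal: "i \<in> I \<Longrightarrow> lin_ext B (word_eval B f) i = \<zero>\<^bsub>B\<^esub>"
proof -
  interpret B: kalgebra B by (rule B)
  have "ideal {p \<in> carrier free_alg. lin_ext B (word_eval B f) p \<in> {\<zero>\<^bsub>B\<^esub>}} free_alg"
    by (rule F.alg_hom_vimage_ideal[OF B alg_hom_free[OF B f] B.zeroideal])
  then have "I \<subseteq> {p \<in> carrier free_alg. lin_ext B (word_eval B f) p \<in> {\<zero>\<^bsub>B\<^esub>}}"
    by (rule F.genideal_minimal) (auto simp: rels)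
  then show "i \<in> I \<Longrightarrow> lin_ext B (word_eval B f) i = \<zero>\<^bsub>B\<^esub>" by auto
qed

lemma alg_lift_coset: "alg_lift B f (I +>\<^bsub>free_alg\<^esub> p) = lin_ext B (word_eval B f) p"
proof -
  interpret B: kalgebra B by (rule B)
  show ?thesis
    using Q.the_elem_image_coset[OF B.kspace_axioms alg_hom_linear[OF alg_hom_free[OF B f]] eval_ideal, of p]
    by (simp add: alg_lift_def word_eval_def[abs_def])
qed

lemma alg_hom_alg_lift: "alg_hom P B (alg_lift B f)"
proof -
  interpret B: kalgebra B by (rule B)
  note hom = alg_hom_free[OF B f]
  note lin = alg_hom_linear[OF hom]
  note hom' = alg_hom_presented
  note lin' = alg_hom_linear[OF hom']
  have cl: "lin_ext B (word_eval B f) p \<in> carrier B" for p using linear_on_closed[OF lin] by simp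
  have lift: "alg_lift B f (I +>\<^bsub>free_alg\<^esub> p) = lin_ext B (word_eval B f) p" for p by (rule alg_lift_coset)
  show ?thesis unfolding alg_hom_def
  proof (intro conjI linear_onI ballI)
    fix a b c assume "a \<in> carrier P" "b \<in> carrier P"
    then obtain p q where a: "a = I +>\<^bsub>free_alg\<^esub> p" and b: "b = I +>\<^bsub>free_alg\<^esub> q" by (auto simp: presented_carrier)
    show "alg_lift B f (a \<oplus>\<^bsub>P\<^esub> b) = alg_lift B f a \<oplus>\<^bsub>B\<^esub> alg_lift B f b"
      unfolding a b using linear_on_add[OF lin', of p q] linear_on_add[OF lin, of p q] by (metis UNIV_I free_alg_simps(1) lift)
    show "alg_lift B f (a \<otimes>\<^bsub>P\<^esub> b) = alg_lift B f a \<otimes>\<^bsub>B\<^esub> alg_lift B f b"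
      unfolding a b using alg_hom_mult[OF hom', of p q] alg_hom_mult[OF hom, of p q] by (metis UNIV_I free_alg_simps(1) lift)
  next
    fix a c assume "a \<in> carrier P"
    then obtain p where a: "a = I +>\<^bsub>free_alg\<^esub> p" by (auto simp: presented_carrier)
    show "alg_lift B f a \<in> carrier B" by (simp add: a lift cl)
    show "alg_lift B f (c \<odot>\<^bsub>P\<^esub> a) = c \<odot>\<^bsub>B\<^esub> alg_lift B f a"
      unfolding a using linear_on_smult[OF lin', of p c] linear_on_smult[OF lin, of p c] by (metis UNIV_I free_alg_simps(1) lift)
  next
    show "alg_lift B f \<one>\<^bsub>P\<^esub> = \<one>\<^bsub>B\<^esub>"
      unfolding alg_hom_one[OF hom', symmetric] lift alg_hom_one[OF hom] ..
  qed
qed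

lemma alg_lift_gen: "alg_lift B f (gen s) = f s"
proof -
  interpret B: kalgebra B by (rule B)
  show ?thesis using f by (auto simp: presented_gen_def alg_lift_coset image_subset_iff)
qed

end

end

subsection \<open>Tensor products\<close>

definition bilinear_on ::
  "('k::field, 'a, 'c) module_scheme \<Rightarrow> ('k, 'b, 'd) module_scheme \<Rightarrow> ('k, 'v, 'e) module_scheme
    \<Rightarrow> ('a \<Rightarrow> 'b \<Rightarrow> 'v) \<Rightarrow> bool" where
  "bilinear_on A B V \<beta> \<longleftrightarrow>
     (\<forall>a\<in>carrier A. linear_on B V (\<beta> a)) \<and> (\<forall>b\<in>carrier B. linear_on A V (\<lambda>a. \<beta> a b))"

lemma bilinear_onI:
  assumes "\<And>a. a \<in> carrier A \<Longrightarrow> linear_on B V (\<beta> a)"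
    and "\<And>b. b \<in> carrier B \<Longrightarrow> linear_on A V (\<lambda>a. \<beta> a b)"
  shows "bilinear_on A B V \<beta>"
  using assms by (simp add: bilinear_on_def)

lemma bilinear_onD:
  assumes "bilinear_on A B V \<beta>"
  shows "a \<in> carrier A \<Longrightarrow> linear_on B V (\<beta> a)" "b \<in> carrier B \<Longrightarrow> linear_on A V (\<lambda>a. \<beta> a b)"
  using assms by (simp_all add: bilinear_on_def)

locale tensor = A: kalgebra A + B: kalgebra B
  for A :: "('k::field, 'a, 'c) module_scheme" and B :: "('k, 'b, 'd) module_scheme"
begin

abbreviation "M \<equiv> monoid_alg (A \<times>\<times> B) :: ('k, 'a \<times> 'b \<Rightarrow>\<^sub>0 'k) module"
abbreviation "T \<equiv> tensor_alg A B"
abbreviation pure (infixl \<open>\<bullet>\<close> 72) where "a \<bullet> b \<equiv> pure_tensor A B a b"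

sublocale M: kalgebra M
  by (rule kalgebra_monoid_alg[OF DirProd_monoid[OF A.monoid_axioms B.monoid_axioms]])

lemma single_closed: "a \<in> carrier A \<Longrightarrow> b \<in> carrier B \<Longrightarrow> Poly_Mapping.single (a, b) c \<in> carrier M"
  by simp

lemma M_minus: "p \<in> carrier M \<Longrightarrow> q \<in> carrier M \<Longrightarrow> p - q = p \<ominus>\<^bsub>M\<^esub> q"
proof -
  assume "p \<in> carrier M" "q \<in> carrier M"
  then have "(p - q) \<oplus>\<^bsub>M\<^esub> q = p" "p - q \<in> carrier M"
    using keys_diff[of p q] by auto
  moreover have "\<ominus>\<^bsub>M\<^esub> q = - q" using \<open>q \<in> carrier M\<close> by (intro M.minus_equality) auto
  ultimately show ?thesis by (simp add: a_minus_def)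
qed

lemma tensor_rels_closed: "tensor_rels A B \<subseteq> carrier M"
proof -
  have "p - q \<in> carrier M" if "p \<in> carrier M" "q \<in> carrier M" for p q
    using M_minus[OF that] that by (simp del: monoid_alg_simps)
  then show ?thesis
    unfolding tensor_rels_def using single_closed
    by (auto simp del: monoid_alg_simps)
qed

lemma M_mult_diff:
  "(p - q) \<otimes>\<^bsub>M\<^esub> r = p \<otimes>\<^bsub>M\<^esub> r - q \<otimes>\<^bsub>M\<^esub> r" "r \<otimes>\<^bsub>M\<^esub> (p - q) = r \<otimes>\<^bsub>M\<^esub> p - r \<otimes>\<^bsub>M\<^esub> q"
  using monoid_alg_l_distr[where M = "A \<times>\<times> B" and p = "p - q" and p' = q and q = r]
    monoid_alg_r_distr[where M = "A \<times>\<times> B" and p = "p - q" and p' = q and q = r]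
  by (simp_all add: algebra_simps)

text \<open>A bilinearity relation multiplied by a basis tensor is again a single bilinearity
  relation, with multiplied entries. So the linear span is already a two-sided ideal and the
  componentwise product descends.\<close>

lemma tensor_null_ideal: "ideal (tensor_null A B) M"
  unfolding tensor_null_def
proof (rule M.lin_span_ideal[OF tensor_rels_closed spans_monoid_alg])
  fix t s :: "'a \<times> 'b \<Rightarrow>\<^sub>0 'k" assume t: "t \<in> (\<lambda>a. Poly_Mapping.single a 1) ` carrier (A \<times>\<times> B)"
    and s: "s \<in> tensor_rels A B"
  obtain x y where t: "t = Poly_Mapping.single (x, y) 1" "x \<in> carrier A" "y \<in> carrier B"
    using t by auto
  note simps = t M_mult_diff A.l_distr A.r_distr B.l_distr B.r_distr
    A.smult_mult_left A.smult_mult_right B.smult_mult_left B.smult_mult_right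
  from s have "t \<otimes>\<^bsub>M\<^esub> s \<in> tensor_rels A B"
    unfolding tensor_rels_def
    by (elim UnE CollectE exE conjE)
      (simp_all add: simps, (metis A.m_closed B.m_closed t(2,3))+)
  then show "t \<otimes>\<^bsub>M\<^esub> s \<in> lin_span M (tensor_rels A B)"
    using M.lin_span_incl[OF tensor_rels_closed] by auto
  from s have "s \<otimes>\<^bsub>M\<^esub> t \<in> tensor_rels A B"
    unfolding tensor_rels_def
    by (elim UnE CollectE exE conjE)
      (simp_all add: simps, (metis A.m_closed B.m_closed t(2,3))+)
  then show "s \<otimes>\<^bsub>M\<^esub> t \<in> lin_span M (tensor_rels A B)"
    using M.lin_span_incl[OF tensor_rels_closed] by auto
qed

sublocale Q: kalgebra_ideal M "tensor_null A B"
  by (intro kalgebra_ideal.intro M.kalgebra_axioms tensor_null_ideal)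

sublocale T: kalgebra T
  unfolding tensor_alg_def by (rule Q.kalgebra_quot_alg)

lemma tensor_carrier: "carrier T = (\<lambda>p. tensor_null A B +>\<^bsub>M\<^esub> p) ` carrier M"
  by (simp add: tensor_alg_def Q.quot_alg_carrier)

lemma pure_closed [simp, intro]: "a \<in> carrier A \<Longrightarrow> b \<in> carrier B \<Longrightarrow> a \<bullet> b \<in> carrier T"
  using single_closed[of a b 1] unfolding pure_tensor_def tensor_carrier by blast

lemma pure_mult:
  "\<lbrakk>a \<in> carrier A; b \<in> carrier B; a' \<in> carrier A; b' \<in> carrier B\<rbrakk>
    \<Longrightarrow> (a \<bullet> b) \<otimes>\<^bsub>T\<^esub> (a' \<bullet> b') = (a \<otimes>\<^bsub>A\<^esub> a') \<bullet> (b \<otimes>\<^bsub>B\<^esub> b')"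
  by (simp add: pure_tensor_def tensor_alg_def Q.quot_alg_mult)

lemma pure_one: "\<one>\<^bsub>T\<^esub> = \<one>\<^bsub>A\<^esub> \<bullet> \<one>\<^bsub>B\<^esub>"
  by (simp add: pure_tensor_def tensor_alg_def Q.quot_alg_one)

lemma coset_eqI:
  assumes "p \<in> carrier M" "q \<in> carrier M" "p - q \<in> tensor_rels A B"
  shows "tensor_null A B +>\<^bsub>M\<^esub> p = tensor_null A B +>\<^bsub>M\<^esub> q"
  using assms M.lin_span_incl[OF tensor_rels_closed] Q.coset_eq_iff[OF assms(1,2)] M_minus[OF assms(1,2)]
  by (auto simp: tensor_null_def)

lemma pure_bilinear: "bilinear_on A B T (\<lambda>a b. a \<bullet> b)"
proof (rule bilinear_onI; rule linear_onI)
  fix a b b' assume "a \<in> carrier A" "b \<in> carrier B" "b' \<in> carrier B"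
  then show "a \<bullet> (b \<oplus>\<^bsub>B\<^esub> b') = a \<bullet> b \<oplus>\<^bsub>T\<^esub> a \<bullet> b'"
    using Q.quot_alg_add[of "Poly_Mapping.single (a, b) 1" "Poly_Mapping.single (a, b') 1"]
      keys_add[of "Poly_Mapping.single (a, b) (1::'k)" "Poly_Mapping.single (a, b') 1"]
    by (simp add: pure_tensor_def tensor_alg_def)
      (rule coset_eqI; auto simp: tensor_rels_def)
next
  fix a b b' assume "a \<in> carrier B" "b \<in> carrier A" "b' \<in> carrier A"
  then show "(b \<oplus>\<^bsub>A\<^esub> b') \<bullet> a = b \<bullet> a \<oplus>\<^bsub>T\<^esub> b' \<bullet> a"
    using Q.quot_alg_add[of "Poly_Mapping.single (b, a) 1" "Poly_Mapping.single (b', a) 1"]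
      keys_add[of "Poly_Mapping.single (b, a) (1::'k)" "Poly_Mapping.single (b', a) 1"]
    by (simp add: pure_tensor_def tensor_alg_def)
      (rule coset_eqI; auto simp: tensor_rels_def)
next
  fix a b c assume "a \<in> carrier A" "b \<in> carrier B"
  then show "a \<bullet> (c \<odot>\<^bsub>B\<^esub> b) = c \<odot>\<^bsub>T\<^esub> (a \<bullet> b)"
    using Q.quot_alg_smult[of "Poly_Mapping.single (a, b) 1" c]
    by (simp add: pure_tensor_def tensor_alg_def)
      (rule coset_eqI; auto simp: tensor_rels_def)
next
  fix a b c assume "b \<in> carrier B" "a \<in> carrier A"
  then show "(c \<odot>\<^bsub>A\<^esub> a) \<bullet> b = c \<odot>\<^bsub>T\<^esub> (a \<bullet> b)"
    using Q.quot_alg_smult[of "Poly_Mapping.single (a, b) 1" c]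
    by (simp add: pure_tensor_def tensor_alg_def)
      (rule coset_eqI; auto simp: tensor_rels_def)
qed auto

lemma spans_pure: "spans T {a \<bullet> b | a b. a \<in> carrier A \<and> b \<in> carrier B}"
proof -
  have "spans T ((\<lambda>p. tensor_null A B +>\<^bsub>M\<^esub> p) ` (\<lambda>a. Poly_Mapping.single a 1) ` carrier (A \<times>\<times> B))"
    using alg_hom_linear[OF Q.alg_hom_coset] tensor_carrier
    by (intro spans_image[OF M.kspace_axioms T.kspace_axioms _ _ spans_monoid_alg]) (simp_all add: tensor_alg_def)
  also have "(\<lambda>p. tensor_null A B +>\<^bsub>M\<^esub> p) ` (\<lambda>a. Poly_Mapping.single a 1) ` carrier (A \<times>\<times> B)
    = {a \<bullet> b | a b. a \<in> carrier A \<and> b \<in> carrier B}"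
    by (auto simp: pure_tensor_def)
  finally show ?thesis .
qed

text \<open>Spanning sets are substituted one tensor factor at a time, the other factor being held
  fixed.\<close>

lemma spans_pure_spans:
  assumes "spans A S" "spans B S'"
  shows "spans T {a \<bullet> b | a b. a \<in> S \<and> b \<in> S'}"
  unfolding spans_def
proof (intro conjI allI impI)
  note cl = spans_carrier[OF assms(1)] spans_carrier[OF assms(2)]
  show "{a \<bullet> b | a b. a \<in> S \<and> b \<in> S'} \<subseteq> carrier T" using cl by auto
  fix U assume U: "subspace_of U T" "{a \<bullet> b | a b. a \<in> S \<and> b \<in> S'} \<subseteq> U"
  have 1: "a \<bullet> b \<in> U" if a: "a \<in> S" and b: "b \<in> carrier B" for a b
  proof -
    have "S' \<subseteq> {b \<in> carrier B. a \<bullet> b \<in> U}" using U(2) a cl by auto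
    then show ?thesis
      using spansD[OF assms(2) B.subspace_vimage[OF T.kspace_axioms bilinear_onD(1)[OF pure_bilinear] U(1)] _ b, of a] a cl
      by auto
  qed
  have "a \<bullet> b \<in> U" if a: "a \<in> carrier A" and b: "b \<in> carrier B" for a b
  proof -
    have "S \<subseteq> {a \<in> carrier A. a \<bullet> b \<in> U}" using 1 b cl by auto
    then show ?thesis
      using spansD[OF assms(1) A.subspace_vimage[OF T.kspace_axioms bilinear_onD(2)[OF pure_bilinear] U(1)] _ a, of b] b
      by auto
  qed
  then have "{a \<bullet> b | a b. a \<in> carrier A \<and> b \<in> carrier B} \<subseteq> U" by auto
  from spansD[OF spans_pure U(1) this] show "carrier T \<subseteq> U" by auto
qed

context
  fixes V :: "('k, 'v, 'e) module_scheme" and \<beta>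
  assumes V: "kspace V" and \<beta>: "bilinear_on A B V \<beta>"
begin

lemma lin_ext_bilinear: "linear_on M V (lin_ext V (\<lambda>(a, b). \<beta> a b))"
  by (rule linear_on_lin_ext[OF V])
    (auto intro: linear_on_closed[OF bilinear_onD(1)[OF \<beta>]])

lemma lin_ext_tensor_null: "i \<in> tensor_null A B \<Longrightarrow> lin_ext V (\<lambda>(a, b). \<beta> a b) i = \<zero>\<^bsub>V\<^esub>"
proof -
  interpret V: kspace V by (rule V)
  let ?L = "lin_ext V (\<lambda>(a, b). \<beta> a b)"
  note bl = bilinear_onD[OF \<beta>]
  have cl [simp]: "\<beta> a b \<in> carrier V" if "a \<in> carrier A" "b \<in> carrier B" for a b
    using linear_on_closed[OF bl(1)] that .
  have sub: "subspace_of {p \<in> carrier M. ?L p \<in> {\<zero>\<^bsub>V\<^esub>}} M"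
    by (rule M.subspace_vimage[OF V lin_ext_bilinear]) (auto intro: subspace_ofI)
  have k: "(\<lambda>(a, b). \<beta> a b) ` Poly_Mapping.keys (p - q) \<subseteq> carrier V"
    if "(\<lambda>(a, b). \<beta> a b) ` Poly_Mapping.keys p \<subseteq> carrier V" "(\<lambda>(a, b). \<beta> a b) ` Poly_Mapping.keys q \<subseteq> carrier V" for p q :: "'a \<times> 'b \<Rightarrow>\<^sub>0 'k"
    using that keys_diff[of p q] by blast
  have k1: "(\<lambda>(a, b). \<beta> a b) ` Poly_Mapping.keys (Poly_Mapping.single (a, b) (c::'k)) \<subseteq> carrier V"
    if "a \<in> carrier A" "b \<in> carrier B" for a b c using that by simp
  have cancel: "(x \<oplus>\<^bsub>V\<^esub> y) \<ominus>\<^bsub>V\<^esub> x \<ominus>\<^bsub>V\<^esub> y = \<zero>\<^bsub>V\<^esub>" if "x \<in> carrier V" "y \<in> carrier V" for x y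
    using that by (simp add: a_minus_def V.a_assoc V.a_comm[of y] V.r_neg V.r_neg1 V.r_neg2)
  have "?L p = \<zero>\<^bsub>V\<^esub>" if "p \<in> tensor_rels A B" for p
    using that unfolding tensor_rels_def
    by (elim UnE CollectE exE conjE)
      (simp_all add: V.lin_ext_diff k k1 linear_on_add[OF bl(1)] linear_on_add[OF bl(2)]
        linear_on_smult[OF bl(1)] linear_on_smult[OF bl(2)] cancel V.r_neg[folded a_minus_def] flip: a_minus_def)
  then have "tensor_null A B \<subseteq> {p \<in> carrier M. ?L p \<in> {\<zero>\<^bsub>V\<^esub>}}"
    unfolding tensor_null_def using tensor_rels_closed by (intro M.lin_span_minimal[OF sub]) auto
  then show "i \<in> tensor_null A B \<Longrightarrow> ?L i = \<zero>\<^bsub>V\<^esub>" by auto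
qed

lemma tensor_lift_linear: "linear_on T V (tensor_lift V \<beta>)"
  unfolding tensor_alg_def tensor_lift_def[abs_def]
  by (rule linear_on_quot[OF Q.kalgebra_ideal_axioms V lin_ext_bilinear lin_ext_tensor_null])

lemma tensor_lift_pure: "a \<in> carrier A \<Longrightarrow> b \<in> carrier B \<Longrightarrow> tensor_lift V \<beta> (a \<bullet> b) = \<beta> a b"
proof -
  interpret V: kspace V by (rule V)
  show "a \<in> carrier A \<Longrightarrow> b \<in> carrier B \<Longrightarrow> tensor_lift V \<beta> (a \<bullet> b) = \<beta> a b"
    using V.lin_ext_single[of "\<lambda>(a, b). \<beta> a b" "(a, b)" 1] linear_on_closed[OF bilinear_onD(1)[OF \<beta>], of a b]
    unfolding tensor_lift_def pure_tensor_def
    by (subst Q.the_elem_image_coset[OF V lin_ext_bilinear lin_ext_tensor_null]) auto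
qed

end

end

section \<open>Scalar algebra, opposite algebra, and records with the same operations\<close>

lemma kalgebra_cong:
  fixes A :: "('k::field, 'a, 'c) module_scheme" and B :: "('k, 'a, 'd) module_scheme"
  assumes "kalgebra A" and eq: "carrier B = carrier A" "monoid.mult B = monoid.mult A" "one B = one A"
    "zero B = zero A" "add B = add A" "module.smult B = module.smult A"
  shows "kalgebra B"
proof -
  interpret kalgebra A by fact
  show ?thesis
    by (intro kalgebraI kspaceI) (simp_all add: eq a_ac m_assoc l_distr r_distr
      smult_r_distr smult_l_distr smult_smult smult_mult_left smult_mult_right)
qed

lemma kalgebra_scalar_alg: "kalgebra (scalar_alg :: ('k::field, 'k) module)"
  by (intro kalgebraI kspaceI) (simp_all add: scalar_alg_def algebra_simps)

lemma scalar_alg_simps [simp]: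
  "carrier scalar_alg = UNIV" "monoid.mult scalar_alg = (*)" "one scalar_alg = 1" "zero scalar_alg = 0"
  "add scalar_alg = (+)" "module.smult scalar_alg = (*)"
  by (simp_all add: scalar_alg_def)

lemma kalgebra_opposite_alg:
  fixes A :: "('k::field, 'a) module"
  assumes "kalgebra A"
  shows "kalgebra (opposite_alg A)"
proof -
  interpret kalgebra A by fact
  show ?thesis
    by (intro kalgebraI kspaceI) (simp_all add: opposite_alg_def a_ac m_assoc l_distr r_distr
      smult_r_distr smult_l_distr smult_smult smult_mult_left smult_mult_right)
qed

lemma opposite_alg_simps [simp]:
  "carrier (opposite_alg A) = carrier A" "a \<otimes>\<^bsub>opposite_alg A\<^esub> b = b \<otimes>\<^bsub>A\<^esub> a"
  "one (opposite_alg A) = one A" "zero (opposite_alg A) = zero A"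
  "add (opposite_alg A) = add A" "module.smult (opposite_alg A) = module.smult A"
  by (simp_all add: opposite_alg_def)

lemma (in monoid) nat_pow_opposite:
  assumes "a \<in> carrier G" "monoid.mult G' = (\<lambda>x y. y \<otimes> x)" "one G' = \<one>"
  shows "a [^]\<^bsub>G'\<^esub> (k::nat) = a [^] k"
proof (induction k)
  case (Suc k)
  have "a [^]\<^bsub>G'\<^esub> Suc k = a \<otimes> a [^]\<^bsub>G'\<^esub> k" using assms(2) by (simp add: nat_pow_def)
  then show ?case using Suc nat_pow_Suc2[OF assms(1)] by simp
qed (simp add: assms nat_pow_def)

subsection \<open>Operator algebras\<close>

text \<open>The linear operators on all functions, not just the finitely supported ones, so that
  representations carry no support condition. They serve to separate monomials in presented
  algebras.\<close>

definition op_alg :: "('k::field, ('i \<Rightarrow> 'k) \<Rightarrow> ('i \<Rightarrow> 'k)) module" where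
  "op_alg = \<lparr>carrier = {T. (\<forall>f h. T (\<lambda>i. f i + h i) = (\<lambda>i. T f i + T h i)) \<and> (\<forall>c f. T (\<lambda>i. c * f i) = (\<lambda>i. c * T f i))},
    monoid.mult = (\<lambda>S T f. S (T f)), one = (\<lambda>f. f), zero = (\<lambda>f i. 0),
    add = (\<lambda>S T f i. S f i + T f i), module.smult = (\<lambda>c T f i. c * T f i)\<rparr>"

lemma op_alg_simps [simp]:
  "monoid.mult op_alg = (\<lambda>S T f. S (T f))" "one op_alg = (\<lambda>f. f)" "zero op_alg = (\<lambda>f i. 0)"
  "add op_alg = (\<lambda>S T f i. S f i + T f i)" "module.smult op_alg = (\<lambda>c T f i. c * T f i)"
  by (simp_all add: op_alg_def)

lemma op_alg_carrierI:
  assumes "\<And>f h. T (\<lambda>i. f i + h i) = (\<lambda>i. T f i + T h i)" "\<And>c f. T (\<lambda>i. c * f i) = (\<lambda>i. c * T f i)"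
  shows "T \<in> carrier op_alg"
  using assms by (simp add: op_alg_def)

lemma op_alg_carrierD:
  assumes "T \<in> carrier op_alg"
  shows "T (\<lambda>i. f i + h i) = (\<lambda>i. T f i + T h i)" "T (\<lambda>i. c * f i) = (\<lambda>i. c * T f i)"
  using assms by (simp_all add: op_alg_def)

lemma kalgebra_op_alg: "kalgebra (op_alg :: ('k::field, ('i \<Rightarrow> 'k) \<Rightarrow> ('i \<Rightarrow> 'k)) module)"
  by (intro kalgebraI kspaceI) (auto intro!: op_alg_carrierI simp: op_alg_carrierD algebra_simps)

lemma op_alg_pow: "T [^]\<^bsub>op_alg\<^esub> (k::nat) = T ^^ k"
proof (induction k)
  case (Suc k)
  then show ?case by (simp add: nat_pow_def fun_eq_iff funpow_swap1)
qed (simp add: nat_pow_def fun_eq_iff)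

subsection \<open>Gaussian binomial coefficients\<close>

text \<open>Pascal's rule for Gaussian binomial coefficients, in the form produced by expanding (y +
  z)(y + z)^m when zy = q yz.\<close>

fun qbinomial :: "'k::field \<Rightarrow> nat \<Rightarrow> nat \<Rightarrow> 'k" where
  "qbinomial q m 0 = 1"
| "qbinomial q 0 (Suc k) = 0"
| "qbinomial q (Suc m) (Suc k) = qbinomial q m k + q ^ Suc k * qbinomial q m (Suc k)"

lemma qbinomial_eq_0: "m < k \<Longrightarrow> qbinomial q m k = 0"
proof (induction m arbitrary: k)
  case 0
  then show ?case by (cases k) auto
next
  case (Suc m)
  then show ?case by (cases k) auto
qed

text \<open>The ratio of neighbouring coefficients, (q^(m-k) - 1) / (q^(k+1) - 1), kept free of
  division because the denominator may vanish at roots of unity.\<close>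

lemma qbinomial_absorb:
  assumes "k \<le> m"
  shows "qbinomial q m (Suc k) * (q ^ Suc k - 1) = qbinomial q m k * (q ^ (m - k) - 1)"
  using assms
proof (induction m arbitrary: k)
  case (Suc m)
  show ?case
  proof (cases "k = Suc m")
    case True
    then show ?thesis by (simp add: qbinomial_eq_0)
  next
    case False
    then have k: "k \<le> m" using Suc.prems by simp
    have pw: "q ^ k * q ^ (m - k) = q ^ m" using k by (simp flip: power_add)
    have "qbinomial q (Suc m) (Suc k) * (q ^ Suc k - 1)
      = qbinomial q m k * (q ^ Suc k - 1) + q ^ Suc k * (qbinomial q m (Suc k) * (q ^ Suc k - 1))"
      by (simp add: distrib_right mult.assoc)
    also have "\<dots> = qbinomial q m k * (q * (q ^ k * q ^ (m - k)) - 1)"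
      unfolding Suc.IH[OF k] by (simp add: algebra_simps)
    finally have L: "qbinomial q (Suc m) (Suc k) * (q ^ Suc k - 1) = qbinomial q m k * (q ^ Suc m - 1)"
      by (simp add: pw)
    \<comment> \<open>The other side is brought to the same value
      \<open>qbinomial q m k * (q ^ Suc m - 1)\<close>, by Pascal's rule for its coefficient and the
      induction hypothesis at k - 1.\<close>
    show ?thesis
    proof (cases k)
      case 0
      then show ?thesis using L by simp
    next
      case (Suc j)
      have j: "j \<le> m" "m - j = Suc m - k" using Suc k by auto
      have pw': "q ^ k * q ^ (Suc m - k) = q ^ Suc m" using k by (simp flip: power_add)
      have "qbinomial q (Suc m) k * (q ^ (Suc m - k) - 1)
        = qbinomial q m j * (q ^ (Suc m - k) - 1) + q ^ k * qbinomial q m k * (q ^ (Suc m - k) - 1)"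
        by (simp add: Suc algebra_simps)
      also have "qbinomial q m j * (q ^ (Suc m - k) - 1) = qbinomial q m k * (q ^ k - 1)"
        using Suc.IH[OF j(1)] unfolding j(2) Suc[symmetric] by (rule sym)
      also have "qbinomial q m k * (q ^ k - 1) + q ^ k * qbinomial q m k * (q ^ (Suc m - k) - 1)
        = qbinomial q m k * (q ^ k * q ^ (Suc m - k) - 1)"
        by (simp add: algebra_simps)
      finally show ?thesis using L unfolding pw' by simp
    qed
  qed
qed simp

text \<open>In \<open>qbinomial_absorb\<close> the factor q^(k+1) - 1 is nonzero and cancels, while
  the right-hand side vanishes: through q^n = 1 for k = 0, through the preceding coefficient
  afterwards.\<close>

lemma qbinomial_root_of_unity:
  assumes "has_mult_order q n" "0 < k" "k < n"
  shows "qbinomial q n k = 0"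
  using assms(2,3)
proof (induction k)
  case (Suc k)
  have "q ^ Suc k \<noteq> 1" using assms(1) Suc.prems unfolding has_mult_order_def by auto
  moreover have "qbinomial q n (Suc k) * (q ^ Suc k - 1) = qbinomial q n k * (q ^ (n - k) - 1)"
    using Suc.prems by (intro qbinomial_absorb) simp
  moreover have "qbinomial q n k * (q ^ (n - k) - 1) = 0"
    using Suc assms(1) by (cases "k = 0") (auto simp: has_mult_order_def)
  ultimately show ?case by auto
qed simp

context kalgebra
begin

lemma q_commute_pow:
  assumes y: "y \<in> carrier A" and z: "z \<in> carrier A" and zy: "z \<otimes> y = q \<odot> (y \<otimes> z)"
  shows "z \<otimes> y [^] (k::nat) = q ^ k \<odot> (y [^] k \<otimes> z)"
proof (induction k)
  case (Suc k)
  have "z \<otimes> y [^] Suc k = (z \<otimes> y [^] k) \<otimes> y" using y z by (simp add: m_assoc)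
  also have "\<dots> = q ^ k \<odot> (y [^] k \<otimes> (z \<otimes> y))" unfolding Suc using y z by (simp add: smult_mult_left m_assoc)
  also have "\<dots> = q ^ Suc k \<odot> (y [^] Suc k \<otimes> z)"
    unfolding zy using y z by (simp add: smult_mult_right smult_smult m_assoc mult.commute)
  finally show ?case .
qed (simp add: z)

lemma q_binomial:
  assumes y: "y \<in> carrier A" and z: "z \<in> carrier A" and zy: "z \<otimes> y = q \<odot> (y \<otimes> z)"
  shows "(y \<oplus> z) [^] m = (\<Oplus>k\<in>{..m}. qbinomial q m k \<odot> (y [^] k \<otimes> z [^] (m - k)))"
proof (induction m)
  case 0
  then show ?case by simp
next
  case (Suc m)
  let ?t = "\<lambda>k l. y [^] (k::nat) \<otimes> z [^] (l::nat)"
  have t: "?t k l \<in> carrier A" for k l using y z by simp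
  have yt: "y \<otimes> ?t k l = ?t (Suc k) l" for k l
    using y z by (metis m_assoc nat_pow_Suc2 nat_pow_closed)
  have zt: "z \<otimes> ?t k l = q ^ k \<odot> ?t k (Suc l)" for k l
    using y z q_commute_pow[OF y z zy, of k]
    by (metis m_assoc nat_pow_Suc2 nat_pow_closed smult_mult_left m_closed)
  have "(y \<oplus> z) [^] Suc m = (y \<oplus> z) \<otimes> (y \<oplus> z) [^] m" using y z by (metis nat_pow_Suc2 a_closed)
  also have "\<dots> = (\<Oplus>k\<in>{..m}. (y \<oplus> z) \<otimes> (qbinomial q m k \<odot> ?t k (m - k)))"
    unfolding Suc using y z t by (intro finsum_rdistr) auto
  also have "\<dots> = (\<Oplus>k\<in>{..m}. qbinomial q m k \<odot> ?t (Suc k) (m - k) \<oplus> (q ^ k * qbinomial q m k) \<odot> ?t k (Suc m - k))"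
    using y z t by (intro finsum_cong')
      (auto simp: l_distr smult_mult_right yt zt smult_r_distr smult_smult Suc_diff_le mult.commute)
  also have "\<dots> = (\<Oplus>k\<in>{..m}. qbinomial q m k \<odot> ?t (Suc k) (m - k)) \<oplus> (\<Oplus>k\<in>{..m}. (q ^ k * qbinomial q m k) \<odot> ?t k (Suc m - k))"
    using t y z by (intro finsum_addf) auto
  \<comment> \<open>The added term k = m + 1 is zero since \<open>qbinomial q m (Suc m) = 0\<close>;
    shifting the index then isolates k = 0.\<close>
  also have "(\<Oplus>k\<in>{..m}. (q ^ k * qbinomial q m k) \<odot> ?t k (Suc m - k))
     = (\<Oplus>k\<in>{..Suc m}. (q ^ k * qbinomial q m k) \<odot> ?t k (Suc m - k))"
    using t y z by (subst finsum_Suc) (auto simp: qbinomial_eq_0)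
  also have "\<dots> = (\<Oplus>k\<in>{..m}. (q ^ Suc k * qbinomial q m (Suc k)) \<odot> ?t (Suc k) (m - k)) \<oplus> ?t 0 (Suc m)"
    using t y z by (subst finsum_Suc2) auto
  also have "(\<Oplus>k\<in>{..m}. qbinomial q m k \<odot> ?t (Suc k) (m - k)) \<oplus> \<dots>
     = (\<Oplus>k\<in>{..m}. qbinomial q m k \<odot> ?t (Suc k) (m - k) \<oplus> (q ^ Suc k * qbinomial q m (Suc k)) \<odot> ?t (Suc k) (m - k)) \<oplus> ?t 0 (Suc m)"
    using t y z by (subst finsum_addf) (auto simp: a_assoc)
  also have "\<dots> = (\<Oplus>k\<in>{..m}. qbinomial q (Suc m) (Suc k) \<odot> ?t (Suc k) (Suc m - Suc k)) \<oplus> ?t 0 (Suc m)"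
    using t y z by (intro arg_cong2[where f = "(\<oplus>)"] finsum_cong' refl) (auto simp: smult_l_distr)
  also have "\<dots> = (\<Oplus>k\<in>{..Suc m}. qbinomial q (Suc m) k \<odot> ?t k (Suc m - k))"
    using t y z by (subst finsum_Suc2) auto
  finally show ?case .
qed

text \<open>At a primitive nth root of unity only the outer terms z^n and y^n of the expansion
  survive.\<close>

lemma q_nilpotent_sum:
  assumes "y \<in> carrier A" "z \<in> carrier A" "z \<otimes> y = q \<odot> (y \<otimes> z)"
    and q: "has_mult_order q n" and "y [^] n = \<zero>" "z [^] n = \<zero>"
  shows "(y \<oplus> z) [^] n = \<zero>"
proof -
  have "qbinomial q n k \<odot> (y [^] k \<otimes> z [^] (n - k)) = \<zero>" if "k \<le> n" for k
    using that assms qbinomial_root_of_unity[OF q, of k]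
    by (cases "k = 0"; cases "k = n") auto
  then show ?thesis
    unfolding q_binomial[OF assms(1-3)] by (intro add.finprod_one_eqI) auto
qed

end

subsection \<open>Taft algebras\<close>

abbreviation taft_map :: "'b \<Rightarrow> 'b \<Rightarrow> taft_sym \<Rightarrow> 'b" where
  "taft_map G X \<equiv> (\<lambda>s. case s of SymG \<Rightarrow> G | SymX \<Rightarrow> X)"

lemma range_taft_map: "range (taft_map G X) = {G, X}"
  by (auto split: taft_sym.splits intro: range_eqI[of _ _ SymG] range_eqI[of _ _ SymX])

text \<open>Used in both directions: to obtain g^n = 1, x^n = 0 and xg = q gx in the presented
  algebra, and to license maps out of it.\<close>

lemma taft_rels_eval_iff:
  fixes B :: "('k::field, 'b, 'c) module_scheme" (structure)
  assumes "kalgebra B" and G: "G \<in> carrier B" and X: "X \<in> carrier B" and f: "f SymG = G" "f SymX = X"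
  shows "(\<forall>r\<in>taft_rels n q. lin_ext B (word_eval B f) r = \<zero>) \<longleftrightarrow>
    G [^] n = \<one> \<and> X [^] n = \<zero> \<and> X \<otimes> G = q \<odot> (G \<otimes> X)"
proof -
  interpret kalgebra B by fact
  have r: "range f \<subseteq> carrier B" using assms by (auto simp: image_subset_iff) (metis taft_sym.exhaust)
  note w = word_eval_closed[OF r]
  have k: "word_eval B f ` Poly_Mapping.keys p \<subseteq> carrier B" for p :: "taft_sym list \<Rightarrow>\<^sub>0 'k" using w by auto
  show ?thesis
    using G X by (simp add: taft_rels_def lin_ext_diff[OF k k] w word_eval_replicate[OF r] f)
qed

lemma (in presentation) spans_leftI:
  assumes S: "S \<subseteq> carrier P" and one: "\<one>\<^bsub>P\<^esub> \<in> lin_span P S"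
    and gen: "\<And>t s. s \<in> S \<Longrightarrow> gen t \<otimes>\<^bsub>P\<^esub> s \<in> lin_span P S"
  shows "spans P S"
  unfolding spans_def
proof (intro conjI allI impI subsetI)
  fix U a assume U: "subspace_of U P" "S \<subseteq> U" and a: "a \<in> carrier P"
  note sub = P.lin_span_subspace[OF S]
  have "a \<in> lin_span P S"
  proof (rule presented_left_induct[OF sub one _ a])
    fix t b assume b: "b \<in> lin_span P S"
    have "lin_span P S \<subseteq> {b \<in> carrier P. gen t \<otimes>\<^bsub>P\<^esub> b \<in> lin_span P S}"
      using S gen by (intro P.lin_span_minimal P.subspace_vimage[OF P.kspace_axioms _ sub] P.linear_on_mult_left) auto
    then show "gen t \<otimes>\<^bsub>P\<^esub> b \<in> lin_span P S" using b by auto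
  qed
  then show "a \<in> U" using P.lin_span_minimal[OF U] by auto
qed (use S in auto)

lemma has_mult_order_power_eq_iff:
  assumes q: "has_mult_order (q :: 'k::field) n"
  shows "q ^ k = q ^ l \<longleftrightarrow> k mod n = l mod n"
proof -
  have n: "0 < n" "q ^ n = 1" and m: "\<And>m. 0 < m \<Longrightarrow> m < n \<Longrightarrow> q ^ m \<noteq> 1"
    using q by (auto simp: has_mult_order_def)
  have q0: "q \<noteq> 0" using n by (metis power_0_left less_numeral_extra(3) zero_neq_one)
  have pm: "q ^ k = q ^ (k mod n)" for k
    by (metis mod_mult_div_eq mult_1_right n(2) power_add power_mult power_one)
  have "q ^ i \<noteq> q ^ j" if "i < j" "j < n" for i j
  proof
    assume "q ^ i = q ^ j"
    moreover have "q ^ j = q ^ i * q ^ (j - i)" using that by (simp flip: power_add)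
    ultimately have "q ^ (j - i) = 1" using q0 by simp
    then show False using m[of "j - i"] that by auto
  qed
  then have "q ^ i = q ^ j \<longleftrightarrow> i = j" if "i < n" "j < n" for i j
    using that by (metis nat_neq_iff)
  then show ?thesis using pm n(1) by (metis mod_less_divisor)
qed

lemma has_mult_order_power_eq_1_iff: "has_mult_order (q :: 'k::field) n \<Longrightarrow> q ^ k = 1 \<longleftrightarrow> n dvd k"
  using has_mult_order_power_eq_iff[of q n k 0] by (simp add: mod_eq_0_iff_dvd)

lemma has_mult_order_neq_0: "has_mult_order (q :: 'k::field) n \<Longrightarrow> q \<noteq> 0"
  by (auto simp: has_mult_order_def power_0_left)

section \<open>Monomials g^k x^l of the Taft algebra and their independence\<close>

locale taft =
  fixes n :: nat and q :: "'k::field_char_0"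
  assumes n: "1 < n" and q: "has_mult_order q n"
begin

sublocale presentation "taft_rels n q" .

abbreviation "g \<equiv> taft_g n q"
abbreviation "x \<equiv> taft_x n q"
abbreviation "H \<equiv> taft_hopf n q"
abbreviation "HH \<equiv> tensor_alg P P"

sublocale TP: tensor P P
  by unfold_locales

abbreviation tens (infixl \<open>\<bullet>\<close> 72) where "a \<bullet> b \<equiv> pure_tensor P P a b"

lemma relations: "g [^]\<^bsub>P\<^esub> n = \<one>\<^bsub>P\<^esub>" "x [^]\<^bsub>P\<^esub> n = \<zero>\<^bsub>P\<^esub>" "x \<otimes>\<^bsub>P\<^esub> g = q \<odot>\<^bsub>P\<^esub> (g \<otimes>\<^bsub>P\<^esub> x)"
  using iffD1[OF taft_rels_eval_iff[OF P.kalgebra_axioms, of g x gen n q]] eval_rels by simp_all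

lemma x_g_pow: "x \<otimes>\<^bsub>P\<^esub> g [^]\<^bsub>P\<^esub> (k::nat) = q ^ k \<odot>\<^bsub>P\<^esub> (g [^]\<^bsub>P\<^esub> k \<otimes>\<^bsub>P\<^esub> x)"
  by (rule P.q_commute_pow[OF _ _ relations(3)]) auto

lemma lift:
  assumes B: "kalgebra B" and G: "G \<in> carrier B" and X: "X \<in> carrier B"
    and rels: "G [^]\<^bsub>B\<^esub> n = \<one>\<^bsub>B\<^esub>" "X [^]\<^bsub>B\<^esub> n = \<zero>\<^bsub>B\<^esub>" "X \<otimes>\<^bsub>B\<^esub> G = q \<odot>\<^bsub>B\<^esub> (G \<otimes>\<^bsub>B\<^esub> X)"
  shows "alg_hom P B (alg_lift B (taft_map G X))"
    and "alg_lift B (taft_map G X) g = G" and "alg_lift B (taft_map G X) x = X"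
proof -
  have r: "range (taft_map G X) \<subseteq> carrier B" using G X by (simp add: range_taft_map)
  have e: "\<And>r. r \<in> taft_rels n q \<Longrightarrow> lin_ext B (word_eval B (taft_map G X)) r = \<zero>\<^bsub>B\<^esub>"
    using taft_rels_eval_iff[OF B G X, of "taft_map G X" n q] rels by simp
  show "alg_hom P B (alg_lift B (taft_map G X))" by (rule alg_hom_alg_lift[OF B r e])
  show "alg_lift B (taft_map G X) g = G" "alg_lift B (taft_map G X) x = X"
    using alg_lift_gen[OF B r e] by simp_all
qed

definition mon :: "nat \<Rightarrow> nat \<Rightarrow> (taft_sym list \<Rightarrow>\<^sub>0 'k) set" where
  "mon k l = g [^]\<^bsub>P\<^esub> k \<otimes>\<^bsub>P\<^esub> x [^]\<^bsub>P\<^esub> l"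

lemma mon_closed [simp, intro]: "mon k l \<in> carrier P"
  by (simp add: mon_def)

lemma mon_0_0: "mon 0 0 = \<one>\<^bsub>P\<^esub>"
  by (simp add: mon_def)

lemma g_mon: "g \<otimes>\<^bsub>P\<^esub> mon k l = mon (Suc k) l"
  by (metis mon_def P.m_assoc P.nat_pow_Suc2 P.nat_pow_closed gen_closed)

lemma x_mon: "x \<otimes>\<^bsub>P\<^esub> mon k l = q ^ k \<odot>\<^bsub>P\<^esub> mon k (Suc l)"
proof -
  have "x \<otimes>\<^bsub>P\<^esub> mon k l = (x \<otimes>\<^bsub>P\<^esub> g [^]\<^bsub>P\<^esub> k) \<otimes>\<^bsub>P\<^esub> x [^]\<^bsub>P\<^esub> l"
    by (simp add: mon_def P.m_assoc)
  also have "\<dots> = q ^ k \<odot>\<^bsub>P\<^esub> mon k (Suc l)"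
    unfolding x_g_pow mon_def P.nat_pow_Suc2[OF gen_closed]
    by (simp add: P.m_assoc P.smult_mult_left)
  finally show ?thesis .
qed

lemma mon_x: "mon k l \<otimes>\<^bsub>P\<^esub> x = mon k (Suc l)"
  by (simp add: mon_def P.m_assoc)

lemma mon_0_Suc_g: "mon k 0 \<otimes>\<^bsub>P\<^esub> g = mon (Suc k) 0"
  by (simp add: mon_def)

lemma mon_g: "mon k l \<otimes>\<^bsub>P\<^esub> g = q ^ l \<odot>\<^bsub>P\<^esub> mon (Suc k) l"
proof (induction l)
  case (Suc l)
  have "mon k (Suc l) \<otimes>\<^bsub>P\<^esub> g = mon k l \<otimes>\<^bsub>P\<^esub> (x \<otimes>\<^bsub>P\<^esub> g)"
    by (simp add: P.m_assoc flip: mon_x)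
  also have "\<dots> = q \<odot>\<^bsub>P\<^esub> ((mon k l \<otimes>\<^bsub>P\<^esub> g) \<otimes>\<^bsub>P\<^esub> x)"
    by (simp add: relations P.smult_mult_right P.m_assoc)
  also have "\<dots> = q ^ Suc l \<odot>\<^bsub>P\<^esub> mon (Suc k) (Suc l)"
    unfolding Suc by (simp add: P.smult_mult_left P.smult_smult mon_x)
  finally show ?case .
qed (simp add: mon_0_Suc_g)

lemma mon_eq_0: "n \<le> l \<Longrightarrow> mon k l = \<zero>\<^bsub>P\<^esub>"
proof -
  assume "n \<le> l"
  then have "x [^]\<^bsub>P\<^esub> l = x [^]\<^bsub>P\<^esub> n \<otimes>\<^bsub>P\<^esub> x [^]\<^bsub>P\<^esub> (l - n)" by (simp add: P.nat_pow_mult)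
  then show ?thesis by (simp add: mon_def relations)
qed

lemma mon_mod: "mon (k mod n) l = mon k l"
proof -
  have "g [^]\<^bsub>P\<^esub> (n * m) = \<one>\<^bsub>P\<^esub>" for m :: nat
    by (simp add: relations flip: P.nat_pow_pow)
  then have "g [^]\<^bsub>P\<^esub> (n * (k div n)) \<otimes>\<^bsub>P\<^esub> g [^]\<^bsub>P\<^esub> (k mod n) = g [^]\<^bsub>P\<^esub> (k mod n)"
    by simp
  then have "g [^]\<^bsub>P\<^esub> k = g [^]\<^bsub>P\<^esub> (k mod n)"
    by (simp add: P.nat_pow_mult)
  then show ?thesis by (simp add: mon_def)
qed

text \<open>The exponent of g is left unbounded, so that multiplication by g stays within the family
  and only x^n = 0 has to be invoked.\<close>

lemma spans_mon: "spans P {mon k l | k l. l < n}"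
proof (rule spans_leftI)
  let ?S = "{mon k l | k l. l < n}"
  have S: "?S \<subseteq> carrier P" by auto
  show "?S \<subseteq> carrier P" by (rule S)
  note sub = subspace_ofD[OF P.lin_span_subspace[OF S]] and incl = P.lin_span_incl[OF S]
  have mem: "mon k l \<in> lin_span P ?S" for k l
    using incl sub(2) by (cases "l < n") (auto simp: mon_eq_0)
  show "\<one>\<^bsub>P\<^esub> \<in> lin_span P ?S" using mem[of 0 0] by (simp add: mon_0_0)
  fix t s assume "s \<in> ?S"
  then show "gen t \<otimes>\<^bsub>P\<^esub> s \<in> lin_span P ?S"
    using mem sub(4) by (cases t) (auto simp: g_mon x_mon)
qed

text \<open>The sum over \<open>s\<close> of the \<open>n\<close>-dimensional modules with basis \<open>e\<^sub>j\<close> (\<open>j < n\<close>), where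
  \<open>x e\<^sub>j = e\<^bsub>j+1\<^esub>\<close> and \<open>g e\<^sub>j = q\<^bsup>s-j\<^esup> e\<^sub>j\<close>. Since \<open>g\<close> is diagonal, the exponent of \<open>g\<close> in
  \<open>g\<^sup>i x\<^sup>j\<close> is recovered by an inverse Fourier transform in \<open>s\<close>, see \<open>coeff\<close>.\<close>

definition rep_G :: "(nat \<times> nat \<Rightarrow> 'k) \<Rightarrow> (nat \<times> nat \<Rightarrow> 'k)" where
  "rep_G f = (\<lambda>(s, j). q ^ s / q ^ j * f (s, j))"

definition rep_X :: "(nat \<times> nat \<Rightarrow> 'k) \<Rightarrow> (nat \<times> nat \<Rightarrow> 'k)" where
  "rep_X f = (\<lambda>(s, j). if j = 0 \<or> n \<le> j then 0 else f (s, j - 1))"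

definition rep :: "(taft_sym list \<Rightarrow>\<^sub>0 'k) set \<Rightarrow> (nat \<times> nat \<Rightarrow> 'k) \<Rightarrow> (nat \<times> nat \<Rightarrow> 'k)" where
  "rep = alg_lift op_alg (taft_map rep_G rep_X)"

lemma rep_G_pow: "(rep_G ^^ k) f = (\<lambda>(s, j). (q ^ s / q ^ j) ^ k * f (s, j))"
  by (induction k) (auto simp: rep_G_def fun_eq_iff)

lemma rep_X_pow: "(rep_X ^^ k) f = (\<lambda>(s, j). if j < k \<or> (n \<le> j \<and> 0 < k) then 0 else f (s, j - k))"
  by (induction k) (auto simp: rep_X_def fun_eq_iff)

lemma rep: "alg_hom P op_alg rep" "rep g = rep_G" "rep x = rep_X"
proof -
  have G: "rep_G \<in> carrier op_alg" and X: "rep_X \<in> carrier op_alg"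
    by (auto intro!: op_alg_carrierI simp: rep_G_def rep_X_def algebra_simps)
  have q0: "q \<noteq> 0" using q by (rule has_mult_order_neq_0)
  have pn: "q ^ (s * n) = 1" for s
    using q by (metis has_mult_order_def mult.commute power_mult power_one)
  have "rep_G [^]\<^bsub>op_alg\<^esub> n = \<one>\<^bsub>op_alg\<^esub>" "rep_X [^]\<^bsub>op_alg\<^esub> n = \<zero>\<^bsub>op_alg\<^esub>"
    using n pn by (auto simp: op_alg_pow rep_G_pow rep_X_pow fun_eq_iff power_divide simp flip: power_mult)
  moreover have "rep_X \<otimes>\<^bsub>op_alg\<^esub> rep_G = q \<odot>\<^bsub>op_alg\<^esub> (rep_G \<otimes>\<^bsub>op_alg\<^esub> rep_X)"
  proof -
    \<comment> \<open>The relation xg = q gx says that lowering j by one multiplies the eigenvalue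
      q^(s-j) of g by q.\<close>
    have "q ^ s / q ^ (j - Suc 0) * c = q * (q ^ s / q ^ j * c)" if "0 < j" for s j c
      using that q0 by (cases j) (auto simp: field_simps)
    then show ?thesis by (auto simp: rep_G_def rep_X_def fun_eq_iff simp del: times_divide_eq_left times_divide_eq_right)
  qed
  ultimately show "alg_hom P op_alg rep" "rep g = rep_G" "rep x = rep_X"
    unfolding rep_def using lift[OF kalgebra_op_alg G X] by simp_all
qed

text \<open>The test function is the sum of the vectors e_0 over all s, so the value at (s, j) sees
  exactly the terms g^k x^j, each with the factor q^((s-j)k).\<close>

definition rep_coeff :: "nat \<Rightarrow> nat \<Rightarrow> (taft_sym list \<Rightarrow>\<^sub>0 'k) set \<Rightarrow> 'k" where
  "rep_coeff s j h = rep h (\<lambda>(s, j). if j = 0 then 1 else 0) (s, j)"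

lemma linear_rep_coeff: "linear_on P scalar_alg (rep_coeff s j)"
  using alg_hom_linear[OF rep(1)] by (intro linear_onI) (simp_all add: rep_coeff_def linear_on_def)

lemma rep_coeff_mon:
  assumes "l < n"
  shows "rep_coeff s j (mon k l) = (if j = l then (q ^ s / q ^ j) ^ k else 0)"
proof -
  have pow: "rep (a [^]\<^bsub>P\<^esub> (m::nat)) = rep a ^^ m" if "a \<in> carrier P" for a m
    using that alg_hom_mult[OF rep(1)] alg_hom_one[OF rep(1)]
    by (induction m) (auto simp: fun_eq_iff funpow_swap1)
  have "rep (mon k l) = (\<lambda>f. (rep_G ^^ k) ((rep_X ^^ l) f))"
    using alg_hom_mult[OF rep(1)] by (simp add: mon_def pow rep)
  then show ?thesis using assms n by (auto simp: rep_coeff_def rep_G_pow rep_X_pow)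
qed

text \<open>The division by n is where characteristic zero enters. The index i counts only modulo
  n.\<close>

definition coeff :: "nat \<Rightarrow> nat \<Rightarrow> (taft_sym list \<Rightarrow>\<^sub>0 'k) set \<Rightarrow> 'k" where
  "coeff i j h = (\<Sum>s<n. (q ^ j / q ^ s) ^ i * rep_coeff s j h) / of_nat n"

lemma linear_coeff: "linear_on P scalar_alg (coeff i j)"
  using linear_rep_coeff
  by (intro linear_onI) (simp_all add: coeff_def linear_on_def distrib_left sum.distrib
      add_divide_distrib sum_distrib_left mult_ac)

lemma coeff_mon:
  assumes l: "l < n"
  shows "coeff i j (mon k l) = (if j = l \<and> i mod n = k mod n then 1 else 0)"
proof (cases "j = l")
  case True
  have q0: "q \<noteq> 0" using q by (rule has_mult_order_neq_0)
  \<comment> \<open>Summation over s leaves a geometric series in z = q^(k-i), with value n if z = 1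
    and 0 otherwise because z^n = 1.\<close>
  let ?z = "q ^ k / q ^ i"
  have "(\<Sum>s<n. (q ^ j / q ^ s) ^ i * rep_coeff s j (mon k l)) = (\<Sum>s<n. (q ^ j) ^ i / (q ^ j) ^ k * ?z ^ s)"
  proof (rule sum.cong[OF refl])
    fix s
    have "(q ^ j / q ^ s) ^ i * (q ^ s / q ^ j) ^ k = (q ^ j) ^ i / (q ^ j) ^ k * ?z ^ s"
      using q0 by (simp add: power_divide mult.commute flip: power_mult)
    then show "(q ^ j / q ^ s) ^ i * rep_coeff s j (mon k l) = (q ^ j) ^ i / (q ^ j) ^ k * ?z ^ s"
      using True by (simp add: rep_coeff_mon[OF l])
  qed
  also have "\<dots> = (if i mod n = k mod n then of_nat n else 0)"
  proof (cases "i mod n = k mod n")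
    case eq: True
    then have "q ^ k = q ^ i" using has_mult_order_power_eq_iff[OF q, of k i] by simp
    moreover from this have "(q ^ j) ^ i = (q ^ j) ^ k" by (metis mult.commute power_mult)
    ultimately show ?thesis using q0 eq by simp
  next
    case False
    then have z1: "?z \<noteq> 1" using has_mult_order_power_eq_iff[OF q, of k i] q0 by auto
    have "(q ^ m) ^ n = 1" for m
      using q unfolding has_mult_order_def by (metis mult.commute power_mult power_one)
    then have "?z ^ n = 1" by (simp only: power_divide div_by_1)
    then have "(\<Sum>s<n. ?z ^ s) = 0" using geometric_sum[OF z1, of n] by simp
    then show ?thesis using False by (simp only: sum_distrib_left[symmetric] mult_zero_right if_False)
  qed
  finally show ?thesis using True n by (simp add: coeff_def)
qed (simp add: coeff_def rep_coeff_mon[OF l])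

lemma x_neq_zero: "x \<noteq> \<zero>\<^bsub>P\<^esub>"
proof
  assume "x = \<zero>\<^bsub>P\<^esub>"
  moreover have "x = mon 0 1" by (simp add: mon_def)
  ultimately have "coeff 0 1 (mon 0 1) = 0"
    using P.linear_on_zero[OF kalgebra.axioms(2)[OF kalgebra_scalar_alg] linear_coeff] by simp
  then show False using coeff_mon[of 1 0 1 0] n by simp
qed

section \<open>The Hopf structure maps of the Taft algebra\<close>

lemma taft_hopf_simps [simp]:
  "carrier H = carrier P" "monoid.mult H = monoid.mult P" "one H = one P" "zero H = zero P"
  "add H = add P" "module.smult H = module.smult P"
  by (simp_all add: taft_hopf_def Let_def)

lemma comult_def: "comult H = alg_lift HH (taft_map (g \<bullet> g) (g \<bullet> x \<oplus>\<^bsub>HH\<^esub> x \<bullet> \<one>\<^bsub>P\<^esub>))"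
  and counit_def: "counit H = alg_lift scalar_alg (taft_map 1 0)"
  and antipode_def: "antipode H = alg_lift (opposite_alg P)
    (taft_map (g [^]\<^bsub>P\<^esub> (n - 1)) (\<ominus>\<^bsub>P\<^esub> (g [^]\<^bsub>P\<^esub> (n - 1) \<otimes>\<^bsub>P\<^esub> x)))"
  unfolding taft_hopf_def Let_def by (simp_all only: hopf_alg.simps)

lemma pure_pow:
  "a \<in> carrier P \<Longrightarrow> b \<in> carrier P \<Longrightarrow> (a \<bullet> b) [^]\<^bsub>HH\<^esub> (k::nat) = (a [^]\<^bsub>P\<^esub> k) \<bullet> (b [^]\<^bsub>P\<^esub> k)"
  by (induction k) (simp_all add: TP.pure_one TP.pure_mult)

text \<open>For y = g \<otimes> x and z = x \<otimes> 1 one has zy = xg \<otimes> x = q yz, and both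
  nth powers vanish, so \<open>q_nilpotent_sum\<close> applies to the image of x.\<close>

lemma comult: "alg_hom P HH (comult H)" "comult H g = g \<bullet> g" "comult H x = g \<bullet> x \<oplus>\<^bsub>HH\<^esub> x \<bullet> \<one>\<^bsub>P\<^esub>"
proof -
  note bl = bilinear_onD[OF TP.pure_bilinear]
  note sm = linear_on_smult[OF bl(1)] linear_on_smult[OF bl(2)]
  note zer = P.linear_on_zero[OF TP.T.kspace_axioms bl(1)] P.linear_on_zero[OF TP.T.kspace_axioms bl(2)]
  have 1: "(g \<bullet> g) [^]\<^bsub>HH\<^esub> n = \<one>\<^bsub>HH\<^esub>" by (simp add: pure_pow relations TP.pure_one)
  have 2: "(g \<bullet> x \<oplus>\<^bsub>HH\<^esub> x \<bullet> \<one>\<^bsub>P\<^esub>) [^]\<^bsub>HH\<^esub> n = \<zero>\<^bsub>HH\<^esub>"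
    by (rule TP.T.q_nilpotent_sum[OF _ _ _ q]) (simp_all add: pure_pow relations TP.pure_mult sm zer)
  have 3: "(g \<bullet> x \<oplus>\<^bsub>HH\<^esub> x \<bullet> \<one>\<^bsub>P\<^esub>) \<otimes>\<^bsub>HH\<^esub> (g \<bullet> g)
      = q \<odot>\<^bsub>HH\<^esub> ((g \<bullet> g) \<otimes>\<^bsub>HH\<^esub> (g \<bullet> x \<oplus>\<^bsub>HH\<^esub> x \<bullet> \<one>\<^bsub>P\<^esub>))"
    by (simp add: TP.T.l_distr TP.T.r_distr TP.pure_mult relations(3) sm TP.T.smult_r_distr)
  show "alg_hom P HH (comult H)" "comult H g = g \<bullet> g" "comult H x = g \<bullet> x \<oplus>\<^bsub>HH\<^esub> x \<bullet> \<one>\<^bsub>P\<^esub>"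
    unfolding comult_def using lift[OF TP.T.kalgebra_axioms _ _ 1 2 3] by simp_all
qed

lemma counit: "alg_hom P scalar_alg (counit H)" "counit H g = 1" "counit H x = 0"
proof -
  have pow: "a [^]\<^bsub>scalar_alg\<^esub> (k::nat) = a ^ k" for a :: 'k and k
    by (induction k) (simp_all add: nat_pow_def mult.commute)
  show "alg_hom P scalar_alg (counit H)" "counit H g = 1" "counit H x = 0"
    unfolding counit_def using lift[OF kalgebra_scalar_alg, of 1 0] n by (simp_all add: pow power_0_left)
qed

lemma antipode: "alg_hom P (opposite_alg P) (antipode H)"
  "antipode H x = \<ominus>\<^bsub>P\<^esub> (g [^]\<^bsub>P\<^esub> (n - 1) \<otimes>\<^bsub>P\<^esub> x)"
proof -
  let ?G = "g [^]\<^bsub>P\<^esub> (n - 1)" and ?O = "opposite_alg P"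
  let ?X = "\<ominus>\<^bsub>P\<^esub> (?G \<otimes>\<^bsub>P\<^esub> x)"
  have pow: "a [^]\<^bsub>?O\<^esub> (k::nat) = a [^]\<^bsub>P\<^esub> k" if "a \<in> carrier P" for a k
    by (rule P.nat_pow_opposite[OF that]) (simp_all add: opposite_alg_def)
  have X: "?X = (- 1) \<odot>\<^bsub>P\<^esub> mon (n - 1) 1" by (simp add: P.smult_minus_one mon_def)
  have "?G [^]\<^bsub>P\<^esub> n = (g [^]\<^bsub>P\<^esub> n) [^]\<^bsub>P\<^esub> (n - 1)" by (simp add: P.nat_pow_pow mult.commute)
  then have 1: "?G [^]\<^bsub>?O\<^esub> n = \<one>\<^bsub>?O\<^esub>" by (simp add: pow relations)
  \<comment> \<open>Only the shape matters: up to a scalar the kth power is g^(k(n-1)) x^k, which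
    vanishes for k = n.\<close>
  have "\<exists>c. ?X [^]\<^bsub>P\<^esub> k = c \<odot>\<^bsub>P\<^esub> mon (k * (n - 1)) k" for k :: nat
  proof (induction k)
    case 0
    then show ?case by (intro exI[of _ 1]) (simp add: mon_0_0)
  next
    case (Suc k)
    then obtain c where c: "?X [^]\<^bsub>P\<^esub> k = c \<odot>\<^bsub>P\<^esub> mon (k * (n - 1)) k" by auto
    have gm: "g [^]\<^bsub>P\<^esub> i \<otimes>\<^bsub>P\<^esub> mon a l = mon (i + a) l" for i a l :: nat
      by (simp add: mon_def P.m_assoc flip: P.nat_pow_mult)
    have "?X [^]\<^bsub>P\<^esub> Suc k = ?X \<otimes>\<^bsub>P\<^esub> ?X [^]\<^bsub>P\<^esub> k" by (rule P.nat_pow_Suc2) simp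
    also have "\<dots> = (- c) \<odot>\<^bsub>P\<^esub> (?G \<otimes>\<^bsub>P\<^esub> (x \<otimes>\<^bsub>P\<^esub> mon (k * (n - 1)) k))"
      unfolding c unfolding X by (simp add: P.smult_mult_left P.smult_mult_right P.smult_smult mon_def P.m_assoc)
    also have "\<dots> = (- c * q ^ (k * (n - 1))) \<odot>\<^bsub>P\<^esub> mon (Suc k * (n - 1)) (Suc k)"
      by (simp add: x_mon P.smult_mult_right P.smult_smult gm)
    finally show ?case by blast
  qed
  then obtain c where "?X [^]\<^bsub>P\<^esub> n = c \<odot>\<^bsub>P\<^esub> mon (n * (n - 1)) n" by blast
  then have "?X [^]\<^bsub>P\<^esub> n = \<zero>\<^bsub>P\<^esub>" by (simp add: mon_eq_0)
  then have 2: "?X [^]\<^bsub>?O\<^esub> n = \<zero>\<^bsub>?O\<^esub>" by (simp add: pow)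
  have q': "q * q ^ (n - 1) = 1" using q n by (cases n) (auto simp: has_mult_order_def)
  \<comment> \<open>In the opposite algebra the third relation reads GX = q XG. Moving x past
    g^(n-1) costs q^(n-1), the inverse of q.\<close>
  have "?G \<otimes>\<^bsub>P\<^esub> ?X = (- 1) \<odot>\<^bsub>P\<^esub> (?G \<otimes>\<^bsub>P\<^esub> mon (n - 1) 1)"
    unfolding X by (simp add: P.smult_mult_right)
  also have "\<dots> = (q * (- 1) * q ^ (n - 1)) \<odot>\<^bsub>P\<^esub> (?G \<otimes>\<^bsub>P\<^esub> mon (n - 1) 1)"
    using q' by (simp add: mult.assoc mult.commute)
  also have "\<dots> = q \<odot>\<^bsub>P\<^esub> ((- 1) \<odot>\<^bsub>P\<^esub> (?G \<otimes>\<^bsub>P\<^esub> (q ^ (n - 1) \<odot>\<^bsub>P\<^esub> (?G \<otimes>\<^bsub>P\<^esub> x))))"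
    by (simp add: mon_def P.smult_mult_right P.smult_smult)
  also have "\<dots> = q \<odot>\<^bsub>P\<^esub> (?X \<otimes>\<^bsub>P\<^esub> ?G)"
    unfolding x_g_pow[symmetric] X by (simp add: mon_def P.smult_mult_left P.m_assoc)
  finally have 3: "?X \<otimes>\<^bsub>?O\<^esub> ?G = q \<odot>\<^bsub>?O\<^esub> (?G \<otimes>\<^bsub>?O\<^esub> ?X)" by simp
  show "alg_hom P ?O (antipode H)" "antipode H x = ?X"
    unfolding antipode_def using lift[OF kalgebra_opposite_alg[OF P.kalgebra_axioms] _ _ 1 2 3] by simp_all
qed

text \<open>Each Hopf ideal condition says that an algebra homomorphism maps into some ideal, so it
  cuts out an ideal and is checked on x alone. This ideal contradicts inner faithfulness when x acts
  by zero.\<close>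

lemma hopf_ideal_genideal_x: "hopf_ideal (Idl\<^bsub>P\<^esub> {x}) H"
proof -
  let ?I = "Idl\<^bsub>P\<^esub> {x}"
  interpret I: ideal ?I P by (rule P.genideal_ideal) simp
  have xI: "x \<in> ?I" using P.genideal_self[of "{x}"] by simp
  have IP: "?I \<subseteq> carrier P" by (rule I.a_subset)
  let ?S = "{a \<bullet> b | a b. a \<in> ?I \<and> b \<in> carrier P} \<union> {a \<bullet> b | a b. a \<in> carrier P \<and> b \<in> ?I}"
  have S: "?S \<subseteq> carrier HH" using IP by auto
  \<comment> \<open>For I the ideal generated by x, the sum of I \<otimes> P and P \<otimes> I is a
    two-sided ideal of P \<otimes> P.\<close>
  have J: "ideal (lin_span HH ?S) HH"
  proof (rule TP.T.lin_span_ideal[OF S TP.spans_pure])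
    fix t s assume "t \<in> {a \<bullet> b | a b. a \<in> carrier P \<and> b \<in> carrier P}" and s: "s \<in> ?S"
    then obtain a b where t: "t = a \<bullet> b" "a \<in> carrier P" "b \<in> carrier P" by auto
    from s obtain c d where c: "s = c \<bullet> d" "c \<in> carrier P" "d \<in> carrier P" "c \<in> ?I \<or> d \<in> ?I" using IP by auto
    have "a \<otimes>\<^bsub>P\<^esub> c \<in> ?I \<or> b \<otimes>\<^bsub>P\<^esub> d \<in> ?I" "c \<otimes>\<^bsub>P\<^esub> a \<in> ?I \<or> d \<otimes>\<^bsub>P\<^esub> b \<in> ?I"
      using t(2,3) c(4) I.I_l_closed I.I_r_closed by auto
    moreover have "t \<otimes>\<^bsub>HH\<^esub> s = (a \<otimes>\<^bsub>P\<^esub> c) \<bullet> (b \<otimes>\<^bsub>P\<^esub> d)" "s \<otimes>\<^bsub>HH\<^esub> t = (c \<otimes>\<^bsub>P\<^esub> a) \<bullet> (d \<otimes>\<^bsub>P\<^esub> b)"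
      using t c(1-3) by (simp_all add: TP.pure_mult)
    moreover have "a \<otimes>\<^bsub>P\<^esub> c \<in> carrier P" "b \<otimes>\<^bsub>P\<^esub> d \<in> carrier P" "c \<otimes>\<^bsub>P\<^esub> a \<in> carrier P" "d \<otimes>\<^bsub>P\<^esub> b \<in> carrier P"
      using t c by auto
    ultimately have "t \<otimes>\<^bsub>HH\<^esub> s \<in> ?S" "s \<otimes>\<^bsub>HH\<^esub> t \<in> ?S" by blast+
    then show "t \<otimes>\<^bsub>HH\<^esub> s \<in> lin_span HH ?S" "s \<otimes>\<^bsub>HH\<^esub> t \<in> lin_span HH ?S"
      using TP.T.lin_span_incl[OF S] by auto
  qed
  have "g \<bullet> x \<in> ?S" by (intro UnI2 CollectI exI conjI) (auto simp: xI)
  moreover have "x \<bullet> \<one>\<^bsub>P\<^esub> \<in> ?S" by (intro UnI1 CollectI exI conjI) (auto simp: xI)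
  ultimately have "g \<bullet> x \<in> lin_span HH ?S" "x \<bullet> \<one>\<^bsub>P\<^esub> \<in> lin_span HH ?S"
    using TP.T.lin_span_incl[OF S] by auto
  then have "comult H x \<in> lin_span HH ?S"
    using subspace_ofD(3)[OF TP.T.lin_span_subspace[OF S]] by (simp add: comult)
  then have comult_I: "?I \<subseteq> {h \<in> carrier P. comult H h \<in> lin_span HH ?S}"
    by (intro P.genideal_minimal P.alg_hom_vimage_ideal[OF TP.T.kalgebra_axioms comult(1) J]) auto
  interpret S: kalgebra "scalar_alg :: ('k, 'k) module" by (rule kalgebra_scalar_alg)
  have counit_I: "?I \<subseteq> {h \<in> carrier P. counit H h \<in> {\<zero>\<^bsub>scalar_alg :: ('k, 'k) module\<^esub>}}"
    by (intro P.genideal_minimal P.alg_hom_vimage_ideal[OF S.kalgebra_axioms counit(1) S.zeroideal])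
      (auto simp: counit)
  interpret O: kalgebra "opposite_alg P" by (rule kalgebra_opposite_alg[OF P.kalgebra_axioms])
  \<comment> \<open>The antipode is a homomorphism into the opposite algebra, so the target ideal
    has to be one there.\<close>
  have "ideal ?I (opposite_alg P)"
    using P.ideal_subspace[OF I.ideal_axioms] I.I_l_closed I.I_r_closed
    by (intro O.subspace_ideal) (auto simp: subspace_of_def)
  moreover have "antipode H x \<in> ?I"
    unfolding antipode using xI by (intro I.a_inv_closed I.I_l_closed) auto
  ultimately have antipode_I: "?I \<subseteq> {h \<in> carrier P. antipode H h \<in> ?I}"
    by (intro P.genideal_minimal P.alg_hom_vimage_ideal[OF O.kalgebra_axioms antipode(1)]) auto
  \<comment> \<open>The tensor constructions see only the algebra operations, in which
    \<open>H\<close> and \<open>P\<close> agree.\<close>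
  have HT: "tensor_alg H H = HH" "pure_tensor H H = pure_tensor P P"
    by (simp_all add: tensor_alg_def pure_tensor_def[abs_def] tensor_null_def tensor_rels_def DirProd_def)
  have "ideal ?I H"
    using P.ideal_subspace[OF I.ideal_axioms] I.I_l_closed I.I_r_closed
    by (intro kalgebra.subspace_ideal[OF kalgebra_cong[OF P.kalgebra_axioms]]) (auto simp: subspace_of_def)
  then show ?thesis
    unfolding hopf_ideal_def HT using comult_I counit_I antipode_I by auto
qed

end

subsection \<open>Quantum planes and quantum Weyl algebras\<close>

context kalgebra
begin

lemma subalgebraI:
  assumes "B \<subseteq> carrier A" "\<one> \<in> B" "\<And>a b. \<lbrakk>a \<in> B; b \<in> B\<rbrakk> \<Longrightarrow> a \<oplus> b \<in> B"
    and "\<And>a b. \<lbrakk>a \<in> B; b \<in> B\<rbrakk> \<Longrightarrow> a \<otimes> b \<in> B" "\<And>c a. a \<in> B \<Longrightarrow> c \<odot> a \<in> B"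
  shows "subalgebra B A"
  unfolding subalgebra_def
proof (intro conjI subringI allI ballI)
  fix a assume "a \<in> B"
  then show "\<ominus> a \<in> B" using assms(1,5) by (subst smult_minus_one) auto
qed (use assms in auto)

lemma subalgebraD:
  assumes "subalgebra B A"
  shows "B \<subseteq> carrier A" "\<one> \<in> B" "\<zero> \<in> B" "\<And>a b. \<lbrakk>a \<in> B; b \<in> B\<rbrakk> \<Longrightarrow> a \<oplus> b \<in> B"
    and "\<And>a b. \<lbrakk>a \<in> B; b \<in> B\<rbrakk> \<Longrightarrow> a \<otimes> b \<in> B" "\<And>c a. a \<in> B \<Longrightarrow> c \<odot> a \<in> B"
  using assms subringE[of B A] unfolding subalgebra_def by auto

lemma subalgebra_gen_subalgebra:
  assumes "S \<subseteq> carrier A"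
  shows "subalgebra (gen_subalgebra A S) A"
proof (rule subalgebraI)
  have "subalgebra (carrier A) A" by (rule subalgebraI) auto
  then show "gen_subalgebra A S \<subseteq> carrier A" using assms by (auto simp: gen_subalgebra_def)
qed (auto simp: gen_subalgebra_def dest: subalgebraD(2,4,5,6))

lemma gen_subalgebra_incl: "S \<subseteq> gen_subalgebra A S"
  by (auto simp: gen_subalgebra_def)

lemma gen_subalgebra_minimal: "subalgebra B A \<Longrightarrow> S \<subseteq> B \<Longrightarrow> gen_subalgebra A S \<subseteq> B"
  by (auto simp: gen_subalgebra_def)

lemma subalgebra_pow: "subalgebra B A \<Longrightarrow> a \<in> B \<Longrightarrow> a [^] (k::nat) \<in> B"
  by (induction k) (auto dest: subalgebraD)

end

text \<open>The sum \<epsilon>(\<mu>^-1 + ... + \<mu>^-i), the correction c_i in v u^i = \<mu>^-i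
  u^i v - c_i u^(i-1).\<close>

fun weyl_coeff :: "'k::field \<Rightarrow> 'k \<Rightarrow> nat \<Rightarrow> 'k" where
  "weyl_coeff \<mu> \<epsilon> 0 = 0"
| "weyl_coeff \<mu> \<epsilon> (Suc i) = (weyl_coeff \<mu> \<epsilon> i + \<epsilon>) / \<mu>"

text \<open>The geometric sum with its denominator cleared: c_i (\<mu> - 1) = \<epsilon>(1 -
  \<mu>^-i). Its vanishing at n makes u^n commute with v, and v^n with u.\<close>

lemma weyl_coeff_root_of_unity:
  assumes "\<mu> \<noteq> 0" "\<mu> \<noteq> 1" "\<mu> ^ n = 1"
  shows "weyl_coeff \<mu> \<epsilon> n = 0"
proof -
  have "weyl_coeff \<mu> \<epsilon> i * (\<mu> - 1) = \<epsilon> * (1 - (1 / \<mu>) ^ i)" for i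
  proof (induction i)
    case (Suc i)
    have "weyl_coeff \<mu> \<epsilon> (Suc i) * (\<mu> - 1) = (weyl_coeff \<mu> \<epsilon> i * (\<mu> - 1) + \<epsilon> * (\<mu> - 1)) / \<mu>"
      by (simp add: algebra_simps)
    also have "\<dots> = \<epsilon> * (1 - (1 / \<mu>) ^ Suc i)" unfolding Suc using assms(1) by (simp add: field_simps)
    finally show ?case .
  qed simp
  from this[of n] show ?thesis using assms by (simp add: power_divide)
qed

text \<open>Exchanging \<open>u\<close> and \<open>v\<close> preserves the shape of the relation, so all results on the pair
  \<open>(u, v)\<close> with parameters \<open>(\<mu>, \<epsilon>)\<close> also apply to \<open>(v, u)\<close> with \<open>(1 / \<mu>, - \<epsilon> / \<mu>)\<close>.\<close>

lemma (in kalgebra) weyl_swap: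
  assumes "u \<in> carrier A" "v \<in> carrier A" "\<mu> \<noteq> 0" "u \<otimes> v = \<mu> \<odot> (v \<otimes> u) \<oplus> \<epsilon> \<odot> \<one>"
  shows "v \<otimes> u = (1 / \<mu>) \<odot> (u \<otimes> v) \<oplus> (- \<epsilon> / \<mu>) \<odot> \<one>"
proof -
  have "(1 / \<mu>) \<odot> (u \<otimes> v) \<oplus> (- \<epsilon> / \<mu>) \<odot> \<one> = v \<otimes> u \<oplus> ((\<epsilon> / \<mu>) \<odot> \<one> \<oplus> (- \<epsilon> / \<mu>) \<odot> \<one>)"
    unfolding assms(4) using assms(1-3) by (simp add: smult_r_distr smult_smult a_assoc)
  also have "\<dots> = v \<otimes> u"
    using assms(1,2) by (simp flip: smult_l_distr)
  finally show ?thesis ..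
qed

text \<open>Covers the quantum plane (\<epsilon> = 0) and the quantum Weyl algebra (\<epsilon> = 1),
  both with u and v exchanged, and the operators that represent them.\<close>

locale weyl_relation = kalgebra A for A :: "('k::field, 'a, 'c) module_scheme" (structure) +
  fixes u v :: 'a and \<mu> \<epsilon> :: 'k
  assumes u [simp, intro]: "u \<in> carrier A" and v [simp, intro]: "v \<in> carrier A"
    and \<mu>: "\<mu> \<noteq> 0" and uv: "u \<otimes> v = \<mu> \<odot> (v \<otimes> u) \<oplus> \<epsilon> \<odot> \<one>"
begin

abbreviation "c \<equiv> weyl_coeff \<mu> \<epsilon>"

definition mon :: "nat \<Rightarrow> nat \<Rightarrow> 'a" where "mon i j = u [^] i \<otimes> v [^] j"

lemma mon_closed [simp, intro]: "mon i j \<in> carrier A"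
  by (simp add: mon_def)

lemma mon_0_0: "mon 0 0 = \<one>"
  by (simp add: mon_def)

lemma vu: "v \<otimes> u = (1 / \<mu>) \<odot> (u \<otimes> v) \<oplus> (- \<epsilon> / \<mu>) \<odot> \<one>"
  by (rule weyl_swap[OF u v \<mu> uv])

text \<open>For i = 0 the truncated exponent i - 1 is harmless, because its coefficient
  \<open>c 0\<close> is zero; the same convention is kept in all the formulas below.\<close>

lemma v_u_pow: "v \<otimes> u [^] i = (1 / \<mu>) ^ i \<odot> (u [^] i \<otimes> v) \<oplus> (- c i) \<odot> u [^] (i - 1)"
proof (induction i)
  case (Suc i)
  have c: "c i \<odot> (u \<otimes> u [^] (i - 1)) = c i \<odot> u [^] i"
    by (cases i) (simp_all flip: nat_pow_Suc2)
  have "v \<otimes> u [^] Suc i = (v \<otimes> u) \<otimes> u [^] i" by (simp add: m_assoc flip: nat_pow_Suc2)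
  also have "\<dots> = (1 / \<mu>) \<odot> (u \<otimes> (v \<otimes> u [^] i)) \<oplus> (- \<epsilon> / \<mu>) \<odot> u [^] i"
    unfolding vu by (simp add: l_distr smult_mult_left m_assoc)
  also have "u \<otimes> (v \<otimes> u [^] i) = (1 / \<mu>) ^ i \<odot> (u [^] Suc i \<otimes> v) \<oplus> (- 1) \<odot> (c i \<odot> u [^] i)"
    unfolding Suc c[symmetric] nat_pow_Suc2[OF u] by (simp add: r_distr smult_mult_right m_assoc smult_smult)
  also have "(1 / \<mu>) \<odot> \<dots> \<oplus> (- \<epsilon> / \<mu>) \<odot> u [^] i
    = (1 / \<mu>) ^ Suc i \<odot> (u [^] Suc i \<otimes> v) \<oplus> ((- c i / \<mu>) \<odot> u [^] i \<oplus> (- \<epsilon> / \<mu>) \<odot> u [^] i)"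
    by (simp add: smult_r_distr smult_smult a_assoc)
  also have "(- c i / \<mu>) \<odot> u [^] i \<oplus> (- \<epsilon> / \<mu>) \<odot> u [^] i = (- c (Suc i)) \<odot> u [^] i"
    by (simp add: add_divide_distrib flip: smult_l_distr)
  finally show ?case by simp
qed simp

lemma v_pow_u: "v [^] j \<otimes> u = (1 / \<mu>) ^ j \<odot> (u \<otimes> v [^] j) \<oplus> (- c j) \<odot> v [^] (j - 1)"
proof (induction j)
  case (Suc j)
  have c: "c j \<odot> (v [^] (j - 1) \<otimes> v) = c j \<odot> v [^] j"
    by (cases j) simp_all
  have "v [^] Suc j \<otimes> u = v [^] j \<otimes> (v \<otimes> u)" by (simp add: m_assoc)
  also have "\<dots> = (1 / \<mu>) \<odot> ((v [^] j \<otimes> u) \<otimes> v) \<oplus> (- \<epsilon> / \<mu>) \<odot> v [^] j"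
    unfolding vu by (simp add: r_distr smult_mult_right m_assoc)
  also have "(v [^] j \<otimes> u) \<otimes> v = (1 / \<mu>) ^ j \<odot> (u \<otimes> v [^] Suc j) \<oplus> (- 1) \<odot> (c j \<odot> v [^] j)"
    unfolding Suc c[symmetric] by (simp add: l_distr smult_mult_left m_assoc smult_smult)
  also have "(1 / \<mu>) \<odot> \<dots> \<oplus> (- \<epsilon> / \<mu>) \<odot> v [^] j
    = (1 / \<mu>) ^ Suc j \<odot> (u \<otimes> v [^] Suc j) \<oplus> ((- c j / \<mu>) \<odot> v [^] j \<oplus> (- \<epsilon> / \<mu>) \<odot> v [^] j)"
    by (simp add: smult_r_distr smult_smult a_assoc)
  also have "(- c j / \<mu>) \<odot> v [^] j \<oplus> (- \<epsilon> / \<mu>) \<odot> v [^] j = (- c (Suc j)) \<odot> v [^] j"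
    by (simp add: add_divide_distrib flip: smult_l_distr)
  finally show ?case by simp
qed simp

lemma u_mon: "u \<otimes> mon i j = mon (Suc i) j"
  by (metis mon_def m_assoc nat_pow_Suc2 nat_pow_closed u v)

lemma mon_v: "mon i j \<otimes> v = mon i (Suc j)"
  by (simp add: mon_def m_assoc)

lemma v_mon: "v \<otimes> mon i j = (1 / \<mu>) ^ i \<odot> mon i (Suc j) \<oplus> (- c i) \<odot> mon (i - 1) j"
proof -
  have "v \<otimes> mon i j = (v \<otimes> u [^] i) \<otimes> v [^] j" by (simp add: mon_def m_assoc)
  also have "\<dots> = (1 / \<mu>) ^ i \<odot> (u [^] i \<otimes> (v \<otimes> v [^] j)) \<oplus> (- c i) \<odot> mon (i - 1) j"
    unfolding v_u_pow by (simp add: mon_def l_distr smult_mult_left m_assoc)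
  finally show ?thesis by (simp only: mon_def nat_pow_Suc2[OF v])
qed

lemma mon_u: "mon i j \<otimes> u = (1 / \<mu>) ^ j \<odot> mon (Suc i) j \<oplus> (- c j) \<odot> mon i (j - 1)"
proof -
  have "mon i j \<otimes> u = u [^] i \<otimes> (v [^] j \<otimes> u)" by (simp add: mon_def m_assoc)
  also have "\<dots> = (1 / \<mu>) ^ j \<odot> ((u [^] i \<otimes> u) \<otimes> v [^] j) \<oplus> (- c j) \<odot> mon i (j - 1)"
    unfolding v_pow_u by (simp add: mon_def r_distr smult_mult_right m_assoc)
  finally show ?thesis by (simp only: mon_def nat_pow_Suc)
qed

end

text \<open>Left multiplication by \<open>u\<close> and \<open>v\<close> on coefficient functions with respect to the candidate
  basis \<open>u\<^sup>p v\<^sup>q\<close>.\<close>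

definition weyl_U :: "(nat \<times> nat \<Rightarrow> 'k::field) \<Rightarrow> (nat \<times> nat \<Rightarrow> 'k)" where
  "weyl_U f = (\<lambda>(p, q). if p = 0 then 0 else f (p - 1, q))"

definition weyl_V :: "'k::field \<Rightarrow> 'k \<Rightarrow> (nat \<times> nat \<Rightarrow> 'k) \<Rightarrow> (nat \<times> nat \<Rightarrow> 'k)" where
  "weyl_V \<mu> \<epsilon> f = (\<lambda>(p, q). (1 / \<mu>) ^ p * (if q = 0 then 0 else f (p, q - 1)) - weyl_coeff \<mu> \<epsilon> (Suc p) * f (Suc p, q))"

lemma weyl_relation_op_alg:
  assumes "\<mu> \<noteq> 0"
  shows "weyl_relation op_alg weyl_U (weyl_V \<mu> \<epsilon>) \<mu> \<epsilon>"
proof -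
  interpret kalgebra "op_alg :: ('k::field, (nat \<times> nat \<Rightarrow> 'k) \<Rightarrow> (nat \<times> nat \<Rightarrow> 'k)) module" by (rule kalgebra_op_alg)
  have "weyl_U (weyl_V \<mu> \<epsilon> f) (p, q) = \<mu> * weyl_V \<mu> \<epsilon> (weyl_U f) (p, q) + \<epsilon> * f (p, q)" for f p q
  proof -
    \<comment> \<open>The recursion of \<open>weyl_coeff\<close> is exactly what the relation
      demands of the correction terms.\<close>
    have c: "\<mu> * (weyl_coeff \<mu> \<epsilon> (Suc k) * y) = weyl_coeff \<mu> \<epsilon> k * y + \<epsilon> * y" for k y
      using assms by (simp add: distrib_right)
    have m: "\<mu> * ((1 / \<mu>) ^ Suc k * y) = (1 / \<mu>) ^ k * y" for k y
      using assms by simp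
    show ?thesis
      by (cases p) (simp_all add: weyl_U_def weyl_V_def right_diff_distrib c m del: weyl_coeff.simps(2) power_Suc)
  qed
  then have rel: "(\<lambda>f. weyl_U (weyl_V \<mu> \<epsilon> f)) = (\<lambda>f i. \<mu> * weyl_V \<mu> \<epsilon> (weyl_U f) i + \<epsilon> * f i)"
    by (simp add: fun_eq_iff)
  have "weyl_U \<in> carrier op_alg"
    by (rule op_alg_carrierI) (simp_all add: weyl_U_def fun_eq_iff)
  moreover have "weyl_V \<mu> \<epsilon> \<in> carrier op_alg"
    by (rule op_alg_carrierI) (simp_all add: weyl_V_def fun_eq_iff distrib_left right_diff_distrib mult.left_commute)
  ultimately show ?thesis using assms rel
    by unfold_locales simp_all
qed

text \<open>On functions supported at p = 0 the operator of v is a pure shift in q, and the operator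
  of u always shifts p. So u^i v^j moves the delta function at (0, 0) to (i, j), which separates the
  monomials.\<close>

lemma weyl_UV_pow:
  "(weyl_U ^^ i) ((weyl_V \<mu> \<epsilon> ^^ j) (\<lambda>(p, q). if p = 0 \<and> q = 0 then 1 else 0))
    = (\<lambda>(p, q). if p = i \<and> q = j then 1 else 0)"
proof -
  have V: "(weyl_V \<mu> \<epsilon> ^^ j) (\<lambda>(p, q). if p = 0 \<and> q = 0 then 1 else 0) = (\<lambda>(p, q). if p = 0 \<and> q = j then 1 else 0)"
    by (induction j) (auto simp: weyl_V_def fun_eq_iff)
  show ?thesis unfolding V by (induction i) (auto simp: weyl_U_def fun_eq_iff)
qed

text \<open>A basis, encoded as a spanning family together with its dual functionals \<psi>, so that
  coefficients are available as linear maps.\<close>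

locale weyl_basis = weyl_relation A u v \<mu> \<epsilon>
  for A :: "('k::field, 'a, 'c) module_scheme" (structure) and u v \<mu> \<epsilon> +
  fixes \<psi> :: "nat \<Rightarrow> nat \<Rightarrow> 'a \<Rightarrow> 'k"
  assumes linear_psi: "linear_on A scalar_alg (\<psi> p q)"
    and psi_mon: "\<psi> p q (mon i j) = (if p = i \<and> q = j then 1 else 0)"
    and spans_mon: "spans A (range (\<lambda>(i, j). mon i j))"

text \<open>By \<open>weyl_UV_pow\<close>, applying the operator of a to the delta function at (0,
  0) lists all coefficients of a.\<close>

lemma weyl_basis_psiI:
  fixes A :: "('k::field, 'a, 'c) module_scheme"
  assumes "weyl_relation A u v \<mu> \<epsilon>" and rep: "alg_hom A op_alg \<rho>" "\<rho> u = weyl_U" "\<rho> v = weyl_V \<mu> \<epsilon>"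
    and sp: "spans A (range (\<lambda>(i :: nat, j :: nat). u [^]\<^bsub>A\<^esub> i \<otimes>\<^bsub>A\<^esub> v [^]\<^bsub>A\<^esub> j))"
  shows "weyl_basis A u v \<mu> \<epsilon> (\<lambda>p q a. \<rho> a (\<lambda>(p, q). if p = 0 \<and> q = 0 then 1 else 0) (p, q))"
proof -
  interpret weyl_relation A u v \<mu> \<epsilon> by fact
  have pow: "\<rho> (a [^]\<^bsub>A\<^esub> (m::nat)) = \<rho> a ^^ m" if "a \<in> carrier A" for a m
    using that alg_hom_mult[OF rep(1)] alg_hom_one[OF rep(1)]
    by (induction m) (auto simp: fun_eq_iff funpow_swap1)
  have "\<rho> (mon i j) f = (weyl_U ^^ i) ((weyl_V \<mu> \<epsilon> ^^ j) f)" for i j f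
    using alg_hom_mult[OF rep(1)] by (simp add: mon_def pow rep)
  then have psi: "\<rho> (mon i j) (\<lambda>(p, q). if p = 0 \<and> q = 0 then 1 else 0) (p, q) = (if p = i \<and> q = j then 1 else 0)"
    for i j p q by (simp add: weyl_UV_pow)
  have lin: "linear_on A scalar_alg (\<lambda>a. \<rho> a (\<lambda>(p, q). if p = 0 \<and> q = 0 then 1 else 0) (p, q))" for p q
    by (rule linear_onI)
      (simp_all add: linear_on_add[OF alg_hom_linear[OF rep(1)]] linear_on_smult[OF alg_hom_linear[OF rep(1)]])
  show ?thesis
    by (intro weyl_basis.intro weyl_relation_axioms weyl_basis_axioms.intro lin psi)
      (use sp in \<open>simp add: mon_def\<close>)
qed

abbreviation plane_map :: "'b \<Rightarrow> 'b \<Rightarrow> plane_sym \<Rightarrow> 'b" where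
  "plane_map U V \<equiv> (\<lambda>s. case s of SymU \<Rightarrow> U | SymV \<Rightarrow> V)"

lemma range_plane_map: "range (plane_map U V) = {U, V}"
  by (auto split: plane_sym.splits intro: range_eqI[of _ _ SymU] range_eqI[of _ _ SymV])

definition weyl_rels :: "'k::field \<Rightarrow> 'k \<Rightarrow> (plane_sym list \<Rightarrow>\<^sub>0 'k) set" where
  "weyl_rels \<mu> \<epsilon> =
    {Poly_Mapping.single [SymU, SymV] 1 - Poly_Mapping.single [SymV, SymU] \<mu> - Poly_Mapping.single [] \<epsilon>}"

lemma weyl_rels_eval_iff:
  fixes B :: "('k::field, 'b, 'c) module_scheme" (structure)
  assumes "kalgebra B" and U: "U \<in> carrier B" and V: "V \<in> carrier B" and f: "f SymU = U" "f SymV = V"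
  shows "(\<forall>r\<in>weyl_rels \<mu> \<epsilon>. lin_ext B (word_eval B f) r = \<zero>) \<longleftrightarrow> U \<otimes> V = \<mu> \<odot> (V \<otimes> U) \<oplus> \<epsilon> \<odot> \<one>"
proof -
  interpret kalgebra B by fact
  have r: "range f \<subseteq> carrier B" using assms by (auto simp: image_subset_iff) (metis plane_sym.exhaust)
  note w = word_eval_closed[OF r]
  have k: "word_eval B f ` Poly_Mapping.keys p \<subseteq> carrier B" for p :: "plane_sym list \<Rightarrow>\<^sub>0 'k" using w by auto
  have "a \<ominus> b \<ominus> d = a \<ominus> (b \<oplus> d)" if "a \<in> carrier B" "b \<in> carrier B" "d \<in> carrier B" for a b d
    using that by (simp add: a_minus_def minus_add a_assoc)
  then show ?thesis
    using U V by (simp add: weyl_rels_def lin_ext_diff[OF k k] w f)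
qed

locale weyl_presentation =
  fixes \<mu> \<epsilon> :: "'k::field"
  assumes \<mu>: "\<mu> \<noteq> 0"
begin

sublocale presentation "weyl_rels \<mu> \<epsilon>" .

abbreviation "u \<equiv> gen SymU"
abbreviation "v \<equiv> gen SymV"

sublocale W: weyl_relation P u v \<mu> \<epsilon>
  using weyl_rels_eval_iff[OF P.kalgebra_axioms, of u v gen \<mu> \<epsilon>] eval_rels \<mu> by unfold_locales auto

sublocale W': weyl_relation P v u "1 / \<mu>" "- \<epsilon> / \<mu>"
  using W.vu \<mu> by unfold_locales auto

lemma lift:
  assumes B: "kalgebra B" and U: "U \<in> carrier B" and V: "V \<in> carrier B"
    and rel: "U \<otimes>\<^bsub>B\<^esub> V = \<mu> \<odot>\<^bsub>B\<^esub> (V \<otimes>\<^bsub>B\<^esub> U) \<oplus>\<^bsub>B\<^esub> \<epsilon> \<odot>\<^bsub>B\<^esub> \<one>\<^bsub>B\<^esub>"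
  shows "alg_hom P B (alg_lift B (plane_map U V))"
    and "alg_lift B (plane_map U V) u = U" and "alg_lift B (plane_map U V) v = V"
proof -
  have r: "range (plane_map U V) \<subseteq> carrier B" using U V by (simp add: range_plane_map)
  have e: "\<And>r. r \<in> weyl_rels \<mu> \<epsilon> \<Longrightarrow> lin_ext B (word_eval B (plane_map U V)) r = \<zero>\<^bsub>B\<^esub>"
    using weyl_rels_eval_iff[OF B U V, of "plane_map U V" \<mu> \<epsilon>] rel by simp
  show "alg_hom P B (alg_lift B (plane_map U V))" by (rule alg_hom_alg_lift[OF B r e])
  show "alg_lift B (plane_map U V) u = U" "alg_lift B (plane_map U V) v = V"
    using alg_lift_gen[OF B r e] by simp_all
qed

text \<open>Stated for an arbitrary pair (a, b) so that it serves both orders of the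
  generators.\<close>

lemma spans_mon:
  assumes W: "weyl_relation P a b m e" and gens: "\<And>s. gen s = a \<or> gen s = b"
  shows "spans P (range (\<lambda>(i :: nat, j :: nat). a [^]\<^bsub>P\<^esub> i \<otimes>\<^bsub>P\<^esub> b [^]\<^bsub>P\<^esub> j))"
proof (rule spans_leftI)
  interpret weyl_relation P a b m e by fact
  let ?S = "range (\<lambda>(i :: nat, j :: nat). a [^]\<^bsub>P\<^esub> i \<otimes>\<^bsub>P\<^esub> b [^]\<^bsub>P\<^esub> j)"
  show S: "?S \<subseteq> carrier P" by auto
  note sub = subspace_ofD[OF P.lin_span_subspace[OF S]]
  have mem: "mon i j \<in> lin_span P ?S" for i j
    using P.lin_span_incl[OF S] by (auto simp: mon_def)
  show "\<one>\<^bsub>P\<^esub> \<in> lin_span P ?S" using mem[of 0 0] by (simp add: mon_0_0)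
  fix t s assume "s \<in> ?S"
  then obtain i j where s: "s = mon i j" by (auto simp: mon_def)
  show "gen t \<otimes>\<^bsub>P\<^esub> s \<in> lin_span P ?S"
    using gens[of t]
  proof
    assume t: "gen t = a"
    show ?thesis unfolding t s u_mon by (rule mem)
  next
    assume t: "gen t = b"
    show ?thesis unfolding t s v_mon by (intro sub(3,4) mem)
  qed
qed

lemma weyl_basis_uv: "\<exists>\<psi>. weyl_basis P u v \<mu> \<epsilon> \<psi>"
proof -
  interpret O: weyl_relation op_alg weyl_U "weyl_V \<mu> \<epsilon>" \<mu> \<epsilon> by (rule weyl_relation_op_alg[OF \<mu>])
  have "gen s = u \<or> gen s = v" for s by (cases s) simp_all
  from weyl_basis_psiI[OF W.weyl_relation_axioms lift[OF O.kalgebra_axioms O.u O.v O.uv]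
      spans_mon[OF W.weyl_relation_axioms this]]
  show ?thesis by blast
qed

text \<open>The generators keep their names, so v goes to \<open>weyl_U\<close> and u to
  \<open>weyl_V\<close> with the exchanged parameters.\<close>

lemma weyl_basis_vu: "\<exists>\<psi>. weyl_basis P v u (1 / \<mu>) (- \<epsilon> / \<mu>) \<psi>"
proof -
  interpret O: weyl_relation op_alg weyl_U "weyl_V (1 / \<mu>) (- \<epsilon> / \<mu>)" "1 / \<mu>" "- \<epsilon> / \<mu>"
    by (rule weyl_relation_op_alg) (simp add: \<mu>)
  \<comment> \<open>Exchanging once more recovers \<mu> and \<epsilon>, the relation demanded of the
    images of u and v.\<close>
  have "weyl_V (1 / \<mu>) (- \<epsilon> / \<mu>) \<otimes>\<^bsub>op_alg\<^esub> weyl_U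
      = \<mu> \<odot>\<^bsub>op_alg\<^esub> (weyl_U \<otimes>\<^bsub>op_alg\<^esub> weyl_V (1 / \<mu>) (- \<epsilon> / \<mu>)) \<oplus>\<^bsub>op_alg\<^esub> \<epsilon> \<odot>\<^bsub>op_alg\<^esub> \<one>\<^bsub>op_alg\<^esub>"
    using O.vu \<mu> by (simp del: op_alg_simps)
  note hom = lift[OF O.kalgebra_axioms O.v O.u this]
  have "gen s = v \<or> gen s = u" for s by (cases s) simp_all
  from weyl_basis_psiI[OF W'.weyl_relation_axioms hom(1,3,2) spans_mon[OF W'.weyl_relation_axioms this]]
  show ?thesis by blast
qed

end

section \<open>Coefficients with respect to the monomial basis\<close>

context weyl_basis
begin

lemma psi_add: "\<lbrakk>a \<in> carrier A; b \<in> carrier A\<rbrakk> \<Longrightarrow> \<psi> p q (a \<oplus> b) = \<psi> p q a + \<psi> p q b"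
  and psi_smult: "a \<in> carrier A \<Longrightarrow> \<psi> p q (d \<odot> a) = d * \<psi> p q a"
  using linear_on_add[OF linear_psi, of a b p q] linear_on_smult[OF linear_psi, of a p q d] by simp_all

lemma psi_zero: "\<psi> p q \<zero> = 0"
  using psi_smult[of \<zero> p q 0] by simp

lemma psi_one: "\<psi> p q \<one> = (if p = 0 \<and> q = 0 then 1 else 0)"
  using psi_mon[of p q 0 0] by (simp add: mon_0_0)

lemmas psi_simps = psi_add psi_smult psi_zero psi_one psi_mon

lemma scalar_kspace: "kspace (scalar_alg :: ('k, 'k) module)"
  by (rule kalgebra.axioms(2)[OF kalgebra_scalar_alg])

lemma scalar_eqI:
  fixes f h :: "'a \<Rightarrow> 'k"
  assumes "\<And>a b. \<lbrakk>a \<in> carrier A; b \<in> carrier A\<rbrakk> \<Longrightarrow> f (a \<oplus> b) = f a + f b"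
    and "\<And>d a. a \<in> carrier A \<Longrightarrow> f (d \<odot> a) = d * f a"
    and "\<And>a b. \<lbrakk>a \<in> carrier A; b \<in> carrier A\<rbrakk> \<Longrightarrow> h (a \<oplus> b) = h a + h b"
    and "\<And>d a. a \<in> carrier A \<Longrightarrow> h (d \<odot> a) = d * h a"
    and "\<And>i j. f (mon i j) = h (mon i j)" and "a \<in> carrier A"
  shows "f a = h a"
  by (rule linear_on_eqI[OF scalar_kspace _ _ spans_mon _ \<open>a \<in> carrier A\<close>])
    (use assms in \<open>auto intro!: linear_onI\<close>)

text \<open>The elements with such an expansion form a subspace containing the monomials. The keys
  of p bound the support, which is how \<open>finite_supp\<close> arises.\<close>

lemma psi_expansion:
  assumes "a \<in> carrier A"
  shows "\<exists>p. a = lin_ext A (\<lambda>(i, j). mon i j) p \<and> (\<forall>i j. \<psi> i j a = Poly_Mapping.lookup p (i, j))"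
proof -
  let ?L = "lin_ext A (\<lambda>(i, j). mon i j)"
  have k: "(\<lambda>(i, j). mon i j) ` Poly_Mapping.keys p \<subseteq> carrier A" for p :: "nat \<times> nat \<Rightarrow>\<^sub>0 'k" by auto
  have cl: "?L p \<in> carrier A" for p by (rule lin_ext_closed[OF k])
  have s: "?L (Poly_Mapping.single (i, j) 1) = mon i j" for i j
    using lin_ext_single[of "\<lambda>(i, j). mon i j" "(i, j)" 1] by simp
  let ?U = "{a. \<exists>p. a = ?L p \<and> (\<forall>i j. \<psi> i j a = Poly_Mapping.lookup p (i, j))}"
  have "subspace_of ?U A"
  proof (rule subspace_ofI)
    show "?U \<subseteq> carrier A" using cl by auto
    show "\<zero> \<in> ?U" by (auto simp: psi_zero intro!: exI[of _ 0])
  next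
    fix a b assume "a \<in> ?U" "b \<in> ?U"
    then obtain p p' where "a = ?L p" "\<forall>i j. \<psi> i j a = Poly_Mapping.lookup p (i, j)"
      "b = ?L p'" "\<forall>i j. \<psi> i j b = Poly_Mapping.lookup p' (i, j)" by auto
    then show "a \<oplus> b \<in> ?U" using cl
      by (intro CollectI exI[of _ "p + p'"]) (simp add: lin_ext_add[OF k k] psi_add lookup_add)
  next
    fix d a assume "a \<in> ?U"
    then obtain p where "a = ?L p" "\<forall>i j. \<psi> i j a = Poly_Mapping.lookup p (i, j)" by auto
    then show "d \<odot> a \<in> ?U" using cl
      by (intro CollectI exI[of _ "Poly_Mapping.map ((*) d) p"]) (simp add: lin_ext_smult[OF k] psi_smult)
  qed
  moreover have "range (\<lambda>(i, j). mon i j) \<subseteq> ?U"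
  proof clarify
    fix i j
    show "\<exists>p. mon i j = ?L p \<and> (\<forall>i' j'. \<psi> i' j' (mon i j) = Poly_Mapping.lookup p (i', j'))"
      by (intro exI[of _ "Poly_Mapping.single (i, j) 1"]) (auto simp: s psi_mon lookup_single when_def)
  qed
  ultimately have "a \<in> ?U" by (rule spansD[OF spans_mon _ _ assms])
  then show ?thesis by simp
qed

lemma psi_eq_zeroD:
  assumes "a \<in> carrier A" "\<And>p q. \<psi> p q a = 0"
  shows "a = \<zero>"
proof -
  obtain p where p: "a = lin_ext A (\<lambda>(i, j). mon i j) p" "\<forall>i j. \<psi> i j a = Poly_Mapping.lookup p (i, j)"
    using psi_expansion[OF assms(1)] by auto
  then have "p = 0" using assms(2) by (intro poly_mapping_eqI) auto
  then show ?thesis using p by simp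
qed

definition supp :: "'a \<Rightarrow> (nat \<times> nat) set" where
  "supp a = {(p, q). \<psi> p q a \<noteq> 0}"

lemma finite_supp:
  assumes "a \<in> carrier A"
  shows "finite (supp a)"
proof -
  obtain p where "\<forall>i j. \<psi> i j a = Poly_Mapping.lookup p (i, j)"
    using psi_expansion[OF assms(1)] by auto
  then have "supp a \<subseteq> Poly_Mapping.keys p" by (auto simp: supp_def in_keys_iff)
  then show ?thesis by (rule finite_subset) simp
qed

text \<open>At such a \<open>(p, q)\<close> the lower terms in \<open>psi_mult_u\<close>, \<open>psi_v_mult\<close> and \<open>psi_X\<close> vanish.\<close>

lemma top_coeff:
  assumes "a \<in> carrier A" "a \<noteq> \<zero>"
  obtains p q where "\<psi> p q a \<noteq> 0" "\<psi> (Suc p) (Suc q) a = 0"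
proof -
  \<comment> \<open>A point of the finite support that maximises p + q is in particular the last one
    on its diagonal.\<close>
  have fin: "finite ((\<lambda>(p, q). p + q) ` supp a)" using finite_supp[OF assms(1)] by simp
  have "supp a \<noteq> {}" using psi_eq_zeroD[OF assms(1)] assms(2) by (auto simp: supp_def)
  then have "Max ((\<lambda>(p, q). p + q) ` supp a) \<in> (\<lambda>(p, q). p + q) ` supp a" using fin by (intro Max_in) auto
  then obtain p q where pq: "(p, q) \<in> supp a" "p + q = Max ((\<lambda>(p, q). p + q) ` supp a)" by force
  have "(Suc p, Suc q) \<notin> supp a"
  proof
    assume "(Suc p, Suc q) \<in> supp a"
    then have "Suc p + Suc q \<le> Max ((\<lambda>(p, q). p + q) ` supp a)" using fin by (intro Max_ge) force+
    then show False using pq(2) by simp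
  qed
  then show ?thesis using that pq(1) by (auto simp: supp_def)
qed

lemma psi_u_mult:
  assumes "a \<in> carrier A"
  shows "\<psi> (Suc p) q (u \<otimes> a) = \<psi> p q a"
  by (rule scalar_eqI[OF _ _ _ _ _ assms])
    (simp_all add: psi_simps r_distr smult_mult_right u_mon)

lemma psi_mult_v:
  assumes "a \<in> carrier A"
  shows "\<psi> p (Suc q) (a \<otimes> v) = \<psi> p q a"
  by (rule scalar_eqI[OF _ _ _ _ _ assms])
    (simp_all add: psi_simps l_distr smult_mult_left mon_v)

text \<open>Two monomials feed the place (p+1, q) of au: u^p v^q through its leading term and
  u^(p+1) v^(q+1), the next one on the diagonal of (p, q), through its correction.\<close>

lemma psi_mult_u:
  assumes "a \<in> carrier A"
  shows "\<psi> (Suc p) q (a \<otimes> u) = (1 / \<mu>) ^ q * \<psi> p q a - c (Suc q) * \<psi> (Suc p) (Suc q) a"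
proof (rule scalar_eqI[OF _ _ _ _ _ assms])
  fix i j
  show "\<psi> (Suc p) q (mon i j \<otimes> u) = (1 / \<mu>) ^ q * \<psi> p q (mon i j) - c (Suc q) * \<psi> (Suc p) (Suc q) (mon i j)"
    by (cases j) (auto simp: mon_u psi_simps)
qed (simp_all add: psi_simps l_distr smult_mult_left algebra_simps)

lemma psi_v_mult:
  assumes "a \<in> carrier A"
  shows "\<psi> p (Suc q) (v \<otimes> a) = (1 / \<mu>) ^ p * \<psi> p q a - c (Suc p) * \<psi> (Suc p) (Suc q) a"
proof (rule scalar_eqI[OF _ _ _ _ _ assms])
  fix i j
  show "\<psi> p (Suc q) (v \<otimes> mon i j) = (1 / \<mu>) ^ p * \<psi> p q (mon i j) - c (Suc p) * \<psi> (Suc p) (Suc q) (mon i j)"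
    by (cases i) (auto simp: v_mon psi_simps)
qed (simp_all add: psi_simps r_distr smult_mult_right algebra_simps)

end

subsection \<open>Linear actions of Taft algebras\<close>

text \<open>The normal form of the action, stated for two operators \<open>G\<close> and
  \<open>X\<close> standing for g and x, so that exchanging u and v gives another instance with the
  same operators.\<close>

locale taft_plane = weyl_basis A u v \<mu> \<epsilon> \<psi>
  for A :: "('k::field, 'a, 'c) module_scheme" (structure) and u v \<mu> \<epsilon> \<psi> +
  fixes n :: nat and lam r :: 'k and G X :: "'a \<Rightarrow> 'a"
  assumes n: "1 < n" and lam: "has_mult_order lam n" and mu: "has_mult_order \<mu> n" and r: "r \<noteq> 0"
    and linear_G: "linear_on A A G" and linear_X: "linear_on A A X"
    and G_mult: "\<lbrakk>a \<in> carrier A; b \<in> carrier A\<rbrakk> \<Longrightarrow> G (a \<otimes> b) = G a \<otimes> G b"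
    and X_mult: "\<lbrakk>a \<in> carrier A; b \<in> carrier A\<rbrakk> \<Longrightarrow> X (a \<otimes> b) = G a \<otimes> X b \<oplus> X a \<otimes> b"
    and G_one: "G \<one> = \<one>" and X_one: "X \<one> = \<zero>"
    and G_u: "G u = \<mu> \<odot> u" and G_v: "G v = (lam * \<mu>) \<odot> v"
    and X_u: "X u = \<zero>" and X_v: "X v = r \<odot> u"
begin

lemmas G_simps = linear_on_closed[OF linear_G] linear_on_add[OF linear_G] linear_on_smult[OF linear_G] G_mult G_one
lemmas X_simps = linear_on_closed[OF linear_X] linear_on_add[OF linear_X] linear_on_smult[OF linear_X] X_one

lemma mu_neq_1: "\<mu> \<noteq> 1" and lam_neq_1: "lam \<noteq> 1"
  using lam mu n by (auto simp: has_mult_order_def)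

lemma G_u_pow: "G (u [^] i) = \<mu> ^ i \<odot> u [^] (i :: nat)"
  by (induction i) (simp_all add: G_simps G_u smult_mult_left smult_mult_right smult_smult mult.commute)

lemma G_v_pow: "G (v [^] i) = (lam * \<mu>) ^ i \<odot> v [^] (i :: nat)"
  by (induction i) (simp_all add: G_simps G_v smult_mult_left smult_mult_right smult_smult mult_ac)

lemma X_u_pow: "X (u [^] i) = \<zero>" for i :: nat
  by (induction i) (simp_all add: X_simps X_mult G_simps X_u)

lemma G_mon: "G (mon i j) = (\<mu> ^ (i + j) * lam ^ j) \<odot> mon i j"
  by (simp add: mon_def G_simps G_u_pow G_v_pow smult_mult_left smult_mult_right smult_smult
      power_add power_mult_distrib mult_ac)

text \<open>In X(v^j), \<open>r * xv j\<close> is the coefficient of v^(j-1) u and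
  \<open>r * xc j\<close> that of v^(j-2), see \<open>X_v_pow\<close>. For j > 0,
  \<open>xv j\<close> is \<mu>^(j-1) times 1 + lam + ... + lam^(j-1), and \<open>xc j\<close> is
  \<epsilon> times the sum of the \<open>xv k\<close> with k < j.\<close>

fun xv :: "nat \<Rightarrow> 'k" where
  "xv 0 = 0"
| "xv (Suc j) = (lam * \<mu>) ^ j + \<mu> * xv j"

fun xc :: "nat \<Rightarrow> 'k" where
  "xc 0 = 0"
| "xc (Suc j) = \<epsilon> * xv j + xc j"

lemma xv_eq: "xv j * (lam * \<mu> - \<mu>) = (lam * \<mu>) ^ j - \<mu> ^ j"
proof (induction j)
  case (Suc j)
  have "xv (Suc j) * (lam * \<mu> - \<mu>) = (lam * \<mu>) ^ j * (lam * \<mu> - \<mu>) + \<mu> * (xv j * (lam * \<mu> - \<mu>))"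
    by (simp add: algebra_simps)
  then show ?case unfolding Suc by (simp add: algebra_simps)
qed simp

text \<open>As \<open>lam * \<mu>\<close> differs from \<mu>, \<open>xv_eq\<close> turns vanishing
  into (lam \<mu>)^j = \<mu>^j, that is lam^j = 1. Every conclusion from X a = 0 to divisibility by
  n passes through this.\<close>

lemma xv_eq_0_iff: "xv j = 0 \<longleftrightarrow> n dvd j"
proof -
  have "lam * \<mu> - \<mu> \<noteq> 0" using lam_neq_1 \<mu> by (simp flip: left_diff_distrib[of lam 1 \<mu>, simplified])
  then have "xv j = 0 \<longleftrightarrow> (lam * \<mu>) ^ j = \<mu> ^ j" using xv_eq[of j] by auto
  also have "\<dots> \<longleftrightarrow> lam ^ j = 1" using \<mu> by (simp add: power_mult_distrib)
  finally show ?thesis using has_mult_order_power_eq_1_iff[OF lam] by simp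
qed

lemma X_v_pow: "X (v [^] j) = r \<odot> (xv j \<odot> (v [^] (j - 1) \<otimes> u) \<oplus> xc j \<odot> v [^] (j - 2))"
proof (induction j)
  case 0
  then show ?case by (simp add: X_simps)
next
  case (Suc j)
  \<comment> \<open>The truncation in j - 2 matters only for j < 2, where \<open>xc j\<close> is
    zero.\<close>
  have 1: "xc j \<odot> (v [^] (j - 2) \<otimes> v) = xc j \<odot> v [^] (j - 1)"
  proof (cases "j < 2")
    case True
    then have "j = 0 \<or> j = 1" by auto
    then show ?thesis by auto
  next
    case False
    then obtain m where "j = 2 + m" using le_Suc_ex[of 2 j] by auto
    then show ?thesis by simp
  qed
  have 2: "xv j \<odot> ((v [^] (j - 1) \<otimes> u) \<otimes> v) = xv j \<odot> (\<mu> \<odot> (v [^] j \<otimes> u) \<oplus> \<epsilon> \<odot> v [^] (j - 1))"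
  proof (cases j)
    case (Suc m)
    have "(v [^] m \<otimes> u) \<otimes> v = v [^] m \<otimes> (\<mu> \<odot> (v \<otimes> u) \<oplus> \<epsilon> \<odot> \<one>)" by (simp add: m_assoc uv)
    also have "\<dots> = \<mu> \<odot> (v [^] Suc m \<otimes> u) \<oplus> \<epsilon> \<odot> v [^] m"
      by (simp add: r_distr smult_mult_right m_assoc)
    finally show ?thesis using Suc by simp
  qed simp
  have "X (v [^] Suc j) = r \<odot> ((lam * \<mu>) ^ j \<odot> (v [^] j \<otimes> u)) \<oplus> X (v [^] j) \<otimes> v"
    by (simp add: X_mult G_v_pow X_v smult_mult_left smult_mult_right smult_smult mult.commute)
  also have "X (v [^] j) \<otimes> v = r \<odot> (xv j \<odot> ((v [^] (j - 1) \<otimes> u) \<otimes> v) \<oplus> xc j \<odot> (v [^] (j - 2) \<otimes> v))"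
    unfolding Suc by (simp add: smult_mult_left l_distr)
  also have "\<dots> = r \<odot> ((\<mu> * xv j) \<odot> (v [^] j \<otimes> u) \<oplus> ((\<epsilon> * xv j) \<odot> v [^] (j - 1) \<oplus> xc j \<odot> v [^] (j - 1)))"
    unfolding 1 2 by (simp add: smult_r_distr smult_smult a_assoc mult_ac)
  also have "r \<odot> ((lam * \<mu>) ^ j \<odot> (v [^] j \<otimes> u)) \<oplus> \<dots>
    = r \<odot> (((lam * \<mu>) ^ j \<odot> (v [^] j \<otimes> u) \<oplus> (\<mu> * xv j) \<odot> (v [^] j \<otimes> u))
        \<oplus> ((\<epsilon> * xv j) \<odot> v [^] (j - 1) \<oplus> xc j \<odot> v [^] (j - 1)))"
    by (simp add: smult_r_distr a_assoc)
  also have "\<dots> = r \<odot> (xv (Suc j) \<odot> (v [^] (Suc j - 1) \<otimes> u) \<oplus> xc (Suc j) \<odot> v [^] (Suc j - 2))"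
    by (simp flip: smult_l_distr)
  finally show ?case .
qed

text \<open>X(u^i) = 0 leaves \<mu>^i u^i X(v^j); bringing the remaining u to the left of v^(j-1)
  costs \<mu>^-(j-1) and the correction \<open>c (j - 1)\<close>.\<close>

lemma X_mon:
  "X (mon i j) = (r * \<mu> ^ i * xv j * (1 / \<mu>) ^ (j - 1)) \<odot> mon (Suc i) (j - 1)
    \<oplus> (r * \<mu> ^ i * (xc j - xv j * c (j - 1))) \<odot> mon i (j - 2)"
proof -
  have m: "u [^] i \<otimes> (u \<otimes> v [^] k) = mon (Suc i) k" for k :: nat
    by (simp add: mon_def m_assoc)
  have "X (mon i j) = (r * \<mu> ^ i) \<odot> (u [^] i \<otimes> (xv j \<odot> (v [^] (j - 1) \<otimes> u) \<oplus> xc j \<odot> v [^] (j - 2)))"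
    unfolding mon_def
    by (simp add: X_mult X_u_pow G_u_pow X_v_pow smult_mult_left smult_mult_right smult_smult mult.commute)
  also have "xv j \<odot> (v [^] (j - 1) \<otimes> u) \<oplus> xc j \<odot> v [^] (j - 2)
    = (xv j * (1 / \<mu>) ^ (j - 1)) \<odot> (u \<otimes> v [^] (j - 1)) \<oplus> ((- (xv j * c (j - 1))) \<odot> v [^] (j - 2) \<oplus> xc j \<odot> v [^] (j - 2))"
    unfolding v_pow_u by (simp add: smult_r_distr smult_smult a_assoc numeral_2_eq_2 diff_diff_eq)
  also have "(- (xv j * c (j - 1))) \<odot> v [^] (j - 2) \<oplus> xc j \<odot> v [^] (j - 2) = (xc j - xv j * c (j - 1)) \<odot> v [^] (j - 2)"
    by (simp flip: smult_l_distr)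
  finally show ?thesis
    by (simp add: r_distr smult_mult_right m smult_r_distr smult_smult mult.assoc) (simp add: mon_def)
qed

lemma psi_G:
  assumes "a \<in> carrier A"
  shows "\<psi> p q (G a) = \<mu> ^ (p + q) * lam ^ q * \<psi> p q a"
  by (rule scalar_eqI[OF _ _ _ _ _ assms])
    (auto simp add: psi_simps G_simps G_mon algebra_simps)

text \<open>The contributing places (p, q+1) and (p+1, q+2) lie on one diagonal; if the second
  coefficient vanishes, only the \<open>xv\<close> term is left.\<close>

lemma psi_X:
  assumes "a \<in> carrier A"
  shows "\<psi> (Suc p) q (X a) = r * \<mu> ^ p * xv (Suc q) * (1 / \<mu>) ^ q * \<psi> p (Suc q) a
    + r * \<mu> ^ Suc p * (xc (Suc (Suc q)) - xv (Suc (Suc q)) * c (Suc q)) * \<psi> (Suc p) (Suc (Suc q)) a"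
proof (rule scalar_eqI[OF _ _ _ _ _ assms])
  fix i j
  consider "j = 0" | "j = 1" | m where "j = Suc (Suc m)" by (metis One_nat_def not0_implies_Suc)
  then show "\<psi> (Suc p) q (X (mon i j)) = r * \<mu> ^ p * xv (Suc q) * (1 / \<mu>) ^ q * \<psi> p (Suc q) (mon i j)
    + r * \<mu> ^ Suc p * (xc (Suc (Suc q)) - xv (Suc (Suc q)) * c (Suc q)) * \<psi> (Suc p) (Suc (Suc q)) (mon i j)"
    by cases (auto simp: X_mon psi_simps simp del: xv.simps(2) xc.simps(2) weyl_coeff.simps(2),
       auto simp: numeral_2_eq_2)
qed (simp_all add: psi_simps X_simps distrib_left distrib_right mult_ac del: xv.simps xc.simps weyl_coeff.simps)

section \<open>The invariants are generated by u^n and v^n\<close>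

definition Inv :: "'a set" where
  "Inv = {a \<in> carrier A. G a = a \<and> X a = \<zero>}"

lemma subalgebra_Inv: "subalgebra Inv A"
  by (rule subalgebraI) (auto simp: Inv_def G_simps X_simps X_mult)

lemma u_pow_n_Inv: "u [^] n \<in> Inv"
  using mu by (simp add: Inv_def G_u_pow X_u_pow has_mult_order_def)

text \<open>Applying \<open>G\<close> to uv = \<mu> vu + \<epsilon> scales the quadratic terms by
  lam \<mu>^2 but fixes the constant; comparing constant coefficients leaves these two
  cases.\<close>

lemma lam_mu_square: "\<epsilon> = 0 \<or> lam * \<mu> * \<mu> = 1"
proof -
  let ?k = "lam * \<mu> * \<mu>"
  have G1: "G (u \<otimes> v) = ?k \<odot> (u \<otimes> v)" "G (v \<otimes> u) = ?k \<odot> (v \<otimes> u)"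
    by (simp_all add: G_simps G_u G_v smult_mult_left smult_mult_right smult_smult mult_ac)
  have "?k \<odot> (\<mu> \<odot> (v \<otimes> u)) \<oplus> \<epsilon> \<odot> \<one> = G (\<mu> \<odot> (v \<otimes> u) \<oplus> \<epsilon> \<odot> \<one>)"
    by (simp add: G_simps G1 smult_smult mult.commute)
  also have "\<dots> = ?k \<odot> (u \<otimes> v)" unfolding uv[symmetric] by (rule G1)
  also have "\<dots> = ?k \<odot> (\<mu> \<odot> (v \<otimes> u)) \<oplus> ?k \<odot> (\<epsilon> \<odot> \<one>)" unfolding uv by (simp add: smult_r_distr)
  finally have "\<epsilon> \<odot> \<one> = ?k \<odot> (\<epsilon> \<odot> \<one>)" by simp
  then have "\<psi> 0 0 (\<epsilon> \<odot> \<one>) = \<psi> 0 0 (?k \<odot> (\<epsilon> \<odot> \<one>))" by simp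
  then show ?thesis by (simp add: psi_simps)
qed

lemma sum_powers_root_of_unity: "z \<noteq> 1 \<Longrightarrow> z ^ n = 1 \<Longrightarrow> (\<Sum>k<n. z ^ k) = (0 :: 'k)"
  by (simp add: geometric_sum)

text \<open>Up to a nonzero factor, the sum of the \<open>xv k\<close> with k < n is a difference of
  two full geometric sums. For \<epsilon> \<noteq> 0 the identity lam \<mu>^2 = 1 ensures lam \<mu>
  \<noteq> 1, so both sums vanish.\<close>

lemma xc_n: "xc n = 0"
proof -
  have xc: "xc j = \<epsilon> * (\<Sum>k<j. xv k)" for j
    by (induction j) (simp_all add: distrib_left)
  show ?thesis
  proof (cases "\<epsilon> = 0")
    case False
    then have l: "lam * \<mu> * \<mu> = 1" using lam_mu_square by simp
    have l1: "lam * \<mu> \<noteq> 1" using l mu_neq_1 by auto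
    have ln: "(lam * \<mu>) ^ n = 1" using lam mu by (simp add: has_mult_order_def power_mult_distrib)
    have "(\<Sum>k<n. xv k) * (lam * \<mu> - \<mu>) = (\<Sum>k<n. (lam * \<mu>) ^ k) - (\<Sum>k<n. \<mu> ^ k)"
      by (simp add: sum_distrib_right xv_eq sum_subtractf)
    also have "\<dots> = 0"
      using sum_powers_root_of_unity[OF l1 ln] sum_powers_root_of_unity[OF mu_neq_1] mu by (simp add: has_mult_order_def)
    finally have "(\<Sum>k<n. xv k) = 0" using lam_neq_1 \<mu> by auto
    then show ?thesis by (simp add: xc)
  next
    case True
    then show ?thesis by (metis xc mult_zero_left)
  qed
qed

lemma v_pow_n_Inv: "v [^] n \<in> Inv"
proof -
  have "(lam * \<mu>) ^ n = 1" using lam mu by (simp add: has_mult_order_def power_mult_distrib)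
  moreover have "X (v [^] n) = \<zero>" using xv_eq_0_iff[of n] by (simp add: X_v_pow xc_n)
  ultimately show ?thesis by (simp add: Inv_def G_v_pow)
qed

lemma gen_subset_Inv: "gen_subalgebra A {u [^] n, v [^] n} \<subseteq> Inv"
  by (rule gen_subalgebra_minimal[OF subalgebra_Inv]) (simp add: u_pow_n_Inv v_pow_n_Inv)

text \<open>Induction on the size of the support: a top monomial of an invariant is a product of
  powers of u^n and v^n, hence itself invariant, and can be subtracted.\<close>

lemma Inv_subset_gen:
  assumes "a \<in> Inv"
  shows "a \<in> gen_subalgebra A {u [^] n, v [^] n}"
  using assms
proof (induction "card (supp a)" arbitrary: a rule: less_induct)
  case less
  let ?B = "gen_subalgebra A {u [^] n, v [^] n}"
  have sub: "subalgebra ?B A" by (rule subalgebra_gen_subalgebra) auto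
  note B = subalgebraD[OF sub] and I = subalgebraD[OF subalgebra_Inv]
  have a: "a \<in> carrier A" "G a = a" "X a = \<zero>" using less.prems by (auto simp: Inv_def)
  show ?case
  proof (cases "a = \<zero>")
    case True
    then show ?thesis using B(3) by simp
  next
    case False
    obtain p q where pq: "\<psi> p q a \<noteq> 0" "\<psi> (Suc p) (Suc q) a = 0" by (rule top_coeff[OF a(1) False])
    \<comment> \<open>X a = 0 is read at the place (p+1, q-1), where only \<open>xv q\<close> times
      the top coefficient remains; for q = 0 there is no such place.\<close>
    have dq: "n dvd q"
    proof (cases q)
      case (Suc m)
      then have "r * \<mu> ^ p * xv q * (1 / \<mu>) ^ m * \<psi> p q a = 0"
        using psi_X[OF a(1), of p m] pq(2) a(3) by (simp add: psi_zero)
      then show ?thesis using r \<mu> pq(1) xv_eq_0_iff[of q] by simp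
    qed simp
    have "\<mu> ^ (p + q) * lam ^ q = 1" using psi_G[OF a(1), of p q] a(2) pq(1) by simp
    then have "\<mu> ^ p = 1"
      using dq has_mult_order_power_eq_1_iff[OF mu, of q] has_mult_order_power_eq_1_iff[OF lam, of q]
      by (simp add: power_add)
    then have dp: "n dvd p" using has_mult_order_power_eq_1_iff[OF mu] by simp
    have "mon p q = (u [^] n) [^] (p div n) \<otimes> (v [^] n) [^] (q div n)"
      using dp dq by (simp add: mon_def nat_pow_pow)
    moreover have "u [^] n \<in> ?B" "v [^] n \<in> ?B" using gen_subalgebra_incl[of "{u [^] n, v [^] n}"] by auto
    ultimately have mB: "mon p q \<in> ?B" using subalgebra_pow[OF sub] B(5) by simp
    let ?b = "a \<oplus> (- \<psi> p q a) \<odot> mon p q"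
    have mI: "mon p q \<in> Inv" using mB gen_subset_Inv by auto
    then have bI: "?b \<in> Inv" by (intro I(4,6) less.prems)
    have "(p, q) \<in> supp a" using pq(1) by (simp add: supp_def)
    moreover have "supp ?b = supp a - {(p, q)}"
      using a(1) by (auto simp: supp_def psi_simps split: if_splits)
    ultimately have "card (supp ?b) < card (supp a)"
      using card_Diff1_less[OF finite_supp[OF a(1)]] by simp
    from less.hyps[OF this bI] have mem: "?b \<oplus> \<psi> p q a \<odot> mon p q \<in> ?B" by (rule B(4)[OF _ B(6)[OF mB]])
    have "?b \<oplus> \<psi> p q a \<odot> mon p q = a"
      using a(1) by (simp add: a_assoc flip: smult_l_distr)
    then show ?thesis using mem by (simp only:)
  qed
qed

lemma Inv_eq: "Inv = gen_subalgebra A {u [^] n, v [^] n}"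
  using gen_subset_Inv Inv_subset_gen by auto

section \<open>Central elements of A and twisted commutation\<close>

lemma commutes_all:
  assumes "a \<in> carrier A" "a \<otimes> u = u \<otimes> a" "a \<otimes> v = v \<otimes> a" "b \<in> carrier A"
  shows "a \<otimes> b = b \<otimes> a"
proof (rule linear_on_eqI[OF kspace_axioms linear_on_mult_left[OF assms(1)] linear_on_mult_right[OF assms(1)]
      spans_mon _ assms(4)])
  have p: "a \<otimes> w [^] k = w [^] k \<otimes> a" if "w \<in> carrier A" "a \<otimes> w = w \<otimes> a" for w and k :: nat
  proof (induction k)
    case (Suc k)
    have "a \<otimes> w [^] Suc k = (a \<otimes> w [^] k) \<otimes> w" using that(1) assms(1) by (simp add: m_assoc)
    also have "\<dots> = w [^] k \<otimes> (a \<otimes> w)" unfolding Suc using that(1) assms(1) by (simp add: m_assoc)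
    also have "\<dots> = w [^] Suc k \<otimes> a" unfolding that(2) using that(1) assms(1) by (simp add: m_assoc)
    finally show ?case .
  qed (simp add: assms(1))
  fix s assume "s \<in> range (\<lambda>(i, j). mon i j)"
  then obtain i j where s: "s = mon i j" by auto
  have "a \<otimes> mon i j = (a \<otimes> u [^] i) \<otimes> v [^] j" using assms(1) by (simp add: mon_def m_assoc)
  also have "\<dots> = u [^] i \<otimes> (a \<otimes> v [^] j)" unfolding p[OF u assms(2)] using assms(1) by (simp add: m_assoc)
  also have "\<dots> = mon i j \<otimes> a" unfolding p[OF v assms(3)] using assms(1) by (simp add: mon_def m_assoc)
  finally show "a \<otimes> s = s \<otimes> a" by (simp add: s)
qed

text \<open>Elements commuting with everything form a subalgebra. It contains u^n and v^n because
  \<mu>^n = 1 removes the twist and \<open>c n = 0\<close> the correction.\<close>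

lemma Inv_central:
  assumes "a \<in> Inv" "b \<in> carrier A"
  shows "a \<otimes> b = b \<otimes> a"
proof -
  have \<mu>n: "\<mu> ^ n = 1" using mu by (simp add: has_mult_order_def)
  have c: "c n = 0" by (rule weyl_coeff_root_of_unity[OF \<mu> mu_neq_1 \<mu>n])
  let ?C = "{a \<in> carrier A. \<forall>b\<in>carrier A. a \<otimes> b = b \<otimes> a}"
  have "subalgebra ?C A"
  proof (rule subalgebraI)
    fix a b assume "a \<in> ?C" "b \<in> ?C"
    then have ab: "a \<in> carrier A" "b \<in> carrier A" and a: "\<And>d. d \<in> carrier A \<Longrightarrow> a \<otimes> d = d \<otimes> a"
      and b: "\<And>d. d \<in> carrier A \<Longrightarrow> b \<otimes> d = d \<otimes> b" by auto
    have "a \<otimes> b \<otimes> d = d \<otimes> (a \<otimes> b)" if d: "d \<in> carrier A" for d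
    proof -
      have "a \<otimes> b \<otimes> d = (a \<otimes> d) \<otimes> b" using ab d by (simp add: m_assoc b[OF d])
      then show ?thesis using ab d by (simp add: a[OF d] m_assoc)
    qed
    then show "a \<otimes> b \<in> ?C" using ab by simp
    show "a \<oplus> b \<in> ?C" using ab by (simp add: l_distr r_distr a b)
  next
    fix d a assume "a \<in> ?C"
    then show "d \<odot> a \<in> ?C" by (simp add: smult_mult_left smult_mult_right)
  qed auto
  moreover have "u [^] n \<in> ?C"
  proof -
    have "v \<otimes> u [^] n = u [^] n \<otimes> v" using \<mu>n by (simp add: v_u_pow c power_divide)
    moreover have "u [^] n \<otimes> u = u \<otimes> u [^] n" using nat_pow_Suc2[OF u, of n] by simp
    ultimately show ?thesis using commutes_all[of "u [^] n"] by auto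
  qed
  moreover have "v [^] n \<in> ?C"
  proof -
    have "v [^] n \<otimes> u = u \<otimes> v [^] n" using \<mu>n by (simp add: v_pow_u c power_divide)
    moreover have "v [^] n \<otimes> v = v \<otimes> v [^] n" using nat_pow_Suc2[OF v, of n] by simp
    ultimately show ?thesis using commutes_all[of "v [^] n"] by auto
  qed
  ultimately have "gen_subalgebra A {u [^] n, v [^] n} \<subseteq> ?C" by (intro gen_subalgebra_minimal) auto
  then show ?thesis using assms Inv_eq by auto
qed

text \<open>At a top place (p, q) of b the hypotheses become \<mu>^(i+j) = \<mu>^q, (lam
  \<mu>)^(i+j) \<mu>^p = 1 and \<mu>^(p+q) lam^q = lam^j. The first holds for \<open>lam\<close>
  too, which has the same order; it turns the left side of the second into that of the third, so
  lam^j = 1.\<close>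

lemma twisted_commuting:
  assumes b: "b \<in> carrier A" "b \<noteq> \<zero>" and j: "j < n"
    and bu: "u \<otimes> b = \<mu> ^ (i + j) \<odot> (b \<otimes> u)" and bv: "v \<otimes> b = (lam * \<mu>) ^ (i + j) \<odot> (b \<otimes> v)"
    and Gb: "G b = lam ^ j \<odot> b"
  shows "j = 0" and "X b = \<zero> \<Longrightarrow> n dvd i"
proof -
  obtain p q where pq: "\<psi> p q b \<noteq> 0" "\<psi> (Suc p) (Suc q) b = 0" by (rule top_coeff[OF b])
  have "\<psi> p q b = \<mu> ^ (i + j) * ((1 / \<mu>) ^ q * \<psi> p q b)"
    using psi_u_mult[OF b(1), of p q] psi_mult_u[OF b(1), of p q] pq(2) b(1)
    unfolding bu by (simp add: psi_smult)
  then have 1: "\<mu> ^ (i + j) = \<mu> ^ q" using pq(1) \<mu> by (simp add: power_divide field_simps)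
  have "(1 / \<mu>) ^ p * \<psi> p q b = (lam * \<mu>) ^ (i + j) * \<psi> p q b"
    using psi_v_mult[OF b(1), of p q] psi_mult_v[OF b(1), of p q] pq(2) b(1)
    unfolding bv by (auto simp: psi_smult)
  then have 2: "lam ^ (i + j) * \<mu> ^ (i + j) * \<mu> ^ p = 1"
    using pq(1) \<mu> by (simp add: power_divide power_mult_distrib field_simps)
  have "\<mu> ^ (p + q) * lam ^ q * \<psi> p q b = lam ^ j * \<psi> p q b"
    using psi_G[OF b(1), of p q] b(1) unfolding Gb by (auto simp: psi_smult)
  then have 3: "\<mu> ^ (p + q) * lam ^ q = lam ^ j" using pq(1) by simp
  have m: "(i + j) mod n = q mod n" using 1 has_mult_order_power_eq_iff[OF mu] by blast
  then have "lam ^ (i + j) = lam ^ q" using has_mult_order_power_eq_iff[OF lam] by blast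
  then have "lam ^ j = 1" using 1 2 3 by (simp add: power_add mult_ac)
  then have "n dvd j" using has_mult_order_power_eq_1_iff[OF lam] by simp
  then show j0: "j = 0" using j by (auto dest: dvd_imp_le)
  assume X: "X b = \<zero>"
  \<comment> \<open>As for invariants, X b = 0 yields n | q; with j = 0 the congruence of i + j and
    q modulo n then gives n | i.\<close>
  have "n dvd q"
  proof (cases q)
    case (Suc m)
    then have "r * \<mu> ^ p * xv q * (1 / \<mu>) ^ m * \<psi> p q b = 0"
      using psi_X[OF b(1), of p m] pq(2) X by (simp add: psi_zero)
    then show ?thesis using r \<mu> pq(1) xv_eq_0_iff[of q] by simp
  qed simp
  then show "n dvd i" using m j0 by (simp add: dvd_eq_mod_eq_0)
qed

end

subsection \<open>Smash products with Taft algebras\<close>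

text \<open>The smash multiplication nests \<open>tensor_lift\<close>, the inner lifts depending on
  the outer arguments. Linearity of this dependence is what makes the outer lifts
  meaningful.\<close>

lemma (in tensor) tensor_lift_linear_param:
  assumes "kspace V" "kspace W"
    and bl: "\<And>w. w \<in> carrier W \<Longrightarrow> bilinear_on A B V (\<beta> w)"
    and lin: "\<And>a b. \<lbrakk>a \<in> carrier A; b \<in> carrier B\<rbrakk> \<Longrightarrow> linear_on W V (\<lambda>w. \<beta> w a b)"
    and Q: "Q \<in> carrier T"
  shows "linear_on W V (\<lambda>w. tensor_lift V (\<beta> w) Q)"
proof -
  interpret V: kspace V by fact
  interpret W: kspace W by fact
  note tl = tensor_lift_linear[OF assms(1) bl]
  note cl = linear_on_closed[OF tl]
  show ?thesis
  proof (rule linear_onI)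
    fix w assume "w \<in> carrier W" then show "tensor_lift V (\<beta> w) Q \<in> carrier V" using cl Q by simp
  next
    fix w w' assume w: "w \<in> carrier W" "w' \<in> carrier W"
    show "tensor_lift V (\<beta> (w \<oplus>\<^bsub>W\<^esub> w')) Q = tensor_lift V (\<beta> w) Q \<oplus>\<^bsub>V\<^esub> tensor_lift V (\<beta> w') Q"
    proof (rule T.linear_on_eqI[OF assms(1) _ _ spans_pure _ Q])
      show "linear_on T V (tensor_lift V (\<beta> (w \<oplus>\<^bsub>W\<^esub> w')))" using tl w by simp
      show "linear_on T V (\<lambda>Q. tensor_lift V (\<beta> w) Q \<oplus>\<^bsub>V\<^esub> tensor_lift V (\<beta> w') Q)"
        using tl w by (intro V.linear_on_add_fun)
    qed (use w in \<open>auto simp: tensor_lift_pure[OF assms(1) bl] linear_on_add[OF lin]\<close>)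
  next
    fix d w assume w: "w \<in> carrier W"
    show "tensor_lift V (\<beta> (d \<odot>\<^bsub>W\<^esub> w)) Q = d \<odot>\<^bsub>V\<^esub> tensor_lift V (\<beta> w) Q"
    proof (rule T.linear_on_eqI[OF assms(1) _ _ spans_pure _ Q])
      show "linear_on T V (tensor_lift V (\<beta> (d \<odot>\<^bsub>W\<^esub> w)))" using tl w by simp
      show "linear_on T V (\<lambda>Q. d \<odot>\<^bsub>V\<^esub> tensor_lift V (\<beta> w) Q)"
        using tl w by (intro linear_on_comp[OF V.linear_on_smult_left])
    qed (use w in \<open>auto simp: tensor_lift_pure[OF assms(1) bl] linear_on_smult[OF lin]\<close>)
  qed
qed

lemma (in kspace) linear_on_finsum:
  assumes "kspace U" "finite S" "\<And>s. s \<in> S \<Longrightarrow> linear_on U V (f s)"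
  shows "linear_on U V (\<lambda>a. \<Oplus>s\<in>S. f s a)"
proof -
  interpret U: kspace U by fact
  show ?thesis
    using assms(2,3)
  proof (induction S rule: finite_induct)
    case empty
    then show ?case by (simp add: linear_on_const_zero)
  next
    case (insert s S)
    have "linear_on U V (\<lambda>a. f s a \<oplus> (\<Oplus>s\<in>S. f s a))"
      using insert by (intro linear_on_add_fun) auto
    then show ?case
      by (rule linear_on_cong[OF U.kspace_axioms])
        (use insert in \<open>auto intro!: finsum_insert[symmetric] linear_on_closed[of U V]\<close>)
  qed
qed

locale taft_action = T: taft n lam + A: kalgebra A + hopf_action "taft_hopf n lam" A act
  for n and lam :: "'k::field_char_0" and A :: "('k, 'a) module" and act
begin

abbreviation "P \<equiv> T.P"
abbreviation "E \<equiv> tensor_alg A P"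
abbreviation pure (infixl \<open>\<bullet>\<close> 72) where "a \<bullet> h \<equiv> pure_tensor A P a h"
abbreviation "SM \<equiv> smash_product A (taft_hopf n lam) act"

sublocale S: tensor A P
  by unfold_locales

lemmas act_cl [simp, intro] = act_closed[unfolded T.taft_hopf_simps]

lemma linear_act_left: "r \<in> carrier A \<Longrightarrow> linear_on P A (\<lambda>h. act h r)"
  and linear_act_right: "h \<in> carrier P \<Longrightarrow> linear_on A A (act h)"
  using act_add_left act_add_right act_smult_left act_smult_right by (auto intro!: linear_onI)

lemma act_one': "r \<in> carrier A \<Longrightarrow> act \<one>\<^bsub>P\<^esub> r = r"
  and act_mult': "\<lbrakk>h \<in> carrier P; k \<in> carrier P; r \<in> carrier A\<rbrakk> \<Longrightarrow> act (h \<otimes>\<^bsub>P\<^esub> k) r = act h (act k r)"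
  using act_one act_mult by simp_all

lemma bilinear_act_act:
  assumes "r \<in> carrier A" "r' \<in> carrier A"
  shows "bilinear_on P P A (\<lambda>h1 h2. act h1 r \<otimes>\<^bsub>A\<^esub> act h2 r')"
  using assms
  by (intro bilinear_onI linear_on_comp[OF A.linear_on_mult_left] linear_on_comp[OF A.linear_on_mult_right]
      linear_act_left) auto

lemma act_g_mult:
  assumes "r \<in> carrier A" "r' \<in> carrier A"
  shows "act T.g (r \<otimes>\<^bsub>A\<^esub> r') = act T.g r \<otimes>\<^bsub>A\<^esub> act T.g r'"
  using act_prod[of T.g r r'] assms
  by (simp add: T.comult T.TP.tensor_lift_pure[OF A.kspace_axioms bilinear_act_act])

text \<open>A skew derivation relative to g, from \<Delta>(x) = g \<otimes> x + x \<otimes>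
  1.\<close>

lemma act_x_mult:
  assumes "r \<in> carrier A" "r' \<in> carrier A"
  shows "act T.x (r \<otimes>\<^bsub>A\<^esub> r') = act T.g r \<otimes>\<^bsub>A\<^esub> act T.x r' \<oplus>\<^bsub>A\<^esub> act T.x r \<otimes>\<^bsub>A\<^esub> r'"
proof -
  note bl = bilinear_act_act[OF assms]
  show ?thesis
    using act_prod[of T.x r r'] assms
    by (simp add: T.comult T.TP.tensor_lift_pure[OF A.kspace_axioms bl] act_one'
        linear_on_add[OF T.TP.tensor_lift_linear[OF A.kspace_axioms bl]])
qed

lemma act_g_one: "act T.g \<one>\<^bsub>A\<^esub> = \<one>\<^bsub>A\<^esub>" and act_x_one: "act T.x \<one>\<^bsub>A\<^esub> = \<zero>\<^bsub>A\<^esub>"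
  using act_unit[of T.g] act_unit[of T.x] by (simp_all add: T.counit)

section \<open>The multiplication of the smash product\<close>

lemma smash_tensor [simp]:
  "tensor_alg A (taft_hopf n lam) = E" "pure_tensor A (taft_hopf n lam) = pure_tensor A P"
  by (simp_all add: tensor_alg_def pure_tensor_def[abs_def] tensor_null_def tensor_rels_def DirProd_def)

lemma carrier_smash: "carrier SM = carrier E"
  by (simp add: smash_product_def)

text \<open>The product of r # h and r' # h', singled out so that its linearity in all four
  arguments is settled before the lifts are nested.\<close>

definition smash_pure where
  "smash_pure r h r' h' = tensor_lift E (\<lambda>h1 h2. (r \<otimes>\<^bsub>A\<^esub> act h1 r') \<bullet> (h2 \<otimes>\<^bsub>P\<^esub> h')) (comult T.H h)"

lemma comult_closed: "h \<in> carrier P \<Longrightarrow> comult T.H h \<in> carrier T.HH"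
  by (rule linear_on_closed[OF alg_hom_linear[OF T.comult(1)]])

lemmas pure_lin = bilinear_onD[OF S.pure_bilinear]

lemma bilinear_smash_inner:
  assumes "r \<in> carrier A" "r' \<in> carrier A" "h' \<in> carrier P"
  shows "bilinear_on P P E (\<lambda>h1 h2. (r \<otimes>\<^bsub>A\<^esub> act h1 r') \<bullet> (h2 \<otimes>\<^bsub>P\<^esub> h'))"
  using assms
  by (intro bilinear_onI linear_on_comp[OF pure_lin(1)] linear_on_comp[OF pure_lin(2)]
      linear_on_comp[OF A.linear_on_mult_left] T.P.linear_on_mult_right linear_act_left) auto

lemma bilinear_smash_pure:
  assumes "r \<in> carrier A" "h \<in> carrier P"
  shows "bilinear_on A P E (smash_pure r h)"
proof (rule bilinear_onI)
  fix r' assume "r' \<in> carrier A"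
  then show "linear_on P E (smash_pure r h r')" unfolding smash_pure_def
    using assms
    by (intro T.TP.tensor_lift_linear_param[OF S.T.kspace_axioms T.P.kspace_axioms _ _ comult_closed]
        bilinear_smash_inner linear_on_comp[OF pure_lin(1)] T.P.linear_on_mult_left) auto
next
  fix h' assume "h' \<in> carrier P"
  then show "linear_on A E (\<lambda>r'. smash_pure r h r' h')" unfolding smash_pure_def
    using assms
    by (intro T.TP.tensor_lift_linear_param[OF S.T.kspace_axioms A.kspace_axioms _ _ comult_closed]
        bilinear_smash_inner linear_on_comp[OF pure_lin(2)] linear_on_comp[OF A.linear_on_mult_left]
        linear_act_right) auto
qed

lemma bilinear_smash_pure':
  assumes "r' \<in> carrier A" "h' \<in> carrier P"
  shows "bilinear_on A P E (\<lambda>r h. smash_pure r h r' h')"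
proof (rule bilinear_onI)
  fix r assume "r \<in> carrier A"
  then show "linear_on P E (\<lambda>h. smash_pure r h r' h')" unfolding smash_pure_def
    using assms
    by (intro linear_on_comp[OF T.TP.tensor_lift_linear[OF S.T.kspace_axioms] alg_hom_linear[OF T.comult(1)]]
        bilinear_smash_inner)
next
  fix h assume "h \<in> carrier P"
  then show "linear_on A E (\<lambda>r. smash_pure r h r' h')" unfolding smash_pure_def
    using assms
    by (intro T.TP.tensor_lift_linear_param[OF S.T.kspace_axioms A.kspace_axioms _ _ comult_closed]
        bilinear_smash_inner linear_on_comp[OF pure_lin(2)] A.linear_on_mult_right) auto
qed

lemma smash_mult_eq:
  "Q \<otimes>\<^bsub>SM\<^esub> Q' = tensor_lift E (\<lambda>r h. tensor_lift E (smash_pure r h) Q') Q"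
  by (simp add: smash_product_def smash_pure_def[abs_def])

lemma bilinear_smash_outer:
  assumes "Q' \<in> carrier E"
  shows "bilinear_on A P E (\<lambda>r h. tensor_lift E (smash_pure r h) Q')"
proof (rule bilinear_onI)
  fix r assume r: "r \<in> carrier A"
  show "linear_on P E (\<lambda>h. tensor_lift E (smash_pure r h) Q')"
    using r bilinear_smash_pure bilinear_onD(1)[OF bilinear_smash_pure']
    by (intro S.tensor_lift_linear_param[OF S.T.kspace_axioms T.P.kspace_axioms _ _ assms]) auto
next
  fix h assume h: "h \<in> carrier P"
  show "linear_on A E (\<lambda>r. tensor_lift E (smash_pure r h) Q')"
    using h bilinear_smash_pure bilinear_onD(2)[OF bilinear_smash_pure']
    by (intro S.tensor_lift_linear_param[OF S.T.kspace_axioms A.kspace_axioms _ _ assms]) auto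
qed

lemma smash_mult_pure:
  assumes "r \<in> carrier A" "h \<in> carrier P" "r' \<in> carrier A" "h' \<in> carrier P"
  shows "(r \<bullet> h) \<otimes>\<^bsub>SM\<^esub> (r' \<bullet> h') = smash_pure r h r' h'"
  using assms
  by (simp add: smash_mult_eq S.tensor_lift_pure[OF S.T.kspace_axioms bilinear_smash_outer]
      S.tensor_lift_pure[OF S.T.kspace_axioms bilinear_smash_pure])

lemma smash_mult_linear_left: "Q' \<in> carrier E \<Longrightarrow> linear_on E E (\<lambda>Q. Q \<otimes>\<^bsub>SM\<^esub> Q')"
  unfolding smash_mult_eq by (rule S.tensor_lift_linear[OF S.T.kspace_axioms bilinear_smash_outer])

lemma smash_mult_linear_right: "Q \<in> carrier E \<Longrightarrow> linear_on E E (\<lambda>Q'. Q \<otimes>\<^bsub>SM\<^esub> Q')"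
  unfolding smash_mult_eq
  by (rule S.tensor_lift_linear_param[OF S.T.kspace_axioms S.T.kspace_axioms])
    (auto intro: bilinear_smash_outer S.tensor_lift_linear[OF S.T.kspace_axioms bilinear_smash_pure])

text \<open>\<open>cross h a\<close> is the sum of the \<open>(h\<^sub>1 \<cdot> a) # h\<^sub>2\<close>, the product of \<open>1 # h\<close> and \<open>a # 1\<close>.\<close>

definition cross where "cross h a = tensor_lift E (\<lambda>h1 h2. act h1 a \<bullet> h2) (comult T.H h)"
text \<open>With \<open>right_mult\<close>, the outer multiplications on the A-factor and the
  H-factor: (r # h)(a # h') is \<open>cross h a\<close> with r applied on the left and h' on the
  right.\<close>

definition left_mult where "left_mult a = tensor_lift E (\<lambda>b k. (a \<otimes>\<^bsub>A\<^esub> b) \<bullet> k)"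
definition right_mult where "right_mult k = tensor_lift E (\<lambda>b l. b \<bullet> (l \<otimes>\<^bsub>P\<^esub> k))"

lemma bilinear_cross: "a \<in> carrier A \<Longrightarrow> bilinear_on P P E (\<lambda>h1 h2. act h1 a \<bullet> h2)"
  by (intro bilinear_onI pure_lin(1) linear_on_comp[OF pure_lin(2)] linear_act_left) auto

lemma bilinear_left_mult: "a \<in> carrier A \<Longrightarrow> bilinear_on A P E (\<lambda>b k. (a \<otimes>\<^bsub>A\<^esub> b) \<bullet> k)"
  by (intro bilinear_onI pure_lin(1) linear_on_comp[OF pure_lin(2)] A.linear_on_mult_left) auto

lemma bilinear_right_mult: "k \<in> carrier P \<Longrightarrow> bilinear_on A P E (\<lambda>b l. b \<bullet> (l \<otimes>\<^bsub>P\<^esub> k))"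
  by (intro bilinear_onI pure_lin(2) linear_on_comp[OF pure_lin(1)] T.P.linear_on_mult_right) auto

lemmas left_mult_linear = S.tensor_lift_linear[OF S.T.kspace_axioms bilinear_left_mult, folded left_mult_def]
lemmas left_mult_pure = S.tensor_lift_pure[OF S.T.kspace_axioms bilinear_left_mult, folded left_mult_def]
lemmas right_mult_linear = S.tensor_lift_linear[OF S.T.kspace_axioms bilinear_right_mult, folded right_mult_def]
lemmas right_mult_pure = S.tensor_lift_pure[OF S.T.kspace_axioms bilinear_right_mult, folded right_mult_def]
lemmas cross_lift_linear = T.TP.tensor_lift_linear[OF S.T.kspace_axioms bilinear_cross]
lemmas cross_lift_pure = T.TP.tensor_lift_pure[OF S.T.kspace_axioms bilinear_cross]

lemma cross_linear_left: "a \<in> carrier A \<Longrightarrow> linear_on P E (\<lambda>h. cross h a)"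
  unfolding cross_def by (rule linear_on_comp[OF cross_lift_linear alg_hom_linear[OF T.comult(1)]])

lemma cross_linear_right: "h \<in> carrier P \<Longrightarrow> linear_on A E (cross h)"
  unfolding cross_def
  by (intro T.TP.tensor_lift_linear_param[OF S.T.kspace_axioms A.kspace_axioms _ _ comult_closed]
      bilinear_cross linear_on_comp[OF pure_lin(2)] linear_act_right) auto

lemma cross_one: "a \<in> carrier A \<Longrightarrow> cross \<one>\<^bsub>P\<^esub> a = a \<bullet> \<one>\<^bsub>P\<^esub>"
  by (simp add: cross_def alg_hom_one[OF T.comult(1)] T.TP.pure_one cross_lift_pure act_one')

text \<open>Since \<Delta>(hg) = \<Delta>(h)(g \<otimes> g), the factor g acts on a first and
  reappears at the right end. The identity is checked with an arbitrary tensor in place of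
  \<Delta>(h).\<close>

lemma cross_g:
  assumes "h \<in> carrier P" "a \<in> carrier A"
  shows "cross (h \<otimes>\<^bsub>P\<^esub> T.g) a = right_mult T.g (cross h (act T.g a))"
proof -
  let ?f = "\<lambda>a. tensor_lift E (\<lambda>h1 h2. act h1 a \<bullet> h2)" and ?g = "pure_tensor P P T.g T.g"
  have "?f a (Q \<otimes>\<^bsub>T.HH\<^esub> ?g) = right_mult T.g (?f (act T.g a) Q)" if "Q \<in> carrier T.HH" for Q
  proof (rule T.TP.T.linear_on_eqI[OF S.T.kspace_axioms _ _ T.TP.spans_pure _ that])
    show "linear_on T.HH E (\<lambda>Q. ?f a (Q \<otimes>\<^bsub>T.HH\<^esub> ?g))"
      using assms by (intro linear_on_comp[OF cross_lift_linear] T.TP.T.linear_on_mult_right) auto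
    show "linear_on T.HH E (\<lambda>Q. right_mult T.g (?f (act T.g a) Q))"
      using assms by (intro linear_on_comp[OF right_mult_linear] cross_lift_linear) auto
  qed (use assms in \<open>auto simp: T.TP.pure_mult cross_lift_pure right_mult_pure act_mult'\<close>)
  then show ?thesis
    using assms by (simp add: cross_def alg_hom_mult[OF T.comult(1)] T.comult(2) comult_closed)
qed

text \<open>The summand g \<otimes> x of \<Delta>(x) contributes the first term and x \<otimes> 1
  the second.\<close>

lemma cross_x:
  assumes "h \<in> carrier P" "a \<in> carrier A"
  shows "cross (h \<otimes>\<^bsub>P\<^esub> T.x) a = right_mult T.x (cross h (act T.g a)) \<oplus>\<^bsub>E\<^esub> cross h (act T.x a)"
proof -
  let ?f = "\<lambda>a. tensor_lift E (\<lambda>h1 h2. act h1 a \<bullet> h2)"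
  let ?x = "pure_tensor P P T.g T.x \<oplus>\<^bsub>T.HH\<^esub> pure_tensor P P T.x \<one>\<^bsub>P\<^esub>"
  have "?f a (Q \<otimes>\<^bsub>T.HH\<^esub> ?x) = right_mult T.x (?f (act T.g a) Q) \<oplus>\<^bsub>E\<^esub> ?f (act T.x a) Q"
    if "Q \<in> carrier T.HH" for Q
  proof (rule T.TP.T.linear_on_eqI[OF S.T.kspace_axioms _ _ T.TP.spans_pure _ that])
    show "linear_on T.HH E (\<lambda>Q. ?f a (Q \<otimes>\<^bsub>T.HH\<^esub> ?x))"
      using assms by (intro linear_on_comp[OF cross_lift_linear] T.TP.T.linear_on_mult_right) auto
    show "linear_on T.HH E (\<lambda>Q. right_mult T.x (?f (act T.g a) Q) \<oplus>\<^bsub>E\<^esub> ?f (act T.x a) Q)"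
      using assms by (intro S.T.linear_on_add_fun linear_on_comp[OF right_mult_linear] cross_lift_linear) auto
  qed (use assms in \<open>auto simp: T.TP.T.r_distr T.TP.pure_mult cross_lift_pure right_mult_pure act_mult'
        linear_on_add[OF cross_lift_linear]\<close>)
  then show ?thesis
    using assms by (simp add: cross_def alg_hom_mult[OF T.comult(1)] T.comult(3) comult_closed)
qed

text \<open>Generators are split off from the right of h: g passes an invariant unchanged, and the
  extra term for x is \<open>cross\<close> of zero.\<close>

lemma cross_invariant:
  assumes a: "a \<in> carrier A" "act T.g a = a" "act T.x a = \<zero>\<^bsub>A\<^esub>" and h: "h \<in> carrier P"
  shows "cross h a = a \<bullet> h"
proof -
  let ?U = "{h \<in> carrier P. cross h a = a \<bullet> h}"
  have z: "cross h \<zero>\<^bsub>A\<^esub> = \<zero>\<^bsub>E\<^esub>" if "h \<in> carrier P" for h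
    using A.linear_on_zero[OF S.T.kspace_axioms cross_linear_right[OF that]] .
  have "h \<in> ?U"
  proof (rule T.presented_right_induct[OF _ _ _ h])
    show "subspace_of ?U P"
      by (rule T.P.linear_on_eq_subspace[OF S.T.kspace_axioms cross_linear_left[OF a(1)] pure_lin(1)[OF a(1)]])
    show "\<one>\<^bsub>P\<^esub> \<in> ?U" using a(1) by (simp add: cross_one)
    fix s b assume "b \<in> ?U"
    then show "b \<otimes>\<^bsub>P\<^esub> T.gen s \<in> ?U"
      using a z by (cases s) (simp_all add: cross_g cross_x right_mult_pure)
  qed
  then show ?thesis by simp
qed

lemma smash_left_A:
  assumes "r \<in> carrier A" "r' \<in> carrier A" "h' \<in> carrier P"
  shows "(r \<bullet> \<one>\<^bsub>P\<^esub>) \<otimes>\<^bsub>SM\<^esub> (r' \<bullet> h') = (r \<otimes>\<^bsub>A\<^esub> r') \<bullet> h'"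
  using assms
  by (simp add: smash_mult_pure smash_pure_def alg_hom_one[OF T.comult(1)] T.TP.pure_one
      T.TP.tensor_lift_pure[OF S.T.kspace_axioms bilinear_smash_inner] act_one')

lemma smash_right_A:
  assumes "r \<in> carrier A" "h \<in> carrier P" "r' \<in> carrier A"
  shows "(r \<bullet> h) \<otimes>\<^bsub>SM\<^esub> (r' \<bullet> \<one>\<^bsub>P\<^esub>) = left_mult r (cross h r')"
proof -
  have "tensor_lift E (\<lambda>h1 h2. (r \<otimes>\<^bsub>A\<^esub> act h1 r') \<bullet> (h2 \<otimes>\<^bsub>P\<^esub> \<one>\<^bsub>P\<^esub>)) Q
    = left_mult r (tensor_lift E (\<lambda>h1 h2. act h1 r' \<bullet> h2) Q)" if "Q \<in> carrier T.HH" for Q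
  proof (rule T.TP.T.linear_on_eqI[OF S.T.kspace_axioms _ _ T.TP.spans_pure _ that])
    show "linear_on T.HH E (\<lambda>Q. left_mult r (tensor_lift E (\<lambda>h1 h2. act h1 r' \<bullet> h2) Q))"
      using assms by (intro linear_on_comp[OF left_mult_linear] cross_lift_linear)
  qed (use assms in \<open>auto intro!: T.TP.tensor_lift_linear S.T.kspace_axioms bilinear_smash_inner
      simp: cross_lift_pure left_mult_pure T.TP.tensor_lift_pure[OF S.T.kspace_axioms bilinear_smash_inner]\<close>)
  then show ?thesis
    using assms by (simp add: smash_mult_pure smash_pure_def cross_def comult_closed)
qed

text \<open>The unit of A is fixed by g and killed by x, so \<open>cross_invariant\<close> evaluates
  \<open>cross h\<close> at it as 1 # h.\<close>

lemma smash_right_H: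
  assumes "r \<in> carrier A" "h \<in> carrier P" "h' \<in> carrier P"
  shows "(r \<bullet> h) \<otimes>\<^bsub>SM\<^esub> (\<one>\<^bsub>A\<^esub> \<bullet> h') = r \<bullet> (h \<otimes>\<^bsub>P\<^esub> h')"
proof -
  have "tensor_lift E (\<lambda>h1 h2. (r \<otimes>\<^bsub>A\<^esub> act h1 \<one>\<^bsub>A\<^esub>) \<bullet> (h2 \<otimes>\<^bsub>P\<^esub> h')) Q
    = right_mult h' (left_mult r (tensor_lift E (\<lambda>h1 h2. act h1 \<one>\<^bsub>A\<^esub> \<bullet> h2) Q))" if "Q \<in> carrier T.HH" for Q
  proof (rule T.TP.T.linear_on_eqI[OF S.T.kspace_axioms _ _ T.TP.spans_pure _ that])
    show "linear_on T.HH E (\<lambda>Q. right_mult h' (left_mult r (tensor_lift E (\<lambda>h1 h2. act h1 \<one>\<^bsub>A\<^esub> \<bullet> h2) Q)))"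
      using assms by (intro linear_on_comp[OF right_mult_linear] linear_on_comp[OF left_mult_linear] cross_lift_linear) auto
  qed (use assms in \<open>auto intro!: T.TP.tensor_lift_linear S.T.kspace_axioms bilinear_smash_inner
      simp: cross_lift_pure left_mult_pure right_mult_pure T.TP.tensor_lift_pure[OF S.T.kspace_axioms bilinear_smash_inner]\<close>)
  then have "(r \<bullet> h) \<otimes>\<^bsub>SM\<^esub> (\<one>\<^bsub>A\<^esub> \<bullet> h') = right_mult h' (left_mult r (cross h \<one>\<^bsub>A\<^esub>))"
    using assms by (simp add: smash_mult_pure smash_pure_def cross_def comult_closed)
  then show ?thesis
    using assms by (simp add: cross_invariant act_g_one act_x_one left_mult_pure right_mult_pure)
qed

lemma smash_left_g:
  assumes "r' \<in> carrier A" "h' \<in> carrier P"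
  shows "(\<one>\<^bsub>A\<^esub> \<bullet> T.g) \<otimes>\<^bsub>SM\<^esub> (r' \<bullet> h') = act T.g r' \<bullet> (T.g \<otimes>\<^bsub>P\<^esub> h')"
  using assms
  by (simp add: smash_mult_pure smash_pure_def T.comult
      T.TP.tensor_lift_pure[OF S.T.kspace_axioms bilinear_smash_inner])

lemma smash_left_x:
  assumes "r' \<in> carrier A" "h' \<in> carrier P"
  shows "(\<one>\<^bsub>A\<^esub> \<bullet> T.x) \<otimes>\<^bsub>SM\<^esub> (r' \<bullet> h') = act T.g r' \<bullet> (T.x \<otimes>\<^bsub>P\<^esub> h') \<oplus>\<^bsub>E\<^esub> act T.x r' \<bullet> h'"
  using assms
  by (simp add: smash_mult_pure smash_pure_def T.comult
      T.TP.tensor_lift_pure[OF S.T.kspace_axioms bilinear_smash_inner]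
      linear_on_add[OF T.TP.tensor_lift_linear[OF S.T.kspace_axioms bilinear_smash_inner]])

text \<open>In a product the last generator acts first, and the counit is multiplicative, so
  induction from the right reduces invariance to g and x.\<close>

lemma invariants_eq: "invariants T.H A act = {a \<in> carrier A. act T.g a = a \<and> act T.x a = \<zero>\<^bsub>A\<^esub>}"
proof (intro equalityI subsetI)
  fix a assume "a \<in> invariants T.H A act"
  then show "a \<in> {a \<in> carrier A. act T.g a = a \<and> act T.x a = \<zero>\<^bsub>A\<^esub>}"
    by (auto simp: invariants_def T.counit)
next
  fix a assume "a \<in> {a \<in> carrier A. act T.g a = a \<and> act T.x a = \<zero>\<^bsub>A\<^esub>}"
  then have a: "a \<in> carrier A" "act T.g a = a" "act T.x a = \<zero>\<^bsub>A\<^esub>" by auto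
  let ?U = "{h \<in> carrier P. act h a = counit T.H h \<odot>\<^bsub>A\<^esub> a}"
  note lin = alg_hom_linear[OF T.counit(1)]
  have "h \<in> ?U" if "h \<in> carrier P" for h
  proof (rule T.presented_right_induct[OF _ _ _ that])
    have "linear_on P A (\<lambda>h. counit T.H h \<odot>\<^bsub>A\<^esub> a)"
      using a(1) linear_on_add[OF lin] linear_on_smult[OF lin]
      by (intro linear_onI) (simp_all add: A.smult_l_distr A.smult_smult)
    from T.P.linear_on_eq_subspace[OF A.kspace_axioms linear_act_left[OF a(1)] this]
    show "subspace_of ?U P" .
    show "\<one>\<^bsub>P\<^esub> \<in> ?U" using a(1) alg_hom_one[OF T.counit(1)] by (simp add: act_one')
    fix s b assume b: "b \<in> ?U"
    have "act b \<zero>\<^bsub>A\<^esub> = \<zero>\<^bsub>A\<^esub>"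
      using b A.linear_on_zero[OF A.kspace_axioms linear_act_right] by simp
    then show "b \<otimes>\<^bsub>P\<^esub> T.gen s \<in> ?U"
      using a b alg_hom_mult[OF T.counit(1)] by (cases s) (simp_all add: act_mult' T.counit)
  qed
  then show "a \<in> invariants T.H A act" using a(1) by (simp add: invariants_def)
qed

section \<open>Components with respect to the monomials g^i x^j\<close>

text \<open>The coefficient \<open>a\<^bsub>ij\<^esub>\<close> in the expansion of an element as the sum of the
  \<open>a\<^bsub>ij\<^esub> # g\<^sup>i x\<^sup>j\<close>.\<close>

definition component :: "nat \<Rightarrow> nat \<Rightarrow> ('a \<times> (taft_sym list \<Rightarrow>\<^sub>0 'k) set \<Rightarrow>\<^sub>0 'k) set \<Rightarrow> 'a" where
  "component i j = tensor_lift A (\<lambda>a h. T.coeff i j h \<odot>\<^bsub>A\<^esub> a)"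

lemma bilinear_component: "bilinear_on A P A (\<lambda>a h. T.coeff i j h \<odot>\<^bsub>A\<^esub> a)"
  using linear_on_add[OF T.linear_coeff[of i j]] linear_on_smult[OF T.linear_coeff[of i j]]
  by (intro bilinear_onI A.linear_on_smult_left linear_onI) (simp_all add: A.smult_l_distr A.smult_smult)

lemmas component_linear = S.tensor_lift_linear[OF A.kspace_axioms bilinear_component, folded component_def]

lemma component_closed [simp]: "z \<in> carrier E \<Longrightarrow> component i j z \<in> carrier A"
  by (rule linear_on_closed[OF component_linear])

lemma component_pure:
  assumes "a \<in> carrier A" "l < n"
  shows "component i j (a \<bullet> T.mon k l) = (if j = l \<and> i mod n = k mod n then a else \<zero>\<^bsub>A\<^esub>)"
  using assms unfolding component_def
  by (simp add: S.tensor_lift_pure[OF A.kspace_axioms bilinear_component] T.coeff_mon)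

lemma spans_pure_mon: "spans E {a \<bullet> h | a h. a \<in> carrier A \<and> h \<in> {T.mon k l | k l. l < n}}"
  by (rule S.spans_pure_spans[OF _ T.spans_mon]) (simp add: spans_def)

lemma eq_on_pure_mon:
  assumes "kspace W" "linear_on E W f" "linear_on E W h"
    and "\<And>a k l. \<lbrakk>a \<in> carrier A; l < n\<rbrakk> \<Longrightarrow> f (a \<bullet> T.mon k l) = h (a \<bullet> T.mon k l)"
    and "z \<in> carrier E"
  shows "f z = h z"
  by (rule S.T.linear_on_eqI[OF assms(1-3) spans_pure_mon _ assms(5)]) (use assms(4) in auto)

lemma component_expansion:
  assumes "z \<in> carrier E"
  shows "z = (\<Oplus>\<^bsub>E\<^esub>p\<in>{..<n} \<times> {..<n}. component (fst p) (snd p) z \<bullet> T.mon (fst p) (snd p))"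
proof (rule eq_on_pure_mon[OF S.T.kspace_axioms linear_on_id _ _ assms])
  show "linear_on E E (\<lambda>z. \<Oplus>\<^bsub>E\<^esub>p\<in>{..<n} \<times> {..<n}. component (fst p) (snd p) z \<bullet> T.mon (fst p) (snd p))"
    by (intro S.T.linear_on_finsum S.T.kspace_axioms linear_on_comp[OF pure_lin(2)] component_linear) auto
  fix a k l assume a: "a \<in> carrier A" and l: "l < n"
  have z: "\<zero>\<^bsub>A\<^esub> \<bullet> h = \<zero>\<^bsub>E\<^esub>" if "h \<in> carrier P" for h
    using A.linear_on_zero[OF S.T.kspace_axioms pure_lin(2)[OF that]] .
  \<comment> \<open>On a # g^k x^l a single index contributes, (k mod n, l), since k itself may
    exceed the range of summation.\<close>
  have "(\<Oplus>\<^bsub>E\<^esub>p\<in>{..<n} \<times> {..<n}. component (fst p) (snd p) (a \<bullet> T.mon k l) \<bullet> T.mon (fst p) (snd p))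
    = (\<Oplus>\<^bsub>E\<^esub>p\<in>{..<n} \<times> {..<n}. if (k mod n, l) = p then a \<bullet> T.mon (fst p) (snd p) else \<zero>\<^bsub>E\<^esub>)"
    using a l by (intro S.T.finsum_cong') (auto simp: component_pure z)
  also have "\<dots> = a \<bullet> T.mon (k mod n) l"
    using a l T.n by (subst S.T.finsum_singleton) auto
  finally show "a \<bullet> T.mon k l = (\<Oplus>\<^bsub>E\<^esub>p\<in>{..<n} \<times> {..<n}. component (fst p) (snd p) (a \<bullet> T.mon k l) \<bullet> T.mon (fst p) (snd p))"
    by (simp add: T.mon_mod)
qed

lemma component_eq_zero:
  assumes "z \<in> carrier E" "n \<le> j"
  shows "component i j z = \<zero>\<^bsub>A\<^esub>"
  by (rule eq_on_pure_mon[OF A.kspace_axioms component_linear A.linear_on_const_zero _ assms(1)])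
    (use assms(2) in \<open>auto simp: component_pure\<close>)

lemma component_g_left:
  assumes "z \<in> carrier E"
  shows "component (Suc i) j ((\<one>\<^bsub>A\<^esub> \<bullet> T.g) \<otimes>\<^bsub>SM\<^esub> z) = act T.g (component i j z)"
proof (rule eq_on_pure_mon[OF A.kspace_axioms _ _ _ assms])
  have z: "act T.g \<zero>\<^bsub>A\<^esub> = \<zero>\<^bsub>A\<^esub>" using A.linear_on_zero[OF A.kspace_axioms linear_act_right] by simp
  show "linear_on E A (\<lambda>z. component (Suc i) j ((\<one>\<^bsub>A\<^esub> \<bullet> T.g) \<otimes>\<^bsub>SM\<^esub> z))"
    by (intro linear_on_comp[OF component_linear] smash_mult_linear_right) auto
  show "linear_on E A (\<lambda>z. act T.g (component i j z))"
    by (intro linear_on_comp[OF linear_act_right] component_linear) auto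
  fix a k l assume "a \<in> carrier A" "l < n"
  \<comment> \<open>Cancelling \<open>Suc\<close> modulo n is read off from powers of
    \<open>lam\<close>, where it means cancelling a nonzero factor.\<close>
  moreover have "Suc i mod n = Suc k mod n \<longleftrightarrow> i mod n = k mod n"
    using has_mult_order_power_eq_iff[OF T.q, of "Suc i" "Suc k"] has_mult_order_power_eq_iff[OF T.q, of i k]
      has_mult_order_neq_0[OF T.q] by simp
  ultimately show "component (Suc i) j ((\<one>\<^bsub>A\<^esub> \<bullet> T.g) \<otimes>\<^bsub>SM\<^esub> (a \<bullet> T.mon k l)) = act T.g (component i j (a \<bullet> T.mon k l))"
    by (simp add: smash_left_g T.g_mon component_pure z)
qed

lemma component_g_right:
  assumes "z \<in> carrier E"
  shows "component (Suc i) j (z \<otimes>\<^bsub>SM\<^esub> (\<one>\<^bsub>A\<^esub> \<bullet> T.g)) = lam ^ j \<odot>\<^bsub>A\<^esub> component i j z"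
proof (rule eq_on_pure_mon[OF A.kspace_axioms _ _ _ assms])
  show "linear_on E A (\<lambda>z. component (Suc i) j (z \<otimes>\<^bsub>SM\<^esub> (\<one>\<^bsub>A\<^esub> \<bullet> T.g)))"
    by (intro linear_on_comp[OF component_linear] smash_mult_linear_left) auto
  show "linear_on E A (\<lambda>z. lam ^ j \<odot>\<^bsub>A\<^esub> component i j z)"
    by (intro linear_on_comp[OF A.linear_on_smult_left] component_linear)
  fix a k l assume "a \<in> carrier A" "l < n"
  moreover have "Suc i mod n = Suc k mod n \<longleftrightarrow> i mod n = k mod n"
    using has_mult_order_power_eq_iff[OF T.q, of "Suc i" "Suc k"] has_mult_order_power_eq_iff[OF T.q, of i k]
      has_mult_order_neq_0[OF T.q] by simp
  ultimately show "component (Suc i) j ((a \<bullet> T.mon k l) \<otimes>\<^bsub>SM\<^esub> (\<one>\<^bsub>A\<^esub> \<bullet> T.g)) = lam ^ j \<odot>\<^bsub>A\<^esub> component i j (a \<bullet> T.mon k l)"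
    by (simp add: smash_right_H T.mon_g component_pure linear_on_smult[OF pure_lin(1)] linear_on_smult[OF component_linear])
qed

text \<open>Includes \<open>Suc l = n\<close>, where the monomial is zero instead of a basis
  element.\<close>

lemma component_mon_Suc:
  assumes "a \<in> carrier A"
  shows "component i 0 (a \<bullet> T.mon k (Suc l)) = \<zero>\<^bsub>A\<^esub>"
proof (cases "Suc l < n")
  case True
  then show ?thesis using assms by (simp add: component_pure)
next
  case False
  then show ?thesis
    using assms T.P.linear_on_zero[OF S.T.kspace_axioms pure_lin(1)[OF assms]]
      S.T.linear_on_zero[OF A.kspace_axioms component_linear] by (simp add: T.mon_eq_0)
qed

text \<open>In x-degree 0 a left factor x leaves only its action on the coefficient, as the other
  summand raises the degree, and a right factor x leaves nothing. So x kills the degree-0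
  coefficients of a central element.\<close>

lemma component_x_left:
  assumes "z \<in> carrier E"
  shows "component i 0 ((\<one>\<^bsub>A\<^esub> \<bullet> T.x) \<otimes>\<^bsub>SM\<^esub> z) = act T.x (component i 0 z)"
proof (rule eq_on_pure_mon[OF A.kspace_axioms _ _ _ assms])
  have z: "act T.x \<zero>\<^bsub>A\<^esub> = \<zero>\<^bsub>A\<^esub>" using A.linear_on_zero[OF A.kspace_axioms linear_act_right] by simp
  show "linear_on E A (\<lambda>z. component i 0 ((\<one>\<^bsub>A\<^esub> \<bullet> T.x) \<otimes>\<^bsub>SM\<^esub> z))"
    by (intro linear_on_comp[OF component_linear] smash_mult_linear_right) auto
  show "linear_on E A (\<lambda>z. act T.x (component i 0 z))"
    by (intro linear_on_comp[OF linear_act_right] component_linear) auto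
  fix a k l assume "a \<in> carrier A" "l < n"
  then show "component i 0 ((\<one>\<^bsub>A\<^esub> \<bullet> T.x) \<otimes>\<^bsub>SM\<^esub> (a \<bullet> T.mon k l)) = act T.x (component i 0 (a \<bullet> T.mon k l))"
    by (simp add: smash_left_x T.x_mon component_pure component_mon_Suc z linear_on_smult[OF pure_lin(1)]
        linear_on_smult[OF component_linear] linear_on_add[OF component_linear])
qed

lemma component_x_right:
  assumes "z \<in> carrier E"
  shows "component i 0 (z \<otimes>\<^bsub>SM\<^esub> (\<one>\<^bsub>A\<^esub> \<bullet> T.x)) = \<zero>\<^bsub>A\<^esub>"
proof (rule eq_on_pure_mon[OF A.kspace_axioms _ A.linear_on_const_zero _ assms])
  show "linear_on E A (\<lambda>z. component i 0 (z \<otimes>\<^bsub>SM\<^esub> (\<one>\<^bsub>A\<^esub> \<bullet> T.x)))"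
    by (intro linear_on_comp[OF component_linear] smash_mult_linear_left) auto
qed (simp add: smash_right_H T.mon_x component_mon_Suc)

lemma component_A_left:
  assumes "b \<in> carrier A" "z \<in> carrier E"
  shows "component i j ((b \<bullet> \<one>\<^bsub>P\<^esub>) \<otimes>\<^bsub>SM\<^esub> z) = b \<otimes>\<^bsub>A\<^esub> component i j z"
proof (rule eq_on_pure_mon[OF A.kspace_axioms _ _ _ assms(2)])
  show "linear_on E A (\<lambda>z. component i j ((b \<bullet> \<one>\<^bsub>P\<^esub>) \<otimes>\<^bsub>SM\<^esub> z))"
    using assms(1) by (intro linear_on_comp[OF component_linear] smash_mult_linear_right) auto
  show "linear_on E A (\<lambda>z. b \<otimes>\<^bsub>A\<^esub> component i j z)"
    using assms(1) by (intro linear_on_comp[OF A.linear_on_mult_left] component_linear) auto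
qed (use assms(1) in \<open>simp add: smash_left_A component_pure\<close>)

end

section \<open>The center of the smash product for an action in normal form\<close>

locale taft_plane_action =
  taft_plane A u v \<mu> \<epsilon> \<psi> n lam r "act (taft_g n lam)" "act (taft_x n lam)" + taft_action n lam A act
  for n and lam :: "'k::field_char_0" and A :: "('k, 'a) module" (structure) and act u v \<mu> \<epsilon> \<psi> r
begin

text \<open>u is an eigenvector of g and is killed by x, so each of the i + j factors contributes
  one \<mu>.\<close>

lemma cross_u: "cross (T.mon i j) u = \<mu> ^ (i + j) \<odot>\<^bsub>E\<^esub> (u \<bullet> T.mon i j)"
proof (induction j)
  case 0
  show ?case
  proof (induction i)
    case 0
    then show ?case by (simp add: T.mon_0_0 cross_one)
  next
    case (Suc i)
    then show ?case
      by (simp add: T.mon_0_Suc_g[symmetric] cross_g G_u linear_on_smult[OF cross_linear_right]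
          linear_on_smult[OF right_mult_linear] right_mult_pure S.T.smult_smult)
  qed
next
  case (Suc j)
  have "cross (T.mon i j) \<zero> = \<zero>\<^bsub>E\<^esub>"
    using linear_on_zero[OF S.T.kspace_axioms cross_linear_right] by simp
  then show ?case
    using Suc by (simp add: T.mon_x[symmetric] cross_x G_u X_u linear_on_smult[OF cross_linear_right]
        linear_on_smult[OF right_mult_linear] right_mult_pure S.T.smult_smult)
qed

text \<open>For j > 0 this is r \<mu>^(j-1) (1 + lam + ... + lam^(j-1)), the coefficient of u #
  x^(j-1) in (1 # x^j)(v # 1).\<close>

fun crossc :: "nat \<Rightarrow> 'k" where
  "crossc 0 = 0"
| "crossc (Suc j) = lam * \<mu> * crossc j + r * \<mu> ^ j"

text \<open>Each x either passes v with the factor lam \<mu> or turns it into r u and is used up;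
  since X u = 0 the latter happens at most once. For j = 0 the truncated index has coefficient
  \<open>crossc 0 = 0\<close>.\<close>

lemma cross_v:
  "cross (T.mon i j) v = (lam * \<mu>) ^ (i + j) \<odot>\<^bsub>E\<^esub> (v \<bullet> T.mon i j) \<oplus>\<^bsub>E\<^esub> (\<mu> ^ i * crossc j) \<odot>\<^bsub>E\<^esub> (u \<bullet> T.mon i (j - 1))"
proof (induction j)
  case 0
  have "cross (T.mon i 0) v = (lam * \<mu>) ^ i \<odot>\<^bsub>E\<^esub> (v \<bullet> T.mon i 0)"
  proof (induction i)
    case 0
    then show ?case by (simp add: T.mon_0_0 cross_one)
  next
    case (Suc i)
    then show ?case
      by (simp add: T.mon_0_Suc_g[symmetric] cross_g G_v linear_on_smult[OF cross_linear_right]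
          linear_on_smult[OF right_mult_linear] right_mult_pure S.T.smult_smult)
  qed
  then show ?case by simp
next
  case (Suc j)
  have 1: "(\<mu> ^ i * crossc j) \<odot>\<^bsub>E\<^esub> (u \<bullet> T.mon i (Suc (j - Suc 0))) = (\<mu> ^ i * crossc j) \<odot>\<^bsub>E\<^esub> (u \<bullet> T.mon i j)"
    by (cases j) simp_all
  have "cross (T.mon i (Suc j)) v = right_mult T.x (cross (T.mon i j) ((lam * \<mu>) \<odot> v)) \<oplus>\<^bsub>E\<^esub> cross (T.mon i j) (r \<odot> u)"
    by (simp add: T.mon_x[symmetric] cross_x G_v X_v)
  also have "cross (T.mon i j) (r \<odot> u) = (r * \<mu> ^ (i + j)) \<odot>\<^bsub>E\<^esub> (u \<bullet> T.mon i j)"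
    by (simp add: linear_on_smult[OF cross_linear_right] cross_u S.T.smult_smult)
  also have "right_mult T.x (cross (T.mon i j) ((lam * \<mu>) \<odot> v))
    = (lam * \<mu>) \<odot>\<^bsub>E\<^esub> ((lam * \<mu>) ^ (i + j) \<odot>\<^bsub>E\<^esub> (v \<bullet> T.mon i (Suc j)) \<oplus>\<^bsub>E\<^esub> (\<mu> ^ i * crossc j) \<odot>\<^bsub>E\<^esub> (u \<bullet> T.mon i j))"
    by (simp add: linear_on_smult[OF cross_linear_right] Suc linear_on_smult[OF right_mult_linear]
        linear_on_add[OF right_mult_linear] right_mult_pure 1 T.mon_x)
  also have "\<dots> \<oplus>\<^bsub>E\<^esub> (r * \<mu> ^ (i + j)) \<odot>\<^bsub>E\<^esub> (u \<bullet> T.mon i j)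
    = (lam * \<mu>) ^ (i + Suc j) \<odot>\<^bsub>E\<^esub> (v \<bullet> T.mon i (Suc j))
      \<oplus>\<^bsub>E\<^esub> ((lam * \<mu> * (\<mu> ^ i * crossc j)) \<odot>\<^bsub>E\<^esub> (u \<bullet> T.mon i j) \<oplus>\<^bsub>E\<^esub> (r * \<mu> ^ (i + j)) \<odot>\<^bsub>E\<^esub> (u \<bullet> T.mon i j))"
    by (simp add: S.T.smult_r_distr S.T.smult_smult S.T.a_assoc)
  also have "(lam * \<mu> * (\<mu> ^ i * crossc j)) \<odot>\<^bsub>E\<^esub> (u \<bullet> T.mon i j) \<oplus>\<^bsub>E\<^esub> (r * \<mu> ^ (i + j)) \<odot>\<^bsub>E\<^esub> (u \<bullet> T.mon i j)
    = (\<mu> ^ i * crossc (Suc j)) \<odot>\<^bsub>E\<^esub> (u \<bullet> T.mon i (Suc j - 1))"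
    by (simp add: algebra_simps power_add flip: S.T.smult_l_distr)
  finally show ?case .
qed

lemma power_mod_eq:
  assumes "i mod n = k mod n"
  shows "\<mu> ^ k = \<mu> ^ i" "lam ^ k = lam ^ i"
  using assms has_mult_order_power_eq_iff[OF mu, of k i] has_mult_order_power_eq_iff[OF lam, of k i] by simp_all

lemma component_u_right:
  assumes "z \<in> carrier E"
  shows "component i j (z \<otimes>\<^bsub>SM\<^esub> (u \<bullet> \<one>\<^bsub>P\<^esub>)) = \<mu> ^ (i + j) \<odot> (component i j z \<otimes> u)"
proof (rule eq_on_pure_mon[OF kspace_axioms _ _ _ assms])
  show "linear_on E A (\<lambda>z. component i j (z \<otimes>\<^bsub>SM\<^esub> (u \<bullet> \<one>\<^bsub>P\<^esub>)))"
    by (intro linear_on_comp[OF component_linear] smash_mult_linear_left) auto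
  show "linear_on E A (\<lambda>z. \<mu> ^ (i + j) \<odot> (component i j z \<otimes> u))"
    by (intro linear_on_comp[OF linear_on_smult_left] linear_on_comp[OF linear_on_mult_right] component_linear) auto
  fix a k l assume "a \<in> carrier A" "l < n"
  then show "component i j ((a \<bullet> T.mon k l) \<otimes>\<^bsub>SM\<^esub> (u \<bullet> \<one>\<^bsub>P\<^esub>)) = \<mu> ^ (i + j) \<odot> (component i j (a \<bullet> T.mon k l) \<otimes> u)"
    using power_mod_eq[of i k]
    by (simp add: smash_right_A cross_u linear_on_smult[OF left_mult_linear] left_mult_pure
        linear_on_smult[OF component_linear] component_pure power_add)
qed

text \<open>Terms of x-degree j + 1 spill into degree j through the second summand of
  \<open>cross_v\<close>. Excluding them leaves a pure twist, whence the maximal j in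
  \<open>center_smash\<close>.\<close>

lemma component_v_right:
  assumes "z \<in> carrier E" "component i (Suc j) z = \<zero>"
  shows "component i j (z \<otimes>\<^bsub>SM\<^esub> (v \<bullet> \<one>\<^bsub>P\<^esub>)) = (lam * \<mu>) ^ (i + j) \<odot> (component i j z \<otimes> v)"
proof -
  have "component i j (z \<otimes>\<^bsub>SM\<^esub> (v \<bullet> \<one>\<^bsub>P\<^esub>)) = (lam * \<mu>) ^ (i + j) \<odot> (component i j z \<otimes> v)
    \<oplus> (\<mu> ^ i * crossc (Suc j)) \<odot> (component i (Suc j) z \<otimes> u)"
  proof (rule eq_on_pure_mon[OF kspace_axioms _ _ _ assms(1)])
    show "linear_on E A (\<lambda>z. component i j (z \<otimes>\<^bsub>SM\<^esub> (v \<bullet> \<one>\<^bsub>P\<^esub>)))"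
      by (intro linear_on_comp[OF component_linear] smash_mult_linear_left) auto
    show "linear_on E A (\<lambda>z. (lam * \<mu>) ^ (i + j) \<odot> (component i j z \<otimes> v)
      \<oplus> (\<mu> ^ i * crossc (Suc j)) \<odot> (component i (Suc j) z \<otimes> u))"
      by (intro linear_on_add_fun linear_on_comp[OF linear_on_smult_left] linear_on_comp[OF linear_on_mult_right] component_linear) auto
    fix a k l assume a: "a \<in> carrier A" and l: "l < n"
    have c: "component i j ((a \<bullet> T.mon k l) \<otimes>\<^bsub>SM\<^esub> (v \<bullet> \<one>\<^bsub>P\<^esub>))
      = (lam * \<mu>) ^ (k + l) \<odot> component i j ((a \<otimes> v) \<bullet> T.mon k l)
        \<oplus> (\<mu> ^ k * crossc l) \<odot> component i j ((a \<otimes> u) \<bullet> T.mon k (l - 1))"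
      using a by (simp add: smash_right_A cross_v linear_on_smult[OF left_mult_linear] linear_on_add[OF left_mult_linear]
          left_mult_pure linear_on_smult[OF component_linear] linear_on_add[OF component_linear])
    show "component i j ((a \<bullet> T.mon k l) \<otimes>\<^bsub>SM\<^esub> (v \<bullet> \<one>\<^bsub>P\<^esub>)) = (lam * \<mu>) ^ (i + j) \<odot> (component i j (a \<bullet> T.mon k l) \<otimes> v)
      \<oplus> (\<mu> ^ i * crossc (Suc j)) \<odot> (component i (Suc j) (a \<bullet> T.mon k l) \<otimes> u)"
      unfolding c using a l power_mod_eq[of i k]
      by (cases l) (auto simp: component_pure power_add power_mult_distrib mult_ac simp del: crossc.simps(2))
  qed
  then show ?thesis using assms by simp
qed

lemma center_smash: "alg_center SM = (\<lambda>a. a \<bullet> \<one>\<^bsub>P\<^esub>) ` Inv"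
proof (intro equalityI subsetI)
  fix z assume "z \<in> alg_center SM"
  then have z: "z \<in> carrier E" and comm: "\<And>w. w \<in> carrier E \<Longrightarrow> z \<otimes>\<^bsub>SM\<^esub> w = w \<otimes>\<^bsub>SM\<^esub> z"
    by (auto simp: alg_center_def carrier_smash)
  have key: "j = 0 \<and> (act T.x (component i j z) = \<zero> \<longrightarrow> n dvd i)"
    if j: "j < n" "component i j z \<noteq> \<zero>" and top: "component i (Suc j) z = \<zero>" for i j
  proof -
    have 1: "u \<otimes> component i j z = \<mu> ^ (i + j) \<odot> (component i j z \<otimes> u)"
      using comm[of "u \<bullet> \<one>\<^bsub>P\<^esub>"] component_u_right[OF z, of i j] component_A_left[OF u z, of i j] by simp
    have 2: "v \<otimes> component i j z = (lam * \<mu>) ^ (i + j) \<odot> (component i j z \<otimes> v)"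
      using comm[of "v \<bullet> \<one>\<^bsub>P\<^esub>"] component_v_right[OF z top] component_A_left[OF v z, of i j] by simp
    have 3: "act T.g (component i j z) = lam ^ j \<odot> component i j z"
      using comm[of "\<one> \<bullet> T.g"] component_g_left[OF z, of i j] component_g_right[OF z, of i j] by simp
    show ?thesis using twisted_commuting[OF _ j(2,1) 1 2 3] z by auto
  qed
  have zero: "component i j z = \<zero>" if "i < n" "j < n" "(i, j) \<noteq> (0, 0)" for i j
  proof (rule ccontr)
    let ?J = "{j. j < n \<and> component i j z \<noteq> \<zero>}"
    assume "component i j z \<noteq> \<zero>"
    then have J: "finite ?J" "j \<in> ?J" using that by auto
    define m where "m = Max ?J"
    have m: "m \<in> ?J" unfolding m_def using J by (intro Max_in) auto
    \<comment> \<open>Components with j \<ge> n are zero, so m + 1 = n is no exception.\<close>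
    have "component i (Suc m) z = \<zero>"
    proof (cases "Suc m < n")
      case True
      have "Suc m \<notin> ?J" using Max_ge[OF J(1), of "Suc m", folded m_def] by auto
      then show ?thesis using True by simp
    next
      case False
      then show ?thesis using component_eq_zero[OF z] by simp
    qed
    with m have k: "m = 0 \<and> (act T.x (component i m z) = \<zero> \<longrightarrow> n dvd i)" using key[of m i] by auto
    \<comment> \<open>As m = 0, only degree 0 is left for this i, and there commuting with x
      supplies the premise of the second half of \<open>key\<close>.\<close>
    have "act T.x (component i 0 z) = \<zero>"
      using comm[of "\<one> \<bullet> T.x"] component_x_left[OF z, of i] component_x_right[OF z, of i] by simp
    with k have "n dvd i" by auto
    then have "i = 0" using that(1) by (auto dest: dvd_imp_le)
    moreover have "j = 0" using Max_ge[OF J] k by (simp add: m_def)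
    ultimately show False using that(3) by simp
  qed
  let ?b = "component 0 0 z"
  have "act T.g ?b = ?b"
  proof -
    have "act T.g ?b = lam ^ 0 \<odot> ?b"
      using comm[of "\<one> \<bullet> T.g"] component_g_left[OF z, of 0 0] component_g_right[OF z, of 0 0] by simp
    then show ?thesis using z by simp
  qed
  moreover have "act T.x ?b = \<zero>"
    using comm[of "\<one> \<bullet> T.x"] component_x_left[OF z, of 0] component_x_right[OF z, of 0] by simp
  ultimately have b: "?b \<in> Inv" using z by (simp add: Inv_def)
  have zp: "\<zero> \<bullet> h = \<zero>\<^bsub>E\<^esub>" if "h \<in> carrier P" for h
    using linear_on_zero[OF S.T.kspace_axioms pure_lin(2)[OF that]] .
  have "z = (\<Oplus>\<^bsub>E\<^esub>p\<in>{..<n} \<times> {..<n}. component (fst p) (snd p) z \<bullet> T.mon (fst p) (snd p))"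
    by (rule component_expansion[OF z])
  also have "\<dots> = (\<Oplus>\<^bsub>E\<^esub>p\<in>{..<n} \<times> {..<n}. if (0, 0) = p then component (fst p) (snd p) z \<bullet> T.mon (fst p) (snd p) else \<zero>\<^bsub>E\<^esub>)"
  proof (intro S.T.finsum_cong' refl)
    fix p assume "p \<in> {..<n} \<times> {..<n}"
    then show "component (fst p) (snd p) z \<bullet> T.mon (fst p) (snd p)
      = (if (0, 0) = p then component (fst p) (snd p) z \<bullet> T.mon (fst p) (snd p) else \<zero>\<^bsub>E\<^esub>)"
      using zero[of "fst p" "snd p"] by (cases "p = (0, 0)") (simp_all add: zp mem_Times_iff)
  qed (use z in auto)
  also have "\<dots> = ?b \<bullet> \<one>\<^bsub>P\<^esub>"
    using z n by (subst S.T.finsum_singleton) (auto simp: T.mon_0_0)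
  finally show "z \<in> (\<lambda>a. a \<bullet> \<one>\<^bsub>P\<^esub>) ` Inv" using b by (rule image_eqI)
next
  fix z assume "z \<in> (\<lambda>a. a \<bullet> \<one>\<^bsub>P\<^esub>) ` Inv"
  then obtain a where a: "a \<in> Inv" and z: "z = a \<bullet> \<one>\<^bsub>P\<^esub>" by auto
  have aA: "a \<in> carrier A" "act T.g a = a" "act T.x a = \<zero>" using a by (auto simp: Inv_def)
  have zE: "z \<in> carrier E" using aA z by simp
  \<comment> \<open>An invariant a is central in A by \<open>Inv_central\<close> and passes every h
    unchanged by \<open>cross_invariant\<close>.\<close>
  have "z \<otimes>\<^bsub>SM\<^esub> w = w \<otimes>\<^bsub>SM\<^esub> z" if w: "w \<in> carrier E" for w
  proof (rule S.T.linear_on_eqI[OF S.T.kspace_axioms smash_mult_linear_right[OF zE] smash_mult_linear_left[OF zE]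
        S.spans_pure _ w])
    fix s assume "s \<in> {b \<bullet> h | b h. b \<in> carrier A \<and> h \<in> carrier P}"
    then obtain b h where s: "s = b \<bullet> h" "b \<in> carrier A" "h \<in> carrier P" by auto
    then show "z \<otimes>\<^bsub>SM\<^esub> s = s \<otimes>\<^bsub>SM\<^esub> z"
      using aA Inv_central[OF a, of b] by (simp add: z smash_left_A smash_right_A cross_invariant left_mult_pure)
  qed
  then show "z \<in> alg_center SM" using zE by (simp add: alg_center_def carrier_smash)
qed

theorem center_and_invariants:
  "alg_center SM = (\<lambda>a. a \<bullet> \<one>\<^bsub>P\<^esub>) ` invariants T.H A act"
  "invariants T.H A act = gen_subalgebra A {u [^] n, v [^] n}"
  using center_smash Inv_eq invariants_eq by (auto simp: Inv_def)

end

section \<open>Reduction of linear actions to the normal form\<close>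

text \<open>The annihilator of A is an ideal; once it contains x, it contains the nonzero Hopf ideal
  generated by x.\<close>

lemma (in taft_action) not_inner_faithful:
  assumes "\<And>r. r \<in> carrier A \<Longrightarrow> act T.x r = \<zero>\<^bsub>A\<^esub>"
  shows "\<not> inner_faithful T.H A act"
proof -
  let ?K = "{h \<in> carrier P. \<forall>r\<in>carrier A. act h r = \<zero>\<^bsub>A\<^esub>}"
  have act0: "act \<zero>\<^bsub>P\<^esub> r = \<zero>\<^bsub>A\<^esub>" if "r \<in> carrier A" for r
    using T.P.linear_on_zero[OF A.kspace_axioms linear_act_left[OF that]] .
  have act0': "act h \<zero>\<^bsub>A\<^esub> = \<zero>\<^bsub>A\<^esub>" if "h \<in> carrier P" for h
    using A.linear_on_zero[OF A.kspace_axioms linear_act_right[OF that]] .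
  have "ideal ?K P"
  proof (rule T.P.subspace_ideal)
    show "subspace_of ?K P"
      using linear_on_add[OF linear_act_left] linear_on_smult[OF linear_act_left]
      by (intro subspace_ofI) (auto simp: act0)
  qed (auto simp: act_mult' act0')
  then have "Idl\<^bsub>P\<^esub> {T.x} \<subseteq> ?K"
    by (rule T.P.genideal_minimal) (simp add: assms)
  then have "\<forall>h\<in>Idl\<^bsub>P\<^esub> {T.x}. \<forall>r\<in>carrier A. act h r = \<zero>\<^bsub>A\<^esub>" by blast
  moreover have "Idl\<^bsub>P\<^esub> {T.x} \<noteq> {\<zero>\<^bsub>T.H\<^esub>}"
    using T.P.genideal_self[of "{T.x}"] T.x_neq_zero by fastforce
  ultimately show ?thesis
    unfolding inner_faithful_def using T.hopf_ideal_genideal_x by blast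
qed

lemma has_mult_order_inverse:
  assumes "has_mult_order (q :: 'k::field) n"
  shows "has_mult_order (1 / q) n"
  using assms has_mult_order_neq_0[OF assms] by (auto simp: has_mult_order_def power_divide)

locale taft_weyl = weyl_basis A u v \<mu> \<epsilon> \<psi> + taft_action n lam A act
  for n and lam :: "'k::field_char_0" and A :: "('k, 'a) module" (structure) and act u v \<mu> \<epsilon> \<psi> +
  assumes mu_order: "has_mult_order \<mu> n"
    and linear: "linear_action A {T.g, T.x} {u, v} act"
    and faithful: "inner_faithful T.H A act"
begin

abbreviation "G \<equiv> act T.g"
abbreviation "X \<equiv> act T.x"

lemma linear_form: "\<exists>a b. act h w = a \<odot> u \<oplus> b \<odot> v" if h: "h = T.g \<or> h = T.x" and w: "w = u \<or> w = v"
proof -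
  let ?U = "{a \<odot> u \<oplus> b \<odot> v | a b. True}"
  have "subspace_of ?U A"
  proof (rule subspace_ofI)
    show "\<zero> \<in> ?U" by (intro CollectI exI[of _ 0]) simp
  next
    fix y z assume "y \<in> ?U" "z \<in> ?U"
    then obtain a b a' b' where y: "y = a \<odot> u \<oplus> b \<odot> v" "z = a' \<odot> u \<oplus> b' \<odot> v" by auto
    show "y \<oplus> z \<in> ?U"
      unfolding y by (intro CollectI exI[of _ "a + a'"] exI[of _ "b + b'"]) (simp add: smult_l_distr a_ac)
  next
    fix d y assume "y \<in> ?U"
    then obtain a b where y: "y = a \<odot> u \<oplus> b \<odot> v" by auto
    show "d \<odot> y \<in> ?U"
      unfolding y by (intro CollectI exI[of _ "d * a"] exI[of _ "d * b"]) (simp add: smult_r_distr smult_smult)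
  qed auto
  moreover have "u = 1 \<odot> u \<oplus> 0 \<odot> v" "v = 0 \<odot> u \<oplus> 1 \<odot> v" by simp_all
  then have "{u, v} \<subseteq> ?U" by blast
  ultimately have "lin_span A {u, v} \<subseteq> ?U" by (rule lin_span_minimal)
  moreover have "act h w \<in> lin_span A {u, v}" using linear h w by (auto simp: linear_action_def)
  ultimately show ?thesis by auto
qed

lemma psi_linear_form:
  "\<psi> 1 0 (a \<odot> u \<oplus> b \<odot> v) = a" "\<psi> 0 1 (a \<odot> u \<oplus> b \<odot> v) = b"
proof -
  have "u = mon 1 0" "v = mon 0 1" by (simp_all add: mon_def)
  then have "\<psi> p q u = (if p = 1 \<and> q = 0 then 1 else 0)" "\<psi> p q v = (if p = 0 \<and> q = 1 then 1 else 0)" for p q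
    by (metis psi_mon)+
  then show "\<psi> 1 0 (a \<odot> u \<oplus> b \<odot> v) = a" "\<psi> 0 1 (a \<odot> u \<oplus> b \<odot> v) = b" by (simp_all add: psi_add psi_smult)
qed

text \<open>Quadratic coefficients do not see \<epsilon>: reordering vu gives the factor 1/\<mu> and
  otherwise changes only the constant term.\<close>

lemma psi_product:
  shows "\<psi> 2 0 ((a \<odot> u \<oplus> b \<odot> v) \<otimes> (a' \<odot> u \<oplus> b' \<odot> v)) = a * a'"
    and "\<psi> 0 2 ((a \<odot> u \<oplus> b \<odot> v) \<otimes> (a' \<odot> u \<oplus> b' \<odot> v)) = b * b'"
    and "\<psi> 1 1 ((a \<odot> u \<oplus> b \<odot> v) \<otimes> (a' \<odot> u \<oplus> b' \<odot> v)) = a * b' + b * a' / \<mu>"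
proof -
  have uu: "u \<otimes> u = mon 2 0" "v \<otimes> v = mon 0 2" and uv: "u \<otimes> v = mon 1 1" by (simp_all add: mon_def numeral_2_eq_2)
  have "(a \<odot> u \<oplus> b \<odot> v) \<otimes> (a' \<odot> u \<oplus> b' \<odot> v)
    = (a * a') \<odot> mon 2 0 \<oplus> (a * b') \<odot> mon 1 1 \<oplus> (b * a') \<odot> (v \<otimes> u) \<oplus> (b * b') \<odot> mon 0 2"
    by (simp add: l_distr r_distr smult_mult_left smult_mult_right smult_smult smult_r_distr uu uv a_ac mult.commute)
  moreover have "v \<otimes> u = (1 / \<mu>) \<odot> mon 1 1 \<oplus> (- \<epsilon> / \<mu>) \<odot> mon 0 0"
    unfolding vu uv by (simp add: mon_0_0)
  ultimately show "\<psi> 2 0 ((a \<odot> u \<oplus> b \<odot> v) \<otimes> (a' \<odot> u \<oplus> b' \<odot> v)) = a * a'"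
    "\<psi> 0 2 ((a \<odot> u \<oplus> b \<odot> v) \<otimes> (a' \<odot> u \<oplus> b' \<odot> v)) = b * b'"
    "\<psi> 1 1 ((a \<odot> u \<oplus> b \<odot> v) \<otimes> (a' \<odot> u \<oplus> b' \<odot> v)) = a * b' + b * a' / \<mu>"
    by (simp_all add: psi_simps)
qed

text \<open>A skew derivation that vanishes on u and v vanishes on all monomials, contrary to inner
  faithfulness.\<close>

lemma X_nonzero: "\<not> (X u = \<zero> \<and> X v = \<zero>)"
proof
  assume 0: "X u = \<zero> \<and> X v = \<zero>"
  have pow: "X (w [^] k) = \<zero>" if "w \<in> carrier A" "X w = \<zero>" for w and k :: nat
    using that by (induction k) (simp_all add: act_x_one act_x_mult)
  have "X r = \<zero>" if "r \<in> carrier A" for r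
  proof (rule linear_on_eqI[OF kspace_axioms linear_act_right linear_on_const_zero spans_mon _ that])
    fix s assume "s \<in> range (\<lambda>(i, j). mon i j)"
    then show "X s = \<zero>" using 0 by (auto simp: mon_def act_x_mult pow)
  qed simp
  then show False using not_inner_faithful faithful by auto
qed

lemma act_simps:
  "w \<in> carrier A \<Longrightarrow> w' \<in> carrier A \<Longrightarrow> G (w \<oplus> w') = G w \<oplus> G w'" "w \<in> carrier A \<Longrightarrow> G (d \<odot> w) = d \<odot> G w"
  "w \<in> carrier A \<Longrightarrow> w' \<in> carrier A \<Longrightarrow> X (w \<oplus> w') = X w \<oplus> X w'" "w \<in> carrier A \<Longrightarrow> X (d \<odot> w) = d \<odot> X w"
  using linear_on_add[OF linear_act_right] linear_on_smult[OF linear_act_right] by simp_all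

lemma X_G: "w \<in> carrier A \<Longrightarrow> X (G w) = lam \<odot> G (X w)"
  using act_mult'[of T.x T.g w] act_mult'[of T.g T.x w] linear_on_smult[OF linear_act_left, of w "T.g \<otimes>\<^bsub>P\<^esub> T.x" lam]
  by (simp add: T.relations(3))

lemma G_inj:
  assumes "w \<in> carrier A" "G w = \<zero>"
  shows "w = \<zero>"
proof -
  let ?h = "T.g [^]\<^bsub>P\<^esub> (n - 1)"
  have "?h \<otimes>\<^bsub>P\<^esub> T.g = T.g [^]\<^bsub>P\<^esub> Suc (n - 1)" by simp
  then have "?h \<otimes>\<^bsub>P\<^esub> T.g = \<one>\<^bsub>P\<^esub>" using T.n T.relations(1) by simp
  then have "w = act ?h (G w)" using assms(1) act_mult'[of ?h T.g w] by (simp add: act_one')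
  also have "\<dots> = \<zero>" unfolding assms(2) using linear_on_zero[OF kspace_axioms linear_act_right] by simp
  finally show ?thesis .
qed

lemma G_nonzero:
  assumes "G w = a \<odot> u \<oplus> b \<odot> v" "w = u \<or> w = v"
  shows "a \<noteq> 0 \<or> b \<noteq> 0"
proof (rule ccontr)
  assume "\<not> ?thesis"
  then have "G w = \<zero>" using assms(1) by simp
  then have "w = \<zero>" using G_inj assms(2) by auto
  moreover have "w = 1 \<odot> u \<oplus> 0 \<odot> v \<or> w = 0 \<odot> u \<oplus> 1 \<odot> v" using assms(2) by auto
  ultimately show False using psi_linear_form psi_zero by (metis zero_neq_one)
qed

lemma mu_neq_1: "\<mu> \<noteq> 1"
  using mu_order T.n by (auto simp: has_mult_order_def)

lemma lam_neq_1: "lam \<noteq> 1"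
  using T.q T.n by (auto simp: has_mult_order_def)

lemma order_two:
  assumes "has_mult_order q n" "q * q = (1 :: 'k)"
  shows "n = 2" "q = - 1"
proof -
  have "n dvd 2" using has_mult_order_power_eq_1_iff[OF assms(1), of 2] assms(2) by (simp add: power2_eq_square)
  then show "n = 2" using T.n by (auto dest: dvd_imp_le)
  have "q \<noteq> 1" using assms(1) T.n by (auto simp: has_mult_order_def)
  then show "q = - 1" using assms(2) by (metis square_eq_1_iff)
qed

text \<open>Excludes the last case of \<open>taft_plane_cases\<close>, in which X u and X v are both
  nonzero.\<close>

lemma X_square: "n = 2 \<Longrightarrow> w \<in> carrier A \<Longrightarrow> X (X w) = \<zero>"
proof -
  assume n2: "n = 2" and w: "w \<in> carrier A"
  have "T.x \<otimes>\<^bsub>P\<^esub> T.x = T.x [^]\<^bsub>P\<^esub> (2 :: nat)" by (simp add: numeral_2_eq_2)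
  also have "\<dots> = \<zero>\<^bsub>P\<^esub>" using T.relations(2) arg_cong[OF n2, of "\<lambda>m. T.x [^]\<^bsub>P\<^esub> m"] by (simp only:)
  finally show ?thesis
    using act_mult'[of T.x T.x w] w T.P.linear_on_zero[OF kspace_axioms linear_act_left[OF w]] by simp
qed

lemma G_relation: "G u \<otimes> G v = \<mu> \<odot> (G v \<otimes> G u) \<oplus> \<epsilon> \<odot> \<one>"
proof -
  have "G u \<otimes> G v = G (u \<otimes> v)" by (simp add: act_g_mult)
  also have "\<dots> = \<mu> \<odot> (G v \<otimes> G u) \<oplus> \<epsilon> \<odot> \<one>"
    unfolding uv by (simp add: act_simps act_g_mult act_g_one)
  finally show ?thesis .
qed

lemma X_relation: "G u \<otimes> X v \<oplus> X u \<otimes> v = \<mu> \<odot> (G v \<otimes> X u \<oplus> X v \<otimes> u)"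
proof -
  have "G u \<otimes> X v \<oplus> X u \<otimes> v = X (u \<otimes> v)" by (simp add: act_x_mult)
  also have "\<dots> = \<mu> \<odot> (G v \<otimes> X u \<oplus> X v \<otimes> u)"
    unfolding uv by (simp add: act_simps act_x_mult act_x_one)
  finally show ?thesis .
qed

text \<open>If \<open>\<mu> = - 1\<close>, a diagonalisable linear automorphism may also swap the lines spanned by \<open>u\<close> and
  \<open>v\<close>; then \<open>x\<close> is forced to act by zero.\<close>

lemma not_swap:
  assumes Gu: "G u = b \<odot> v" and Gv: "G v = e \<odot> u" and b: "b \<noteq> 0" and mu: "\<mu> = - 1" and n2: "n = 2"
  shows False
proof -
  have lam: "lam = - 1" using order_two(2)[OF T.q] T.q n2 by (simp add: has_mult_order_def power2_eq_square)
  obtain p q where Xu: "X u = p \<odot> u \<oplus> q \<odot> v" using linear_form by blast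
  obtain s t where Xv: "X v = s \<odot> u \<oplus> t \<odot> v" using linear_form by blast
  \<comment> \<open>Applying g^2 = 1 to u gives be = 1.\<close>
  have "T.g \<otimes>\<^bsub>P\<^esub> T.g = T.g [^]\<^bsub>P\<^esub> (2 :: nat)" by (simp add: numeral_2_eq_2)
  also have "\<dots> = \<one>\<^bsub>P\<^esub>" using T.relations(1) arg_cong[OF n2, of "\<lambda>m. T.g [^]\<^bsub>P\<^esub> m"] by (simp only:)
  finally have "G (G u) = u" using act_mult'[of T.g T.g u] by (simp add: act_one')
  then have "(b * e) \<odot> u \<oplus> 0 \<odot> v = 1 \<odot> u \<oplus> 0 \<odot> v" by (simp add: Gu Gv act_simps smult_smult)
  then have bc: "b * e = 1" using psi_linear_form(1)[of "b * e" 0] psi_linear_form(1)[of 1 0] by metis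
  \<comment> \<open>Comparing xg with \<open>lam\<close> gx on u expresses s and t through q and
    p.\<close>
  have "(b * s) \<odot> u \<oplus> (b * t) \<odot> v = (lam * q * e) \<odot> u \<oplus> (lam * p * b) \<odot> v"
    using X_G[OF u] by (simp add: Gu Xu Xv act_simps Gv smult_r_distr smult_smult a_comm mult_ac)
  then have "b * s = lam * q * e" "b * t = lam * p * b" using psi_linear_form by metis+
  then have "b * t = b * (- p)" and s: "b * s = - (q * e)" using lam by (simp_all add: mult.commute)
  then have t: "t = - p" using b by (metis mult_left_cancel)
  let ?f = "\<lambda>a b. a \<odot> u \<oplus> b \<odot> v"
  \<comment> \<open>All linear forms are written out with their zero coefficients so that
    \<open>psi_product\<close> matches.\<close>
  have rel: "?f 0 b \<otimes> ?f s t \<oplus> ?f p q \<otimes> ?f 0 1 = (- 1) \<odot> (?f e 0 \<otimes> ?f p q \<oplus> ?f s t \<otimes> ?f 1 0)"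
    using X_relation by (simp add: Gu Gv Xu Xv mu)
  have cl: "?f a b \<otimes> ?f a' b' \<in> carrier A" for a b a' b' by simp
  have "\<psi> i j (?f 0 b \<otimes> ?f s t) + \<psi> i j (?f p q \<otimes> ?f 0 1)
    = - (\<psi> i j (?f e 0 \<otimes> ?f p q) + \<psi> i j (?f s t \<otimes> ?f 1 0))" for i j
  proof -
    have "\<psi> i j (?f 0 b \<otimes> ?f s t \<oplus> ?f p q \<otimes> ?f 0 1)
      = \<psi> i j ((- 1) \<odot> (?f e 0 \<otimes> ?f p q \<oplus> ?f s t \<otimes> ?f 1 0))" by (simp only: rel)
    then show ?thesis by (simp only: psi_add[OF cl cl] psi_smult[OF a_closed[OF cl cl]]) simp
  qed
  \<comment> \<open>The coefficients of v^2 and uv in the image of the defining relation under x.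
    Together with the equations for s and t they give 4p = 0, hence p = 0 in characteristic
    zero.\<close>
  from this[of 0 2] this[of 1 1] have "b * t + q = 0" "- (b * s) + p = - (e * q) + t"
    by (simp_all only: psi_product mu) (simp_all add: algebra_simps)
  then have "q = b * p" "p + p = - (e * q) + b * s" using t by (simp_all add: algebra_simps)
  have "e * q = p" using bc \<open>q = b * p\<close> by (simp add: mult.assoc[symmetric] mult.commute)
  moreover from this have "b * s = - p" using s by (simp add: mult.commute)
  ultimately have "p + p = - p + - p" using \<open>p + p = _\<close> by simp
  then have "4 * p = 0" by (simp add: algebra_simps)
  then have "p = 0" by simp
  moreover from this have "q = 0" "s = 0" "t = 0" using \<open>q = b * p\<close> s t b by auto
  ultimately show False using X_nonzero Xu Xv by simp
qed

lemma G_diagonal: "\<exists>a d. G u = a \<odot> u \<and> G v = d \<odot> v \<and> a \<noteq> 0 \<and> d \<noteq> 0"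
proof -
  obtain a b where Gu: "G u = a \<odot> u \<oplus> b \<odot> v" using linear_form by blast
  obtain e d where Gv: "G v = e \<odot> u \<oplus> d \<odot> v" using linear_form by blast
  let ?f = "\<lambda>a b. a \<odot> u \<oplus> b \<odot> v"
  have "\<psi> i j (?f a b \<otimes> ?f e d) = \<mu> * \<psi> i j (?f e d \<otimes> ?f a b) + \<epsilon> * \<psi> i j \<one>" for i j
    using arg_cong[OF G_relation, of "\<psi> i j"] unfolding Gu Gv by (simp add: psi_add psi_smult)
  \<comment> \<open>The coefficients of u^2 and v^2 force ae = bd = 0 as \<mu> \<noteq> 1, that of
    uv forces be(1 - \<mu>^2) = 0. So g is diagonal or antidiagonal, the latter only if \<mu>^2 =
    1.\<close>
  from this[of 2 0] this[of 0 2] this[of 1 1]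
  have "a * e = \<mu> * (e * a)" "b * d = \<mu> * (d * b)" "a * d + b * e / \<mu> = \<mu> * (e * b + d * a / \<mu>)"
    unfolding psi_product by (simp_all add: psi_one)
  then have ac: "a * e = 0" and bd: "b * d = 0" and bc: "b * e * (1 - \<mu> * \<mu>) = 0"
    using mu_neq_1 \<mu> by (auto simp: field_simps)
  have ab: "a \<noteq> 0 \<or> b \<noteq> 0" and cd: "e \<noteq> 0 \<or> d \<noteq> 0" using G_nonzero Gu Gv by blast+
  show ?thesis
  proof (cases "b = 0")
    case True
    then have "a \<noteq> 0" "e = 0" "d \<noteq> 0" using ab ac cd by auto
    then show ?thesis using Gu Gv True by auto
  next
    case False
    then have "d = 0" "e \<noteq> 0" "a = 0" using bd cd ac by auto
    then have "\<mu> * \<mu> = 1" using bc False by auto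
    from order_two[OF mu_order this] have False
      using not_swap[of b e] Gu Gv False \<open>a = 0\<close> \<open>d = 0\<close> by simp
    then show ?thesis ..
  qed
qed

lemma taft_plane_cases:
  assumes vb: "weyl_basis A v u (1 / \<mu>) (- \<epsilon> / \<mu>) \<psi>'"
  shows "(\<exists>r. taft_plane A u v \<mu> \<epsilon> \<psi> n lam r G X) \<or> (\<exists>r. taft_plane A v u (1 / \<mu>) (- \<epsilon> / \<mu>) \<psi>' n lam r G X)"
proof -
  obtain a d where Gu: "G u = a \<odot> u" and Gv: "G v = d \<odot> v" and ad: "a \<noteq> 0" "d \<noteq> 0" using G_diagonal by blast
  obtain p q where Xu: "X u = p \<odot> u \<oplus> q \<odot> v" using linear_form by blast
  obtain s t where Xv: "X v = s \<odot> u \<oplus> t \<odot> v" using linear_form by blast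
  \<comment> \<open>In xg = \<open>lam\<close> gx the diagonal entries p and t of x acquire the
    factor \<open>lam\<close> \<noteq> 1 and must vanish.\<close>
  have "(a * p) \<odot> u \<oplus> (a * q) \<odot> v = (lam * p * a) \<odot> u \<oplus> (lam * q * d) \<odot> v"
    using X_G[OF u] by (simp add: Gu Xu act_simps Gv smult_r_distr smult_smult mult_ac)
  then have "a * p = lam * p * a" and q: "a * q = lam * q * d" using psi_linear_form by metis+
  then have p0: "p = 0" using ad lam_neq_1 by auto
  have "(d * s) \<odot> u \<oplus> (d * t) \<odot> v = (lam * s * a) \<odot> u \<oplus> (lam * t * d) \<odot> v"
    using X_G[OF v] by (simp add: Gu Xv act_simps Gv smult_r_distr smult_smult mult_ac)
  then have s: "d * s = lam * s * a" and "d * t = lam * t * d" using psi_linear_form by metis+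
  then have t0: "t = 0" using ad lam_neq_1 by auto
  have Xu: "X u = q \<odot> v" and Xv: "X v = s \<odot> u" using Xu Xv p0 t0 by simp_all
  note common = T.n T.q linear_act_right[OF T.gen_closed] act_g_mult act_x_mult act_g_one act_x_one
  let ?f = "\<lambda>a b. a \<odot> u \<oplus> b \<odot> v"
  have rel: "?f a 0 \<otimes> ?f s 0 \<oplus> ?f 0 q \<otimes> ?f 0 1 = \<mu> \<odot> (?f 0 d \<otimes> ?f 0 q \<oplus> ?f s 0 \<otimes> ?f 1 0)"
    using X_relation by (simp add: Gu Gv Xu Xv)
  have cl: "?f a b \<otimes> ?f a' b' \<in> carrier A" for a b a' b' by simp
  have rel': "\<psi> i j (?f a 0 \<otimes> ?f s 0) + \<psi> i j (?f 0 q \<otimes> ?f 0 1)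
    = \<mu> * (\<psi> i j (?f 0 d \<otimes> ?f 0 q) + \<psi> i j (?f s 0 \<otimes> ?f 1 0))" for i j
    using arg_cong[OF rel, of "\<psi> i j"] by (simp only: psi_add[OF cl cl] psi_smult[OF a_closed[OF cl cl]])
  \<comment> \<open>The u^2 and v^2 coefficients fix the eigenvalues of g: a = \<mu> if s \<noteq>
    0, and d = 1/\<mu> if q \<noteq> 0.\<close>
  have as: "a * s = \<mu> * s" using rel'[of 2 0] unfolding psi_product by simp
  have dq: "q = \<mu> * d * q" using rel'[of 0 2] unfolding psi_product by simp
  consider "q = 0" "s \<noteq> 0" | "q \<noteq> 0" "s = 0" | "q \<noteq> 0" "s \<noteq> 0" using X_nonzero Xu Xv by (cases "q = 0"; cases "s = 0") auto
  then show ?thesis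
  proof cases
    case 1
    then have "a = \<mu>" "d = lam * \<mu>" using as s by auto
    then have "taft_plane A u v \<mu> \<epsilon> \<psi> n lam s G X"
      using 1 Gu Gv Xu Xv common mu_order
      by (intro taft_plane.intro weyl_basis_axioms taft_plane_axioms.intro) simp_all
    then show ?thesis by blast
  next
    case 2
    \<comment> \<open>Here v takes the part of u, with 1/\<mu> in place of \<mu>.\<close>
    then have d: "d = 1 / \<mu>" using dq \<mu> by (auto simp: field_simps)
    have "a * q = (lam * d) * q" using q by (simp add: mult_ac)
    then have "a = lam * d" using 2(1) by (metis mult_right_cancel)
    then have "a = lam * (1 / \<mu>)" unfolding d .
    then have "taft_plane A v u (1 / \<mu>) (- \<epsilon> / \<mu>) \<psi>' n lam q G X"
      using 2 Gu Gv Xu Xv d common has_mult_order_inverse[OF mu_order]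
      by (intro taft_plane.intro vb taft_plane_axioms.intro) simp_all
    then show ?thesis by blast
  next
    case 3
    \<comment> \<open>The two eigenvalue equations give lam^2 = 1 and n = 2, so x^2 = 0, whereas x^2
      multiplies u by qs.\<close>
    then have "a = lam * d" "d = lam * a" using q s by auto
    then have "lam * lam = 1" using ad by (metis mult.assoc mult_cancel_right1)
    then have "n = 2" by (rule order_two(1)[OF T.q])
    then have "X (X u) = \<zero>" by (rule X_square) simp
    then have "(q * s) \<odot> u \<oplus> 0 \<odot> v = \<zero>" by (simp add: Xu Xv act_simps smult_smult)
    then have "q * s = 0" using psi_linear_form(1)[of "q * s" 0] psi_zero by metis
    then show ?thesis using 3 by simp
  qed
qed

text \<open>Exchanging u and v does not change the subalgebra generated by u^n and v^n, so both
  normal forms yield one statement.\<close>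

lemma center_and_invariants:
  assumes vb: "weyl_basis A v u (1 / \<mu>) (- \<epsilon> / \<mu>) \<psi>'"
  shows "alg_center SM = (\<lambda>a. a \<bullet> \<one>\<^bsub>P\<^esub>) ` invariants T.H A act"
    and "invariants T.H A act = gen_subalgebra A {u [^] n, v [^] n}"
  using taft_plane_cases[OF vb] taft_plane_action.center_and_invariants[OF taft_plane_action.intro[OF _ taft_action_axioms]]
  by (auto simp: insert_commute)

end

theorem corollary2p15:
  fixes n :: nat
    and lam \<mu> :: "'k::{alg_closed_field, field_char_0}"
    and R :: "(plane_sym list \<Rightarrow>\<^sub>0 'k) set"
    and A :: "('k, (plane_sym list \<Rightarrow>\<^sub>0 'k) set) module"
    and u v :: "(plane_sym list \<Rightarrow>\<^sub>0 'k) set"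
    and H :: "('k, (taft_sym list \<Rightarrow>\<^sub>0 'k) set) hopf_alg"
    and g x :: "(taft_sym list \<Rightarrow>\<^sub>0 'k) set"
    and act :: "(taft_sym list \<Rightarrow>\<^sub>0 'k) set
      \<Rightarrow> (plane_sym list \<Rightarrow>\<^sub>0 'k) set \<Rightarrow> (plane_sym list \<Rightarrow>\<^sub>0 'k) set"
  assumes n: "n > 1"
    and lam: "has_mult_order lam n"
    and H: "H = taft_hopf n lam" and g: "g = taft_g n lam" and x: "x = taft_x n lam"
    and mu: "\<mu> \<noteq> 0"
    and R: "R = quantum_plane_rels \<mu> \<or> R = quantum_weyl_rels \<mu>"
    and A: "A = presented_alg R" and u: "u = presented_gen R SymU" and v: "v = presented_gen R SymV"
    and action: "hopf_action H A act"
    and linear: "linear_action A {g, x} {u, v} act"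
    and faithful: "inner_faithful H A act"
    and order: "has_mult_order \<mu> n"
  shows "alg_center (smash_product A H act) = (\<lambda>r. pure_tensor A H r \<one>\<^bsub>H\<^esub>) ` invariants H A act
    \<and> invariants H A act = gen_subalgebra A {u [^]\<^bsub>A\<^esub> n, v [^]\<^bsub>A\<^esub> n}"
proof -
  \<comment> \<open>\<epsilon> is 0 for the quantum plane and 1 for the quantum Weyl algebra; from
    here on the two cases are one.\<close>
  obtain \<epsilon> where R': "R = weyl_rels \<mu> \<epsilon>"
  proof -
    have "quantum_plane_rels \<mu> = weyl_rels \<mu> 0" "quantum_weyl_rels \<mu> = weyl_rels \<mu> 1"
      by (simp_all add: quantum_plane_rels_def quantum_weyl_rels_def weyl_rels_def)
    then show thesis using R that by metis
  qed
  interpret W: weyl_presentation \<mu> \<epsilon> by unfold_locales (rule mu)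
  obtain \<psi> where psi: "weyl_basis A u v \<mu> \<epsilon> \<psi>"
    using W.weyl_basis_uv unfolding A u v R' by blast
  obtain \<psi>' where psi': "weyl_basis A v u (1 / \<mu>) (- \<epsilon> / \<mu>) \<psi>'"
    using W.weyl_basis_vu unfolding A u v R' by blast
  have "taft n lam" using n lam by unfold_locales
  moreover have "kalgebra A" unfolding A R' by (rule W.P.kalgebra_axioms)
  ultimately have "taft_action n lam A act"
    using action unfolding H by (rule taft_action.intro)
  then interpret taft_weyl n lam A act u v \<mu> \<epsilon> \<psi>
    using psi order linear faithful unfolding g x H by (intro taft_weyl.intro taft_weyl_axioms.intro)
  show ?thesis
    using center_and_invariants[OF psi'] unfolding H by simp
qed

end
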